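(* Let $X$ and $Y$ be Banach spaces over $\mathbb K\in\{\mathbb R,\mathbb C\}$. If $X^*$ and $Y^*$ are separable, then $\ker(J)$ is a proximinal subspace of $X^*\widehat\otimes_\pi Y^*$, where $J\colon X^*\widehat\otimes_\pi Y^*\to\mathcal N(X,Y^* )$ is the canonical map.
   Context: $X^*\widehat\otimes_\pi Y^*$ is the projective tensor product, i.e. the completion of $X^*\otimes Y^*$ under $\|z\|_\pi=\inf\{\sum_{i=1}^n\|x_i^*\|\|y_i^*\|:z=\sum_{i=1}^nx_i^*\otimes y_i^*\}$. $\mathcal N(X,Y^* )$ is the space of nuclear operators, i.e. operators of the form $Tx=\sum_{i=1}^\infty x_i^*(x)y_i^*$ with $x_i^*\in X^*$, $y_i^*\in Y^*$, $\sum_i\|x_i^*\|\|y_i^*\|<\infty$, normed by the infimum $\|T\|_{\mathrm{nu}}$ of $\sum_i\|x_i^*\|\|y_i^*\|$ over all such representations. The canonical map $J\colon X^*\widehat\otimes_\pi Y^*\to\mathcal N(X,Y^* )$ is $J(\sum_{i=1}^\infty x_i^*\otimes y_i^* )(x)=\sum_{i=1}^\infty x_i^*(x)y_i^*$. A subspace $W$ of a Banach space $Z$ is proximinal in $Z$ if for every $z\in Z$ the distance $\mathrm{dist}(z,W)=\inf\{\|z-w\|:w\in W\}$ is attained at some $w\in W$. *)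

theory Defs
  imports "HOL-Analysis.Analysis"
begin

section \<open>Scalars and Banach spaces over them\<close>

text \<open>The scalar fields \<open>\<real>\<close> and \<open>\<complex>\<close>, treated uniformly. An isometric field embedding into
  \<^typ>\<open>complex\<close> that fixes \<open>\<real>\<close> has a subfield of \<open>\<complex>\<close> containing \<open>\<real>\<close> as its range, i.e. \<open>\<real>\<close> or
  \<open>\<complex>\<close>; hence up to isometric isomorphism \<^typ>\<open>real\<close> and \<^typ>\<open>complex\<close> are the only instances.\<close>

class real_or_complex = real_normed_field + banach +
  assumes embeds_into_complex:
    "\<exists>\<phi> :: 'a \<Rightarrow> complex.
       (\<forall>a b. \<phi> (a + b) = \<phi> a + \<phi> b) \<and>
       (\<forall>a b. \<phi> (a * b) = \<phi> a * \<phi> b) \<and>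
       (\<forall>r. \<phi> (r *\<^sub>R 1) = complex_of_real r) \<and>
       (\<forall>a. norm (\<phi> a) = norm a)"

instance real :: real_or_complex
  by standard (rule exI[of _ complex_of_real], simp)

instance complex :: real_or_complex
  by standard (rule exI[of _ id], simp add: scaleR_conv_of_real)

text \<open>The type class provides completeness and the norm; the locale adds a multiplication by scalars
  from \<open>'k\<close> that extends the real one and is compatible with the norm. For \<open>'k = real\<close> it is
  necessarily \<^term>\<open>(*\<^sub>R)\<close>.\<close>

locale banach_space_over = vector_space scale
  for scale :: "'k::real_or_complex \<Rightarrow> 'a::banach \<Rightarrow> 'a" +
  assumes scale_of_real: "scale (of_real r) x = r *\<^sub>R x"
    and norm_scale: "norm (scale c x) = norm c * norm x"

lemma banach_space_over_scaleR: "banach_space_over ((*\<^sub>R) :: real \<Rightarrow> 'a::banach \<Rightarrow> 'a)"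
  by unfold_locales (simp_all add: scaleR_add_right scaleR_add_left)

lemma banach_space_over_mult: "banach_space_over ((*) :: 'k::real_or_complex \<Rightarrow> 'k \<Rightarrow> 'k)"
  by unfold_locales (simp_all add: distrib_left distrib_right mult.assoc norm_mult scaleR_conv_of_real)


section \<open>Dual spaces\<close>

text \<open>Only the \<open>'k\<close>-linear functionals; the norm is the operator norm of \<^typ>\<open>'a \<Rightarrow>\<^sub>L 'k\<close>.\<close>

definition dual ::
  "('k::real_or_complex \<Rightarrow> 'a::banach \<Rightarrow> 'a) \<Rightarrow> ('a \<Rightarrow>\<^sub>L 'k) set" where
  "dual sX = {f. \<forall>c x. blinfun_apply f (sX c x) = c * blinfun_apply f x}"

definition dual_scale ::
  "'k::real_or_complex \<Rightarrow> ('a::banach \<Rightarrow>\<^sub>L 'k) \<Rightarrow> ('a \<Rightarrow>\<^sub>L 'k)" where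
  "dual_scale c f = blinfun_mult_right c o\<^sub>L f"


section \<open>Normed spaces with an explicit carrier, and their completion\<close>

record ('k, 'v) normed_structure =
  vcarrier :: "'v set"
  vzero :: 'v
  vadd :: "'v \<Rightarrow> 'v \<Rightarrow> 'v"
  vscale :: "'k \<Rightarrow> 'v \<Rightarrow> 'v"
  vnorm :: "'v \<Rightarrow> real"

definition vdist :: "('k::real_or_complex, 'v) normed_structure \<Rightarrow> 'v \<Rightarrow> 'v \<Rightarrow> real" where
  "vdist E u v = vnorm E (vadd E u (vscale E (- 1) v))"

primrec vpartial_sum ::
  "('k::real_or_complex, 'v) normed_structure \<Rightarrow> (nat \<Rightarrow> 'v) \<Rightarrow> nat \<Rightarrow> 'v" where
  "vpartial_sum E a 0 = vzero E"
| "vpartial_sum E a (Suc n) = vadd E (vpartial_sum E a n) (a n)"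

definition vsums ::
  "('k::real_or_complex, 'v) normed_structure \<Rightarrow> (nat \<Rightarrow> 'v) \<Rightarrow> 'v \<Rightarrow> bool" where
  "vsums E a s \<longleftrightarrow> (\<lambda>n. vdist E (vpartial_sum E a n) s) \<longlonglongrightarrow> 0"

definition vsubspace :: "('k::real_or_complex, 'v) normed_structure \<Rightarrow> 'v set \<Rightarrow> bool" where
  "vsubspace E W \<longleftrightarrow> W \<subseteq> vcarrier E \<and> vzero E \<in> W \<and>
     (\<forall>u\<in>W. \<forall>v\<in>W. vadd E u v \<in> W) \<and> (\<forall>c. \<forall>u\<in>W. vscale E c u \<in> W)"

definition proximinal_subspace ::
  "('k::real_or_complex, 'v) normed_structure \<Rightarrow> 'v set \<Rightarrow> bool" where
  "proximinal_subspace E W \<longleftrightarrow> vsubspace E W \<and>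
     (\<forall>z\<in>vcarrier E. \<exists>w\<in>W. vdist E z w = (INF w'\<in>W. vdist E z w'))"

definition vcauchy :: "('k::real_or_complex, 'v) normed_structure \<Rightarrow> (nat \<Rightarrow> 'v) set" where
  "vcauchy E = {u. (\<forall>n. u n \<in> vcarrier E) \<and>
     (\<forall>e>0. \<exists>M. \<forall>m\<ge>M. \<forall>n\<ge>M. vdist E (u m) (u n) < e)}"

definition vnull_rel ::
  "('k::real_or_complex, 'v) normed_structure \<Rightarrow> ((nat \<Rightarrow> 'v) \<times> (nat \<Rightarrow> 'v)) set" where
  "vnull_rel E = {(u, v). u \<in> vcauchy E \<and> v \<in> vcauchy E \<and> (\<lambda>n. vdist E (u n) (v n)) \<longlonglongrightarrow> 0}"

text \<open>Cauchy sequences modulo null sequences.\<close>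

definition completion ::
  "('k::real_or_complex, 'v) normed_structure \<Rightarrow> ('k, (nat \<Rightarrow> 'v) set) normed_structure" where
  "completion E = \<lparr>
     vcarrier = vcauchy E // vnull_rel E,
     vzero = vnull_rel E `` {\<lambda>_. vzero E},
     vadd = (\<lambda>U V. \<Union>u\<in>U. \<Union>v\<in>V. vnull_rel E `` {\<lambda>n. vadd E (u n) (v n)}),
     vscale = (\<lambda>c U. \<Union>u\<in>U. vnull_rel E `` {\<lambda>n. vscale E c (u n)}),
     vnorm = (\<lambda>U. THE r. \<forall>u\<in>U. (\<lambda>n. vnorm E (u n)) \<longlonglongrightarrow> r) \<rparr>"

definition into_completion ::
  "('k::real_or_complex, 'v) normed_structure \<Rightarrow> 'v \<Rightarrow> (nat \<Rightarrow> 'v) set" where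
  "into_completion E v = vnull_rel E `` {\<lambda>_. v}"


section \<open>The projective tensor product of the duals\<close>

text \<open>\<open>X\<^sup>* \<otimes> Y\<^sup>*\<close> is realised as usual inside the algebraic dual of the space of all (not necessarily
  bounded) \<open>'k\<close>-bilinear forms on \<open>X\<^sup>* \<times> Y\<^sup>*\<close>, with \<open>f \<otimes> g\<close> the evaluation at \<open>(f, g)\<close>. Forms are
  total functions of which only the values on \<open>X\<^sup>* \<times> Y\<^sup>*\<close> matter; tensors are set to \<open>0\<close> at arguments
  that are not bilinear forms, so that equality of tensors is equality of functions.\<close>

definition bilinear_forms ::
  "('k::real_or_complex \<Rightarrow> 'a::banach \<Rightarrow> 'a) \<Rightarrow> ('k \<Rightarrow> 'b::banach \<Rightarrow> 'b) \<Rightarrow>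
     (('a \<Rightarrow>\<^sub>L 'k) \<Rightarrow> ('b \<Rightarrow>\<^sub>L 'k) \<Rightarrow> 'k) set" where
  "bilinear_forms sX sY = {B.
     (\<forall>f\<in>dual sX. \<forall>f'\<in>dual sX. \<forall>g\<in>dual sY. B (f + f') g = B f g + B f' g) \<and>
     (\<forall>f\<in>dual sX. \<forall>g\<in>dual sY. \<forall>g'\<in>dual sY. B f (g + g') = B f g + B f g') \<and>
     (\<forall>c. \<forall>f\<in>dual sX. \<forall>g\<in>dual sY.
        B (dual_scale c f) g = c * B f g \<and> B f (dual_scale c g) = c * B f g)}"

type_synonym ('a, 'b, 'k) tensor = "(('a \<Rightarrow>\<^sub>L 'k) \<Rightarrow> ('b \<Rightarrow>\<^sub>L 'k) \<Rightarrow> 'k) \<Rightarrow> 'k"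

definition elem_tensor ::
  "('k::real_or_complex \<Rightarrow> 'a::banach \<Rightarrow> 'a) \<Rightarrow> ('k \<Rightarrow> 'b::banach \<Rightarrow> 'b) \<Rightarrow>
     ('a \<Rightarrow>\<^sub>L 'k) \<Rightarrow> ('b \<Rightarrow>\<^sub>L 'k) \<Rightarrow> ('a, 'b, 'k) tensor" where
  "elem_tensor sX sY f g = (\<lambda>B. if B \<in> bilinear_forms sX sY then B f g else 0)"

definition tensor_rep ::
  "('k::real_or_complex \<Rightarrow> 'a::banach \<Rightarrow> 'a) \<Rightarrow> ('k \<Rightarrow> 'b::banach \<Rightarrow> 'b) \<Rightarrow>
     nat \<Rightarrow> (nat \<Rightarrow> 'a \<Rightarrow>\<^sub>L 'k) \<Rightarrow> (nat \<Rightarrow> 'b \<Rightarrow>\<^sub>L 'k) \<Rightarrow> ('a, 'b, 'k) tensor \<Rightarrow> bool" where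
  "tensor_rep sX sY n f g z \<longleftrightarrow>
     (\<forall>i<n. f i \<in> dual sX \<and> g i \<in> dual sY) \<and>
     z = (\<lambda>B. \<Sum>i<n. elem_tensor sX sY (f i) (g i) B)"

definition alg_tensor ::
  "('k::real_or_complex \<Rightarrow> 'a::banach \<Rightarrow> 'a) \<Rightarrow> ('k \<Rightarrow> 'b::banach \<Rightarrow> 'b) \<Rightarrow>
     ('k, ('a, 'b, 'k) tensor) normed_structure" where
  "alg_tensor sX sY = \<lparr>
     vcarrier = {z. \<exists>n f g. tensor_rep sX sY n f g z},
     vzero = (\<lambda>B. 0),
     vadd = (\<lambda>z w B. z B + w B),
     vscale = (\<lambda>c z B. c * z B),
     vnorm = (\<lambda>z. Inf {(\<Sum>i<n. norm (f i) * norm (g i)) | n f g. tensor_rep sX sY n f g z}) \<rparr>"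

abbreviation proj_tensor ::
  "('k::real_or_complex \<Rightarrow> 'a::banach \<Rightarrow> 'a) \<Rightarrow> ('k \<Rightarrow> 'b::banach \<Rightarrow> 'b) \<Rightarrow>
     ('k, (nat \<Rightarrow> ('a, 'b, 'k) tensor) set) normed_structure" where
  "proj_tensor sX sY \<equiv> completion (alg_tensor sX sY)"


section \<open>Nuclear operators and the canonical map\<close>

definition abs_summable_pair ::
  "('k::real_or_complex \<Rightarrow> 'a::banach \<Rightarrow> 'a) \<Rightarrow> ('k \<Rightarrow> 'b::banach \<Rightarrow> 'b) \<Rightarrow>
     (nat \<Rightarrow> 'a \<Rightarrow>\<^sub>L 'k) \<Rightarrow> (nat \<Rightarrow> 'b \<Rightarrow>\<^sub>L 'k) \<Rightarrow> bool" where
  "abs_summable_pair sX sY f g \<longleftrightarrow>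
     (\<forall>i. f i \<in> dual sX \<and> g i \<in> dual sY) \<and> summable (\<lambda>i. norm (f i) * norm (g i))"

definition nuclear_rep ::
  "('k::real_or_complex \<Rightarrow> 'a::banach \<Rightarrow> 'a) \<Rightarrow> ('k \<Rightarrow> 'b::banach \<Rightarrow> 'b) \<Rightarrow>
     (nat \<Rightarrow> 'a \<Rightarrow>\<^sub>L 'k) \<Rightarrow> (nat \<Rightarrow> 'b \<Rightarrow>\<^sub>L 'k) \<Rightarrow> ('a \<Rightarrow>\<^sub>L 'b \<Rightarrow>\<^sub>L 'k) \<Rightarrow> bool" where
  "nuclear_rep sX sY f g T \<longleftrightarrow> abs_summable_pair sX sY f g \<and>
     (\<forall>x. (\<lambda>i. dual_scale (blinfun_apply (f i) x) (g i)) sums blinfun_apply T x)"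

definition nuclear_operators ::
  "('k::real_or_complex \<Rightarrow> 'a::banach \<Rightarrow> 'a) \<Rightarrow> ('k \<Rightarrow> 'b::banach \<Rightarrow> 'b) \<Rightarrow>
     ('k, 'a \<Rightarrow>\<^sub>L 'b \<Rightarrow>\<^sub>L 'k) normed_structure" where
  "nuclear_operators sX sY = \<lparr>
     vcarrier = {T. \<exists>f g. nuclear_rep sX sY f g T},
     vzero = 0,
     vadd = (+),
     vscale = (\<lambda>c T. Blinfun (\<lambda>x. dual_scale c (blinfun_apply T x))),
     vnorm = (\<lambda>T. Inf {(\<Sum>i. norm (f i) * norm (g i)) | f g. nuclear_rep sX sY f g T}) \<rparr>"

text \<open>\<open>J\<close> sends \<open>z = \<Sum>i. f i \<otimes> g i\<close> (an absolutely convergent series in the completion) to the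
  operator \<open>x \<mapsto> \<Sum>i. f i x \<cdot> g i\<close>. Every element of the projective tensor product is such a
  series, and the operator does not depend on the series chosen.\<close>

definition canonical_map ::
  "('k::real_or_complex \<Rightarrow> 'a::banach \<Rightarrow> 'a) \<Rightarrow> ('k \<Rightarrow> 'b::banach \<Rightarrow> 'b) \<Rightarrow>
     (nat \<Rightarrow> ('a, 'b, 'k) tensor) set \<Rightarrow> ('a \<Rightarrow>\<^sub>L 'b \<Rightarrow>\<^sub>L 'k)" where
  "canonical_map sX sY z = (THE T. \<exists>f g. nuclear_rep sX sY f g T \<and>
     vsums (proj_tensor sX sY)
       (\<lambda>i. into_completion (alg_tensor sX sY) (elem_tensor sX sY (f i) (g i))) z)"

definition vkernel ::
  "('k, 'v) normed_structure \<Rightarrow> ('k, 'w) normed_structure \<Rightarrow> ('v \<Rightarrow> 'w) \<Rightarrow> 'v set" where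
  "vkernel E F L = {z \<in> vcarrier E. L z = vzero F}"

end

theory Submission
  imports Defs "HOL-Probability.Probability" "HOL-Library.Function_Algebras"
begin

text \<open>
  An element \<open>z\<close> lies in \<open>ker J\<close> iff the forms \<open>f \<otimes> g \<mapsto> f x \<cdot> g y\<close>, extended to the completion, vanish at \<open>z\<close>
  for all \<open>x\<close> and \<open>y\<close>. Hence a minimizing sequence for the distance \<open>c\<close> from \<open>z\<close> to \<open>ker J\<close> yields finite
  tensors \<open>u\<^sub>n\<close> of norm at most \<open>c + o(1)\<close> with \<open>u\<^sub>n(x, y) \<rightarrow> J z x y\<close>, and it suffices to find \<open>v\<close> with \<open>J v = J z\<close>
  and \<open>\<parallel>v\<parallel> \<le> c\<close>: then \<open>z - v\<close> is a nearest point.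

  Normalizing nearly optimal representations turns \<open>u\<^sub>n\<close> into the expectation of \<open>f \<otimes> g\<close> under a finitely
  supported law on the product of the two dual unit balls, times a factor tending to \<open>c\<close>. The product is weak*
  compact and metrizable, so a subsequence of the laws is coupled on one probability space with pointwise weak*
  limits \<open>\<phi>\<close>, \<open>\<psi>\<close>, and dominated convergence gives \<open>J z x y = c \<cdot> E (\<phi> x \<cdot> \<psi> y)\<close>. Separability of the duals makes
  the weak* measurable functions \<open>\<phi>\<close>, \<open>\<psi>\<close> norm limits of simple functions, so \<open>v = c \<cdot> E (\<phi> \<otimes> \<psi>)\<close> exists as a
  Bochner integral in the completion.
\<close>


section \<open>Scalars and dual unit balls\<close>

text \<open>The projective tensor product is not presented as a dual space, so weak* compactness
  does not by itself provide a limit of the minimizing tensors inside it. What compactness gives is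
  only a limiting form on \<open>X \<times> Y\<close>, which is integral in Grothendieck's sense;
  for separable duals such forms are nuclear with the same norm, and working with laws on the dual
  balls shows this without any loss in the constant \<open>c\<close>. The element \<open>v\<close>
  found in this way is determined only modulo \<open>ker J\<close>, which is all that a nearest
  point asks for.

  Integrals are taken in \<open>complex\<close>: Bochner integration asks for a second countable
  target, while \<open>'k\<close> is known only through an isometric embedding, fixed here as
  \<open>cemb\<close>. The completion is a set of classes of Cauchy sequences rather than a type, so
  the integral of \<open>\<phi> \<otimes> \<psi>\<close> is built by hand as a Cauchy sequence of
  finite tensors.\<close>

definition cemb :: "'k::real_or_complex \<Rightarrow> complex" where
  "cemb = (SOME \<phi>. (\<forall>a b. \<phi> (a + b) = \<phi> a + \<phi> b) \<and> (\<forall>a b. \<phi> (a * b) = \<phi> a * \<phi> b) \<and>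
     (\<forall>r. \<phi> (r *\<^sub>R 1) = complex_of_real r) \<and> (\<forall>a. norm (\<phi> a) = norm a))"

lemma cemb_props:
  "(\<forall>a b. cemb (a + b :: 'k::real_or_complex) = cemb a + cemb b) \<and>
   (\<forall>a b. cemb (a * b :: 'k) = cemb a * cemb b) \<and>
   (\<forall>r. cemb (r *\<^sub>R 1 :: 'k) = complex_of_real r) \<and> (\<forall>a :: 'k. norm (cemb a) = norm a)"
  unfolding cemb_def by (rule someI_ex[OF embeds_into_complex])

lemma cemb_add: "cemb (a + b) = cemb a + cemb b"
  and cemb_mult: "cemb (a * b) = cemb a * cemb b"
  and norm_cemb [simp]: "norm (cemb a) = norm a"
  using cemb_props by blast+

lemma cemb_scaleR: "cemb (r *\<^sub>R a) = r *\<^sub>R cemb a"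
proof -
  have "cemb (r *\<^sub>R a) = cemb ((r *\<^sub>R 1) * a)" by simp
  also have "\<dots> = r *\<^sub>R cemb a"
    using cemb_props by (metis cemb_mult scaleR_conv_of_real)
  finally show ?thesis .
qed

lemma bounded_linear_cemb: "bounded_linear cemb"
  by (rule bounded_linear_intro[where K = 1]) (simp_all add: cemb_add cemb_scaleR)

lemma cemb_0 [simp]: "cemb 0 = 0"
  by (rule linear_0[OF bounded_linear.linear[OF bounded_linear_cemb]])

lemma cemb_diff: "cemb (a - b) = cemb a - cemb b"
  by (rule linear_diff[OF bounded_linear.linear[OF bounded_linear_cemb]])

lemma cemb_sum: "cemb (\<Sum>i\<in>A. f i) = (\<Sum>i\<in>A. cemb (f i))"
  by (rule linear_sum[OF bounded_linear.linear[OF bounded_linear_cemb]])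

lemma cemb_eq_iff [simp]: "cemb a = cemb b \<longleftrightarrow> a = b"
proof
  assume "cemb a = cemb b"
  then have "norm (cemb (a - b)) = 0" by (simp add: cemb_diff)
  then show "a = b" by simp
qed simp

lemma dist_cemb: "dist (cemb a) (cemb b) = dist a b"
  by (simp add: dist_norm flip: cemb_diff)

lemma tendsto_cemb: "(f \<longlongrightarrow> a) F \<Longrightarrow> ((\<lambda>x. cemb (f x)) \<longlongrightarrow> cemb a) F"
  by (rule bounded_linear.tendsto[OF bounded_linear_cemb])

text \<open>An isometry transports the Cauchy property both ways and both fields are complete; a
  limit of the images does not have to be known beforehand to lie in the range of
  \<open>cemb\<close>.\<close>

lemma convergent_cemb_iff: "convergent (\<lambda>n. cemb (f n)) \<longleftrightarrow> convergent f"
  unfolding Cauchy_convergent_iff[symmetric] Cauchy_def dist_cemb ..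

lemma compact_cball_scalar: "compact (cball (0::'k::real_or_complex) r)"
  unfolding compact_eq_seq_compact_metric seq_compact_def
proof (intro allI impI)
  fix f :: "nat \<Rightarrow> 'k"
  assume f: "\<forall>n. f n \<in> cball 0 r"
  have "bounded (range (\<lambda>n. cemb (f n)))"
    using f by (auto simp: bounded_iff)
  then obtain l s where s: "strict_mono s" and l: "((\<lambda>n. cemb (f n)) \<circ> s) \<longlonglongrightarrow> l"
    using bounded_imp_convergent_subsequence by blast
  have "convergent (\<lambda>n. cemb ((f \<circ> s) n))"
    using l by (auto simp: convergent_def o_def)
  then obtain a where a: "(f \<circ> s) \<longlonglongrightarrow> a"
    unfolding convergent_cemb_iff convergent_def by blast
  have "a \<in> cball 0 r"
    by (rule closed_sequentially[OF closed_cball _ a]) (use f in auto)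
  then show "\<exists>l\<in>cball 0 r. \<exists>s. strict_mono s \<and> (f \<circ> s) \<longlonglongrightarrow> l"
    using s a by blast
qed

section \<open>Weak* compactness and sequential convergence in dual unit balls\<close>

lemma dual_zero: "0 \<in> dual sX"
  and dual_diff: "f \<in> dual sX \<Longrightarrow> g \<in> dual sX \<Longrightarrow> f - g \<in> dual sX"
  and dual_scaleR: "f \<in> dual sX \<Longrightarrow> r *\<^sub>R f \<in> dual sX"
  and dual_dual_scale: "f \<in> dual sX \<Longrightarrow> dual_scale c f \<in> dual sX"
  by (auto simp: dual_def dual_scale_def blinfun.bilinear_simps algebra_simps)

lemma dual_scale_apply: "blinfun_apply (dual_scale c f) x = c * blinfun_apply f x"
  by (simp add: dual_scale_def)

lemma norm_dual_scale_le: "norm (dual_scale c f) \<le> norm c * norm f"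
  by (rule norm_blinfun_bound)
    (auto simp: dual_scale_apply norm_mult mult.assoc intro!: mult_left_mono norm_blinfun)

lemma scaleR_eq_dual_scale: "r *\<^sub>R f = dual_scale (of_real r) f"
  by (rule blinfun_eqI) (simp add: dual_scale_apply blinfun.bilinear_simps scaleR_conv_of_real)

text \<open>Banach-Alaoglu: the ball sits in a product of closed discs, compact by Tychonoff.
  Filters replace subsequences because metrizability of the ball is not yet available, and
  \<open>G\<close> is left arbitrary so that the lemma also applies to a filter on which convergence
  fails.\<close>

lemma dual_ball_cluster_point:
  fixes F :: "nat \<Rightarrow> 'a::banach \<Rightarrow>\<^sub>L 'k::real_or_complex"
  assumes F: "\<And>n. F n \<in> dual sX" "\<And>n. norm (F n) \<le> 1" and G: "G \<noteq> bot"
  obtains G' l where "G' \<noteq> bot" "G' \<le> G" "l \<in> dual sX" "norm l \<le> 1"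
    "\<And>x. ((\<lambda>n. blinfun_apply (F n) x) \<longlongrightarrow> blinfun_apply l x) G'"
proof -
  define P :: "('a \<Rightarrow> 'k) set" where "P = PiE UNIV (\<lambda>x. cball 0 (norm x))"
  have "compactin (product_topology (\<lambda>_::'a. euclidean :: 'k topology) UNIV) P"
    unfolding P_def by (subst compactin_PiE) (simp add: compact_cball_scalar)
  then have P: "compact P"
    by (simp add: euclidean_product_topology)
  define E where "E n = blinfun_apply (F n)" for n
  have EP: "E n \<in> P" for n
  proof -
    have "norm (blinfun_apply (F n) x) \<le> norm x" for x
      using norm_blinfun[of "F n" x] F(2)[of n] mult_right_mono[of "norm (F n)" 1 "norm x"] by simp
    then show ?thesis by (auto simp: P_def E_def)
  qed
  have "filtermap E G \<noteq> bot" "eventually (\<lambda>y. y \<in> P) (filtermap E G)"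
    using G EP by (auto simp: filtermap_bot_iff eventually_filtermap)
  then obtain l where "l \<in> P" and l: "inf (nhds l) (filtermap E G) \<noteq> bot"
    using P unfolding compact_filter by blast
  \<comment> \<open>The cluster point lives among functions; pulling its neighbourhoods back along
    \<open>E\<close> gives a filter on indices along which the functionals converge.\<close>
  define G' where "G' = inf G (filtercomap E (nhds l))"
  have G': "G' \<noteq> bot"
  proof
    assume "G' = bot"
    then obtain Q R where Q: "eventually Q G" and R: "eventually R (filtercomap E (nhds l))"
      and QR: "\<And>n. Q n \<Longrightarrow> R n \<Longrightarrow> False"
      unfolding G'_def trivial_limit_def eventually_inf by blast
    from R obtain R' where R': "eventually R' (nhds l)" "\<And>n. R' (E n) \<Longrightarrow> R n"
      unfolding eventually_filtercomap by blast
    have "eventually (\<lambda>y. \<not> R' y) (filtermap E G)"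
      unfolding eventually_filtermap using Q by (rule eventually_mono) (use QR R' in blast)
    then have "eventually (\<lambda>_. False) (inf (nhds l) (filtermap E G))"
      unfolding eventually_inf using R'(1) by blast
    then show False using l by (simp add: trivial_limit_def)
  qed
  have lim: "((\<lambda>n. E n x) \<longlongrightarrow> l x) G'" for x
  proof -
    have "filterlim E (nhds l) G'"
      unfolding G'_def by (rule filterlim_mono[OF filterlim_filtercomap]) auto
    then show ?thesis
      by (rule tendsto_compose[rotated])
        (metis continuous_on_product_coordinates UNIV_I continuous_on_def tendsto_within_open open_UNIV)
  qed
  \<comment> \<open>Linearity of \<open>l\<close>, over the reals and over \<open>'k\<close>, is
    inherited from the \<open>F n\<close> by uniqueness of limits.\<close>
  have uniq: "((\<lambda>n. E n x) \<longlongrightarrow> a) G' \<Longrightarrow> l x = a" for x a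
    using tendsto_unique[OF G' lim] by blast
  have l_le: "norm (l x) \<le> norm x" for x
    using \<open>l \<in> P\<close> by (auto simp: P_def PiE_def Pi_def)
  have bl: "bounded_linear l"
  proof (rule bounded_linear_intro[where K = 1])
    show "l (x + y) = l x + l y" for x y
      by (rule uniq) (use tendsto_add[OF lim[of x] lim[of y]] in \<open>simp add: E_def blinfun.add_right\<close>)
    show "l (r *\<^sub>R x) = r *\<^sub>R l x" for r x
      by (rule uniq) (use tendsto_scaleR[OF tendsto_const lim[of x]] in
          \<open>simp add: E_def blinfun.scaleR_right\<close>)
  qed (simp add: l_le)
  have ap: "blinfun_apply (Blinfun l) = l"
    by (rule bounded_linear_Blinfun_apply[OF bl])
  show thesis
  proof
    show "G' \<noteq> bot" by (rule G')
    show "G' \<le> G" by (simp add: G'_def)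
    show "norm (Blinfun l) \<le> 1"
      by (rule norm_blinfun_bound) (simp_all add: ap l_le)
    have "l (sX c x) = c * l x" for c x
      by (rule uniq) (use tendsto_mult[OF tendsto_const lim[of x]] F(1) in
          \<open>simp add: E_def dual_def\<close>)
    then show "Blinfun l \<in> dual sX" by (simp add: dual_def ap)
    show "((\<lambda>n. blinfun_apply (F n) x) \<longlongrightarrow> blinfun_apply (Blinfun l) x) G'" for x
      using lim[of x] by (simp add: ap E_def)
  qed
qed

text \<open>Cluster points are unique because their values at the separating vectors
  \<open>x j\<close> are prescribed. In a compact ball this forces convergence of the entire
  sequence.\<close>

lemma dual_ball_convergent:
  fixes F :: "nat \<Rightarrow> 'a::banach \<Rightarrow>\<^sub>L 'k::real_or_complex"
  assumes F: "\<And>n. F n \<in> dual sX" "\<And>n. norm (F n) \<le> 1"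
    and sep: "\<And>f. f \<in> dual sX \<Longrightarrow> (\<And>j. blinfun_apply f (x j) = 0) \<Longrightarrow> f = 0"
    and conv: "\<And>j. convergent (\<lambda>n. blinfun_apply (F n) (x j))"
  obtains l where "l \<in> dual sX" "norm l \<le> 1"
    "\<And>y. (\<lambda>n. blinfun_apply (F n) y) \<longlonglongrightarrow> blinfun_apply l y"
proof -
  have key: "blinfun_apply l (x j) = lim (\<lambda>n. blinfun_apply (F n) (x j))"
    if "G' \<noteq> bot" "G' \<le> sequentially"
      and "\<And>y. ((\<lambda>n. blinfun_apply (F n) y) \<longlongrightarrow> blinfun_apply l y) G'" for l j G'
    using conv[of j] that
    by (metis convergent_LIMSEQ_iff tendsto_mono tendsto_unique)
  obtain G l where G: "G \<noteq> bot" "G \<le> sequentially" and l: "l \<in> dual sX" "norm l \<le> 1"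
    "\<And>y. ((\<lambda>n. blinfun_apply (F n) y) \<longlongrightarrow> blinfun_apply l y) G"
    by (rule dual_ball_cluster_point[of F, OF F sequentially_bot]) blast
  have "(\<lambda>n. blinfun_apply (F n) y) \<longlonglongrightarrow> blinfun_apply l y" for y
  proof (rule ccontr)
    assume "\<not> ?thesis"
    then obtain e where e: "e > 0"
      and "\<not> eventually (\<lambda>n. dist (blinfun_apply (F n) y) (blinfun_apply l y) < e) sequentially"
      unfolding tendsto_iff by blast
    \<comment> \<open>Failure at \<open>y\<close> leaves a proper filter of indices staying
      \<open>e\<close> away; its cluster point equals \<open>l\<close> by separation, yet differs
      from it at \<open>y\<close>.\<close>
    then have "inf sequentially (principal {n. e \<le> dist (blinfun_apply (F n) y) (blinfun_apply l y)}) \<noteq> bot"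
      unfolding trivial_limit_def eventually_inf_principal by (simp add: not_le)
    then obtain G' l' where G': "G' \<noteq> bot"
      "G' \<le> inf sequentially (principal {n. e \<le> dist (blinfun_apply (F n) y) (blinfun_apply l y)})"
      and l': "l' \<in> dual sX"
      "\<And>y. ((\<lambda>n. blinfun_apply (F n) y) \<longlongrightarrow> blinfun_apply l' y) G'"
      by (rule dual_ball_cluster_point[of F, OF F]) blast
    have "G' \<le> sequentially" using G'(2) by (rule order_trans) simp
    then have "blinfun_apply (l' - l) (x j) = 0" for j
      using key[OF G l(3), of j] key[OF G'(1) _ l'(2), of j] by (simp add: blinfun.diff_left)
    then have "l' - l = 0"
      by (rule sep[OF dual_diff[OF l'(1) l(1)]])
    then have "((\<lambda>n. dist (blinfun_apply (F n) y) (blinfun_apply l y)) \<longlongrightarrow> 0) G'"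
      using tendsto_dist[OF l'(2)[of y] tendsto_const[of "blinfun_apply l y"]] by simp
    moreover have "eventually (\<lambda>n. e \<le> dist (blinfun_apply (F n) y) (blinfun_apply l y)) G'"
      by (rule filter_leD[OF G'(2)]) (simp add: eventually_inf_principal)
    ultimately have "e \<le> 0"
      by (rule tendsto_lowerbound) (rule G'(1))
    then show False using e by simp
  qed
  from that[OF l(1,2) this] show thesis .
qed

text \<open>Almost norming vectors are used in place of a dense sequence in \<open>X\<close>, whose existence would need the
  Hahn-Banach theorem.\<close>

lemma separable_dual_sequences:
  fixes sX :: "'k::real_or_complex \<Rightarrow> 'a::banach \<Rightarrow> 'a"
  assumes "separable_space (top_of_set (dual sX))"
  obtains d :: "nat \<Rightarrow> 'a \<Rightarrow>\<^sub>L 'k" and x :: "nat \<Rightarrow> 'a"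
  where "\<And>i. d i \<in> dual sX" "\<And>f e. f \<in> dual sX \<Longrightarrow> e > 0 \<Longrightarrow> \<exists>i. norm (f - d i) < e"
    "\<And>j. norm (x j) \<le> 1" "\<And>f. f \<in> dual sX \<Longrightarrow> norm f = (SUP j. norm (blinfun_apply f (x j)))"
proof -
  obtain C where C: "countable C" "C \<subseteq> dual sX" "top_of_set (dual sX) closure_of C = dual sX"
    using assms by (auto simp: separable_space_def)
  have dense: "\<exists>c\<in>C. norm (f - c) < e" if f: "f \<in> dual sX" and e: "e > 0" for f e
  proof -
    have "f \<in> top_of_set (dual sX) closure_of C" using f C by simp
    then have "\<forall>T. f \<in> T \<and> openin (top_of_set (dual sX)) T \<longrightarrow> (\<exists>y\<in>C. y \<in> T)"
      unfolding in_closure_of by blast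
    moreover have "openin (top_of_set (dual sX)) (dual sX \<inter> ball f e)"
      by (simp add: openin_open_Int)
    ultimately show ?thesis using f e
      by (metis IntD2 IntI centre_in_ball dist_norm mem_ball)
  qed
  have "C \<noteq> {}" using dense[OF dual_zero, of 1] by auto
  define d where "d = from_nat_into C"
  have d: "d i \<in> dual sX" for i
    using from_nat_into[OF \<open>C \<noteq> {}\<close>] C(2) by (auto simp: d_def)
  have d_dense: "\<exists>i. norm (f - d i) < e" if "f \<in> dual sX" "e > 0" for f e
    using dense[OF that] from_nat_into_surj[OF C(1)] by (metis d_def)
  have ex: "\<exists>v. norm v \<le> 1 \<and> norm (blinfun_apply f v) > norm f - e" if "e > 0"
    for f :: "'a \<Rightarrow>\<^sub>L 'k" and e :: real
  proof (rule ccontr)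
    assume *: "\<not> ?thesis"
    have "norm f \<le> max 0 (norm f - e)"
    proof (rule norm_blinfun_bound)
      fix v :: 'a
      show "norm (blinfun_apply f v) \<le> max 0 (norm f - e) * norm v"
      proof (cases "v = 0")
        case False
        have "norm (blinfun_apply f (v /\<^sub>R norm v)) \<le> norm f - e"
          using * False by (auto simp: not_less)
        then have "norm (blinfun_apply f v) \<le> (norm f - e) * norm v"
          using False by (simp add: blinfun.scaleR_right field_simps)
        also have "\<dots> \<le> max 0 (norm f - e) * norm v"
          by (intro mult_right_mono) auto
        finally show ?thesis .
      qed simp
    qed simp
    \<comment> \<open>As \<open>e > 0\<close>, the bound forces \<open>norm f = 0\<close>, and then
      the vector \<open>0\<close> itself contradicts \<open>*\<close>.\<close>
    then have "norm f = 0" using \<open>e > 0\<close> by (simp add: max_def split: if_splits)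
    then show False using * \<open>e > 0\<close> by (auto dest: spec[of _ 0])
  qed
  \<comment> \<open>These vectors norm each \<open>d i\<close> up to \<open>1 / Suc k\<close>; by
    density of the \<open>d i\<close> they norm the whole dual.\<close>
  define v where "v i k = (SOME v. norm v \<le> 1 \<and> norm (blinfun_apply (d i) v) > norm (d i) - inverse (real (Suc k)))" for i k
  have v: "norm (v i k) \<le> 1" "norm (blinfun_apply (d i) (v i k)) > norm (d i) - inverse (real (Suc k))" for i k
    using someI_ex[OF ex[of "inverse (real (Suc k))" "d i"]] by (auto simp: v_def)
  define x where "x j = case_prod v (prod_decode j)" for j
  have x: "norm (x j) \<le> 1" for j
    by (auto simp: x_def v split: prod.split)
  have "norm f = (SUP j. norm (blinfun_apply f (x j)))" if f: "f \<in> dual sX" for f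
  proof (rule antisym)
    have le: "norm (blinfun_apply f (x j)) \<le> norm f" for j
      using norm_blinfun[of f "x j"] x[of j] mult_left_mono[of "norm (x j)" 1 "norm f"] by simp
    then have bdd: "bdd_above (range (\<lambda>j. norm (blinfun_apply f (x j))))"
      unfolding bdd_above_def by auto
    show "(SUP j. norm (blinfun_apply f (x j))) \<le> norm f"
      by (rule cSUP_least) (auto simp: le)
    show "norm f \<le> (SUP j. norm (blinfun_apply f (x j)))"
    proof (rule field_le_epsilon)
      fix e :: real assume e: "e > 0"
      \<comment> \<open>Three errors of \<open>e / 3\<close>: replacing \<open>f\<close> by
        \<open>d i\<close>, norming \<open>d i\<close> by a vector \<open>v i k\<close>, and
        returning to \<open>f\<close> at that vector.\<close>
      obtain i where i: "norm (f - d i) < e / 3" using d_dense[OF f, of "e/3"] e by auto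
      obtain k where k: "inverse (real (Suc k)) < e / 3"
        using reals_Archimedean[of "e/3"] e by auto
      have "norm f \<le> norm (d i) + e / 3"
        using i norm_triangle_ineq2[of f "d i"] by linarith
      also have "\<dots> \<le> norm (blinfun_apply (d i) (v i k)) + 2 * e / 3"
        using v(2)[where i = i and k = k] k by linarith
      also have "norm (blinfun_apply (d i) (v i k)) \<le> norm (blinfun_apply f (v i k)) + e / 3"
      proof -
        have "norm (blinfun_apply (d i) (v i k)) \<le> norm (blinfun_apply f (v i k)) + norm (blinfun_apply (f - d i) (v i k))"
          by (simp add: blinfun.diff_left) (metis add.commute norm_minus_commute norm_triangle_sub)
        moreover have "norm (blinfun_apply (f - d i) (v i k)) \<le> norm (f - d i)"
          using norm_blinfun[of "f - d i" "v i k"] v(1)[of i k]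
            mult_left_mono[of "norm (v i k)" 1 "norm (f - d i)"] by simp
        ultimately show ?thesis using i by linarith
      qed
      also have "norm (blinfun_apply f (v i k)) \<le> (SUP j. norm (blinfun_apply f (x j)))"
        using cSUP_upper[OF _ bdd, of "prod_encode (i, k)"] by (simp add: x_def)
      finally show "norm f \<le> (SUP j. norm (blinfun_apply f (x j))) + e" by simp
    qed
  qed
  then show thesis using that[of d x] d d_dense x by blast
qed


section \<open>Completions of seminormed structures\<close>

text \<open>Seminorm laws are the right level, since dividing by null sequences supplies
  definiteness. \<open>vscale_m1\<close> is singled out because \<open>vdist\<close> subtracts by
  scaling with \<open>-1\<close>.\<close>

locale seminormed_structure =
  fixes E :: "('k::real_or_complex, 'v::ab_group_add) normed_structure"
  assumes vzero_eq: "vzero E = 0" and vadd_eq: "vadd E u v = u + v"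
    and vscale_m1: "vscale E (-1) u = - u"
    and vscale_diff: "vscale E c (u - v) = vscale E c u - vscale E c v"
    and carrier_zero: "0 \<in> vcarrier E"
    and carrier_add: "u \<in> vcarrier E \<Longrightarrow> v \<in> vcarrier E \<Longrightarrow> u + v \<in> vcarrier E"
    and carrier_scale: "u \<in> vcarrier E \<Longrightarrow> vscale E c u \<in> vcarrier E"
    and vnorm_triangle: "u \<in> vcarrier E \<Longrightarrow> v \<in> vcarrier E \<Longrightarrow> vnorm E (u + v) \<le> vnorm E u + vnorm E v"
    and vnorm_scale: "u \<in> vcarrier E \<Longrightarrow> vnorm E (vscale E c u) = norm c * vnorm E u"
begin

lemma carrier_minus: "u \<in> vcarrier E \<Longrightarrow> - u \<in> vcarrier E"
  using carrier_scale[of u "-1"] by (simp add: vscale_m1)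

lemma carrier_diff: "u \<in> vcarrier E \<Longrightarrow> v \<in> vcarrier E \<Longrightarrow> u - v \<in> vcarrier E"
  using carrier_add[OF _ carrier_minus] by fastforce

lemma carrier_sum: "(\<And>i. i \<in> I \<Longrightarrow> u i \<in> vcarrier E) \<Longrightarrow> (\<Sum>i\<in>I. u i) \<in> vcarrier E"
  by (induction I rule: infinite_finite_induct) (auto simp: carrier_zero carrier_add)

lemma vnorm_minus: "u \<in> vcarrier E \<Longrightarrow> vnorm E (- u) = vnorm E u"
  using vnorm_scale[of u "-1"] by (simp add: vscale_m1)

lemma vnorm_zero: "vnorm E 0 = 0"
proof -
  have "vscale E 0 0 = 0" using vscale_diff[of 0 0 0] by simp
  then show ?thesis using vnorm_scale[OF carrier_zero, of 0] by simp
qed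

lemma vnorm_nonneg: "u \<in> vcarrier E \<Longrightarrow> 0 \<le> vnorm E u"
  using vnorm_triangle[of u "- u"] by (simp add: vnorm_zero vnorm_minus carrier_minus)

lemma vnorm_diff_le: "u \<in> vcarrier E \<Longrightarrow> v \<in> vcarrier E \<Longrightarrow> vnorm E (u - v) \<le> vnorm E u + vnorm E v"
  using vnorm_triangle[of u "- v"] by (simp add: vnorm_minus carrier_minus)

lemma vnorm_commute: "u \<in> vcarrier E \<Longrightarrow> v \<in> vcarrier E \<Longrightarrow> vnorm E (u - v) = vnorm E (v - u)"
  using vnorm_minus[of "u - v"] by (simp add: carrier_diff)

lemma vnorm_diff_triangle:
  assumes "u \<in> vcarrier E" "v \<in> vcarrier E" "w \<in> vcarrier E"
  shows "vnorm E (u - w) \<le> vnorm E (u - v) + vnorm E (v - w)"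
  using vnorm_triangle[of "u - v" "v - w"] assms by (simp add: carrier_diff)

lemma vnorm_reverse_triangle:
  assumes "u \<in> vcarrier E" "v \<in> vcarrier E"
  shows "\<bar>vnorm E u - vnorm E v\<bar> \<le> vnorm E (u - v)"
  using vnorm_triangle[of "u - v" v] vnorm_triangle[of "v - u" u] vnorm_commute[OF assms] assms
  by (simp add: carrier_diff abs_le_iff)

lemma vdist_eq: "vdist E u v = vnorm E (u - v)"
  by (simp add: vdist_def vadd_eq vscale_m1)

lemma vcauchy_iff: "u \<in> vcauchy E \<longleftrightarrow>
    (\<forall>n. u n \<in> vcarrier E) \<and> (\<forall>e>0. \<exists>M. \<forall>m\<ge>M. \<forall>n\<ge>M. vnorm E (u m - u n) < e)"
  by (simp add: vcauchy_def vdist_eq)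

text \<open>The shape \<open>a m + a n\<close> arises when \<open>u m\<close> and \<open>u n\<close>
  are both compared with a limit outside the carrier.\<close>

lemma vcauchyI:
  assumes "\<And>n. u n \<in> vcarrier E" "\<And>m n. vnorm E (u m - u n) \<le> a m + a n" "a \<longlonglongrightarrow> (0::real)"
  shows "u \<in> vcauchy E"
  unfolding vcauchy_iff
proof (intro conjI allI impI)
  fix e :: real assume "e > 0"
  then obtain M where "\<And>n. n \<ge> M \<Longrightarrow> a n < e / 2"
    using order_tendstoD(2)[OF assms(3), of "e/2"] unfolding eventually_sequentially by auto
  then have "\<forall>m\<ge>M. \<forall>n\<ge>M. vnorm E (u m - u n) < e"
    using assms(2) by (smt (verit) field_sum_of_halves)
  then show "\<exists>M. \<forall>m\<ge>M. \<forall>n\<ge>M. vnorm E (u m - u n) < e" ..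
qed (rule assms(1))

lemma vcauchy_carrier: "u \<in> vcauchy E \<Longrightarrow> u n \<in> vcarrier E"
  by (simp add: vcauchy_iff)

lemma vcauchy_const: "v \<in> vcarrier E \<Longrightarrow> (\<lambda>_. v) \<in> vcauchy E"
  by (simp add: vcauchy_iff vnorm_zero)

lemma vcauchy_add:
  assumes u: "u \<in> vcauchy E" and v: "v \<in> vcauchy E"
  shows "(\<lambda>n. u n + v n) \<in> vcauchy E"
  unfolding vcauchy_iff
proof (intro conjI allI impI)
  fix e :: real assume "e > 0"
  then have "e / 2 > 0" by simp
  then obtain M N where MN: "\<forall>m\<ge>M. \<forall>n\<ge>M. vnorm E (u m - u n) < e / 2"
    "\<forall>m\<ge>N. \<forall>n\<ge>N. vnorm E (v m - v n) < e / 2"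
    using u v unfolding vcauchy_iff by blast
  have "vnorm E (u m + v m - (u n + v n)) < e" if "m \<ge> max M N" "n \<ge> max M N" for m n
  proof -
    have "vnorm E ((u m - u n) + (v m - v n)) \<le> vnorm E (u m - u n) + vnorm E (v m - v n)"
      using u v by (intro vnorm_triangle carrier_diff vcauchy_carrier)
    moreover have "vnorm E (u m - u n) < e / 2" "vnorm E (v m - v n) < e / 2"
      using MN that by auto
    ultimately show ?thesis by (simp add: algebra_simps)
  qed
  then show "\<exists>M. \<forall>m\<ge>M. \<forall>n\<ge>M. vnorm E (u m + v m - (u n + v n)) < e" by blast
qed (use u v in \<open>simp add: carrier_add vcauchy_carrier\<close>)

lemma vcauchy_scale:
  assumes u: "u \<in> vcauchy E"
  shows "(\<lambda>n. vscale E c (u n)) \<in> vcauchy E"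
  unfolding vcauchy_iff
proof (intro conjI allI impI)
  fix e :: real assume e: "e > 0"
  then have "e / (norm c + 1) > 0" by (simp add: add_nonneg_pos)
  then obtain M where M: "\<forall>m\<ge>M. \<forall>n\<ge>M. vnorm E (u m - u n) < e / (norm c + 1)"
    using u unfolding vcauchy_iff by blast
  have "vnorm E (vscale E c (u m) - vscale E c (u n)) < e" if "m \<ge> M" "n \<ge> M" for m n
  proof -
    have c: "u m - u n \<in> vcarrier E" using u by (simp add: carrier_diff vcauchy_carrier)
    have "norm c * vnorm E (u m - u n) \<le> (norm c + 1) * vnorm E (u m - u n)"
      using vnorm_nonneg[OF c] by (simp add: algebra_simps)
    also have "\<dots> < e"
      using M that e by (simp add: pos_less_divide_eq add_nonneg_pos mult.commute)
    finally show ?thesis by (simp add: vnorm_scale[OF c] flip: vscale_diff)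
  qed
  then show "\<exists>M. \<forall>m\<ge>M. \<forall>n\<ge>M. vnorm E (vscale E c (u m) - vscale E c (u n)) < e" by blast
qed (use u in \<open>simp add: carrier_scale vcauchy_carrier\<close>)

lemma vcauchy_minus: "u \<in> vcauchy E \<Longrightarrow> (\<lambda>n. - u n) \<in> vcauchy E"
  using vcauchy_scale[of u "-1"] by (simp add: vscale_m1)

lemma vcauchy_diff: "u \<in> vcauchy E \<Longrightarrow> v \<in> vcauchy E \<Longrightarrow> (\<lambda>n. u n - v n) \<in> vcauchy E"
  using vcauchy_add[OF _ vcauchy_minus] by fastforce

lemma vcauchy_norm_convergent:
  assumes u: "u \<in> vcauchy E"
  shows "convergent (\<lambda>n. vnorm E (u n))"
  unfolding Cauchy_convergent_iff[symmetric] Cauchy_def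
proof (intro allI impI)
  fix e :: real assume "e > 0"
  then obtain M where M: "\<forall>m\<ge>M. \<forall>n\<ge>M. vnorm E (u m - u n) < e"
    using u unfolding vcauchy_iff by blast
  have "dist (vnorm E (u m)) (vnorm E (u n)) < e" if "m \<ge> M" "n \<ge> M" for m n
    using vnorm_reverse_triangle[of "u m" "u n"] M that u
    by (force simp: dist_real_def vcauchy_carrier intro: le_less_trans)
  then show "\<exists>M. \<forall>m\<ge>M. \<forall>n\<ge>M. dist (vnorm E (u m)) (vnorm E (u n)) < e" by blast
qed

section \<open>Well-defined operations and norm on the completion\<close>

abbreviation null_class :: "(nat \<Rightarrow> 'v) \<Rightarrow> (nat \<Rightarrow> 'v) set" where
  "null_class u \<equiv> vnull_rel E `` {u}"

lemma null_rel_iff: "(u, v) \<in> vnull_rel E \<longleftrightarrow>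
    u \<in> vcauchy E \<and> v \<in> vcauchy E \<and> (\<lambda>n. vnorm E (u n - v n)) \<longlonglongrightarrow> 0"
  by (simp add: vnull_rel_def vdist_eq)

lemma equiv_null_rel: "equiv (vcauchy E) (vnull_rel E)"
proof (rule equivI)
  show "refl_on (vcauchy E) (vnull_rel E)"
    by (auto simp: refl_on_def null_rel_iff vnorm_zero)
  show "sym (vnull_rel E)"
    by (auto simp: sym_def null_rel_iff vnorm_commute vcauchy_carrier)
  show "trans (vnull_rel E)"
  proof (rule transI)
    fix u v w assume "(u, v) \<in> vnull_rel E" "(v, w) \<in> vnull_rel E"
    then have uvw: "u \<in> vcauchy E" "v \<in> vcauchy E" "w \<in> vcauchy E"
      and lim: "(\<lambda>n. vnorm E (u n - v n)) \<longlonglongrightarrow> 0" "(\<lambda>n. vnorm E (v n - w n)) \<longlonglongrightarrow> 0"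
      by (auto simp: null_rel_iff)
    have "(\<lambda>n. vnorm E (u n - w n)) \<longlonglongrightarrow> 0"
      by (rule tendsto_sandwich[OF _ _ tendsto_const])
        (use uvw tendsto_add[OF lim] in
          \<open>simp_all add: vnorm_nonneg vnorm_diff_triangle vcauchy_carrier carrier_diff\<close>)
    then show "(u, w) \<in> vnull_rel E" using uvw by (simp add: null_rel_iff)
  qed
qed (auto simp: null_rel_iff)

lemma null_class_eqI:
  assumes "u \<in> vcauchy E" "v \<in> vcauchy E" "(\<lambda>n. vnorm E (u n - v n)) \<longlonglongrightarrow> 0"
  shows "null_class u = null_class v"
  using assms by (intro equiv_class_eq[OF equiv_null_rel]) (simp add: null_rel_iff)

lemma in_null_class: "v \<in> null_class u \<longleftrightarrow>
    u \<in> vcauchy E \<and> v \<in> vcauchy E \<and> (\<lambda>n. vnorm E (u n - v n)) \<longlonglongrightarrow> 0"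
  by (simp add: null_rel_iff)

lemma null_class_self: "u \<in> vcauchy E \<Longrightarrow> u \<in> null_class u"
  by (simp add: null_rel_iff vnorm_zero)

lemma completion_carrier: "vcarrier (completion E) = null_class ` vcauchy E"
  by (auto simp: completion_def quotient_def)

lemma completion_zero: "vzero (completion E) = null_class (\<lambda>_. 0)"
  by (simp add: completion_def vzero_eq)

text \<open>Sums and multiples in \<open>completion\<close> are unions over all representatives;
  independence of the representative collapses each union to one class.\<close>

lemma UN_const_eq: "x \<in> A \<Longrightarrow> (\<And>y. y \<in> A \<Longrightarrow> f y = c) \<Longrightarrow> (\<Union>y\<in>A. f y) = c"
  by blast

lemma completion_add:
  assumes u: "u \<in> vcauchy E" and v: "v \<in> vcauchy E"
  shows "vadd (completion E) (null_class u) (null_class v) = null_class (\<lambda>n. u n + v n)"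
proof -
  have *: "null_class (\<lambda>n. u' n + v' n) = null_class (\<lambda>n. u n + v n)"
    if "u' \<in> null_class u" "v' \<in> null_class v" for u' v'
  proof (rule null_class_eqI)
    have uv': "u' \<in> vcauchy E" "v' \<in> vcauchy E" and
      lim: "(\<lambda>n. vnorm E (u n - u' n)) \<longlonglongrightarrow> 0" "(\<lambda>n. vnorm E (v n - v' n)) \<longlonglongrightarrow> 0"
      using that unfolding in_null_class by auto
    show "(\<lambda>n. vnorm E (u' n + v' n - (u n + v n))) \<longlonglongrightarrow> 0"
    proof (rule tendsto_sandwich[OF _ _ tendsto_const])
      have "vnorm E (u' n + v' n - (u n + v n)) \<le> vnorm E (u n - u' n) + vnorm E (v n - v' n)" for n
        using vnorm_triangle[of "u' n - u n" "v' n - v n"] u v uv'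
        by (simp add: algebra_simps carrier_diff vcauchy_carrier vnorm_commute)
      then show "\<forall>\<^sub>F n in sequentially. vnorm E (u' n + v' n - (u n + v n))
          \<le> vnorm E (u n - u' n) + vnorm E (v n - v' n)" by simp
      show "(\<lambda>n. vnorm E (u n - u' n) + vnorm E (v n - v' n)) \<longlonglongrightarrow> 0"
        using tendsto_add[OF lim] by simp
    qed (use u v uv' in \<open>simp add: vnorm_nonneg carrier_diff carrier_add vcauchy_carrier\<close>)
  qed (use that u v in \<open>simp_all add: null_rel_iff vcauchy_add\<close>)
  have "vadd (completion E) (null_class u) (null_class v) =
      (\<Union>u'\<in>null_class u. \<Union>v'\<in>null_class v. null_class (\<lambda>n. u' n + v' n))"
    by (simp add: completion_def vadd_eq)
  also have "\<dots> = null_class (\<lambda>n. u n + v n)"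
    by (rule UN_const_eq[OF null_class_self[OF u]], rule UN_const_eq[OF null_class_self[OF v]], rule *)
  finally show ?thesis .
qed

lemma completion_scale:
  assumes u: "u \<in> vcauchy E"
  shows "vscale (completion E) c (null_class u) = null_class (\<lambda>n. vscale E c (u n))"
proof -
  have *: "null_class (\<lambda>n. vscale E c (u' n)) = null_class (\<lambda>n. vscale E c (u n))"
    if "u' \<in> null_class u" for u'
  proof (rule null_class_eqI)
    have u': "u' \<in> vcauchy E" and lim: "(\<lambda>n. vnorm E (u n - u' n)) \<longlonglongrightarrow> 0"
      using that unfolding in_null_class by auto
    have "vnorm E (vscale E c (u' n) - vscale E c (u n)) = norm c * vnorm E (u n - u' n)" for n
      using u u' by (simp add: vnorm_scale carrier_diff vcauchy_carrier vnorm_commute flip: vscale_diff)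
    then show "(\<lambda>n. vnorm E (vscale E c (u' n) - vscale E c (u n))) \<longlonglongrightarrow> 0"
      using tendsto_mult_right_zero[OF lim] by simp
  qed (use that u in \<open>simp_all add: null_rel_iff vcauchy_scale\<close>)
  have "vscale (completion E) c (null_class u) = (\<Union>u'\<in>null_class u. null_class (\<lambda>n. vscale E c (u' n)))"
    by (simp add: completion_def)
  also have "\<dots> = null_class (\<lambda>n. vscale E c (u n))"
    by (rule UN_const_eq[OF null_class_self[OF u]], rule *)
  finally show ?thesis .
qed

text \<open>The seminorm is 1-Lipschitz, so equivalent Cauchy sequences have seminorms with a common
  limit, which \<open>THE\<close> then picks.\<close>

lemma completion_norm:
  assumes u: "u \<in> vcauchy E"
  shows "(\<lambda>n. vnorm E (u n)) \<longlonglongrightarrow> vnorm (completion E) (null_class u)"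
proof -
  obtain r where r: "(\<lambda>n. vnorm E (u n)) \<longlonglongrightarrow> r"
    using vcauchy_norm_convergent[OF u] by (auto simp: convergent_def)
  have all: "(\<lambda>n. vnorm E (u' n)) \<longlonglongrightarrow> r" if "u' \<in> null_class u" for u'
  proof -
    have u': "u' \<in> vcauchy E" and lim: "(\<lambda>n. vnorm E (u n - u' n)) \<longlonglongrightarrow> 0"
      using that unfolding in_null_class by auto
    have "(\<lambda>n. vnorm E (u n) - vnorm E (u' n)) \<longlonglongrightarrow> 0"
      by (rule Lim_null_comparison[OF _ lim])
        (use u u' in \<open>simp add: vnorm_reverse_triangle vcauchy_carrier\<close>)
    from tendsto_diff[OF r this] show ?thesis by simp
  qed
  have "vnorm (completion E) (null_class u) = (THE r. \<forall>u'\<in>null_class u. (\<lambda>n. vnorm E (u' n)) \<longlonglongrightarrow> r)"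
    by (simp add: completion_def)
  also have "\<dots> = r"
    by (rule the_equality) (use all null_class_self[OF u] LIMSEQ_unique r in blast)+
  finally show ?thesis using r by simp
qed

lemma completion_dist:
  assumes u: "u \<in> vcauchy E" and v: "v \<in> vcauchy E"
  shows "(\<lambda>n. vnorm E (u n - v n)) \<longlonglongrightarrow> vdist (completion E) (null_class u) (null_class v)"
proof -
  have "vdist (completion E) (null_class u) (null_class v) = vnorm (completion E) (null_class (\<lambda>n. u n - v n))"
    unfolding vdist_def using u v vcauchy_minus[OF v]
    by (simp add: completion_scale vscale_m1 completion_add)
  then show ?thesis using completion_norm[OF vcauchy_diff[OF u v]] by simp
qed

lemma completion_dist_eq_norm:
  assumes u: "u \<in> vcauchy E" and v: "v \<in> vcauchy E"
  shows "vdist (completion E) (null_class u) (null_class v) = vnorm (completion E) (null_class (\<lambda>n. u n - v n))"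
  by (rule LIMSEQ_unique[OF completion_dist[OF u v] completion_norm[OF vcauchy_diff[OF u v]]])

lemma completion_dist_nonneg:
  assumes "z \<in> vcarrier (completion E)" "w \<in> vcarrier (completion E)"
  shows "0 \<le> vdist (completion E) z w"
proof -
  obtain u v where uv: "u \<in> vcauchy E" "v \<in> vcauchy E" "z = null_class u" "w = null_class v"
    using assms by (auto simp: completion_carrier)
  show ?thesis unfolding uv(3,4)
    by (rule LIMSEQ_le_const[OF completion_dist[OF uv(1,2)]])
      (use uv(1,2) in \<open>simp add: vnorm_nonneg carrier_diff vcauchy_carrier\<close>)
qed

lemma completion_partial_sum:
  assumes "\<And>i. a i \<in> vcarrier E"
  shows "vpartial_sum (completion E) (\<lambda>i. into_completion E (a i)) n = null_class (\<lambda>_. \<Sum>i<n. a i)"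
  by (induction n)
    (use assms in \<open>simp_all add: completion_zero into_completion_def completion_add vcauchy_const carrier_sum\<close>)

end


section \<open>Coupling discrete laws\<close>

text \<open>Base 3 with digits 0 and 2, so values lie in the Cantor set. Unlike in base 2, closeness
  of two codes forces agreement of their leading bits.\<close>

definition ternary_code :: "(nat \<Rightarrow> bool) \<Rightarrow> real" where
  "ternary_code b = (\<Sum>m. of_bool (b m) * (2 / 3 ^ Suc m))"

lemma ternary_weights_sums: "(\<lambda>i. 2 / 3 ^ Suc (i + m) :: real) sums (1 / 3 ^ m)"
proof -
  have "(\<lambda>i. (2 / 3 ^ Suc m) * (1 / 3) ^ i :: real) sums ((2 / 3 ^ Suc m) * (1 / (1 - 1 / 3)))"
    by (intro sums_mult geometric_sums) simp
  then show ?thesis by (simp add: power_add field_simps)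
qed

lemma ternary_code_summable: "summable (\<lambda>m. of_bool (b m) * (2 / 3 ^ Suc m) :: real)"
proof (rule summable_comparison_test')
  show "summable (\<lambda>m. 2 / 3 ^ Suc m :: real)"
    using sums_summable[OF ternary_weights_sums[of 0]] by simp
qed auto

lemma ternary_code_bounds: "0 \<le> ternary_code b" "ternary_code b \<le> 1"
proof -
  show "0 \<le> ternary_code b"
    unfolding ternary_code_def by (intro suminf_nonneg ternary_code_summable) simp
  have "ternary_code b \<le> (\<Sum>m. 2 / 3 ^ Suc (m + 0))"
    unfolding ternary_code_def
    by (intro suminf_le ternary_code_summable sums_summable[OF ternary_weights_sums]) auto
  also have "\<dots> = 1" using sums_unique[OF ternary_weights_sums[of 0]] by simp
  finally show "ternary_code b \<le> 1" .
qed

text \<open>The first differing digit contributes \<open>2 / 3 ^ Suc m\<close>, and all later digits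
  together can take back at most half of it.\<close>

lemma ternary_code_gap:
  assumes eq: "\<And>i. i < m \<Longrightarrow> b i = b' i" and m: "b m" "\<not> b' m"
  shows "ternary_code b - ternary_code b' \<ge> 1 / 3 ^ Suc m"
proof -
  define d where "d i = (of_bool (b i) - of_bool (b' i)) * (2 / 3 ^ Suc i :: real)" for i
  have sd: "summable d"
    unfolding d_def left_diff_distrib by (intro summable_diff ternary_code_summable)
  have "ternary_code b - ternary_code b' = suminf d"
    unfolding ternary_code_def suminf_diff[OF ternary_code_summable ternary_code_summable]
    by (simp only: d_def[abs_def] left_diff_distrib)
  also have "\<dots> = (\<Sum>i. d (i + Suc m)) + (\<Sum>i<Suc m. d i)"
    by (rule suminf_split_initial_segment[OF sd])
  also have "(\<Sum>i<Suc m. d i) = 2 / 3 ^ Suc m"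
    using m by (simp add: d_def eq)
  also have "(\<Sum>i. d (i + Suc m)) \<ge> (\<Sum>i. - (2 / 3 ^ Suc (i + Suc m)))"
  proof (rule suminf_le)
    show "- (2 / 3 ^ Suc (i + Suc m)) \<le> d (i + Suc m)" for i
      by (auto simp: d_def of_bool_def)
    show "summable (\<lambda>i. - (2 / 3 ^ Suc (i + Suc m)) :: real)"
      by (intro summable_minus sums_summable[OF ternary_weights_sums])
    show "summable (\<lambda>i. d (i + Suc m))" by (rule summable_ignore_initial_segment[OF sd])
  qed
  then have "(\<Sum>i. d (i + Suc m)) \<ge> - (1 / 3 ^ Suc m)"
    using sums_unique[OF sums_minus[OF ternary_weights_sums[of "Suc m"]]] by simp
  ultimately show ?thesis by simp
qed

lemma ternary_code_close:
  assumes "\<bar>ternary_code b - ternary_code b'\<bar> < 1 / 3 ^ Suc m"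
  shows "b m = b' m"
proof (rule ccontr)
  assume ne: "b m \<noteq> b' m"
  define k where "k = (LEAST i. b i \<noteq> b' i)"
  have k: "b k \<noteq> b' k" "k \<le> m" and lt: "\<And>i. i < k \<Longrightarrow> b i = b' i"
    unfolding k_def using ne
      LeastI[of "\<lambda>i. b i \<noteq> b' i"] Least_le[of "\<lambda>i. b i \<noteq> b' i"] not_less_Least[of _ "\<lambda>i. b i \<noteq> b' i"]
    by blast+
  have "\<bar>ternary_code b - ternary_code b'\<bar> \<ge> 1 / 3 ^ Suc k"
    using ternary_code_gap[of k b b'] ternary_code_gap[of k b' b] k lt by fastforce
  moreover have "(1::real) / 3 ^ Suc k \<ge> 1 / 3 ^ Suc m"
    using k(2) by (intro divide_left_mono power_increasing) auto
  ultimately show False using assms by linarith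
qed

text \<open>A bounded sequence that does not converge has two cluster points, and a rational between
  them is crossed infinitely often.\<close>

lemma convergent_by_rational_cuts:
  fixes a :: "nat \<Rightarrow> real"
  assumes bdd: "bounded (range a)"
    and cut: "\<And>q :: rat. (\<forall>\<^sub>F n in sequentially. a n < of_rat q) \<or> (\<forall>\<^sub>F n in sequentially. \<not> a n < of_rat q)"
  shows "convergent a"
proof -
  obtain l s where s: "strict_mono s" and l: "(a \<circ> s) \<longlonglongrightarrow> l"
    using bounded_imp_convergent_subsequence[OF bdd] by blast
  have fs: "filterlim s sequentially sequentially" by (rule filterlim_subseq[OF s])
  have "a \<longlonglongrightarrow> l"
  proof (rule order_tendstoI)
    fix y assume "y < l"
    then obtain q where q: "y < of_rat q" "of_rat q < l" using of_rat_dense by blast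
    have "\<not> (\<forall>\<^sub>F n in sequentially. a n < of_rat q)"
    proof
      assume "\<forall>\<^sub>F n in sequentially. a n < of_rat q"
      then have "\<forall>\<^sub>F n in sequentially. a (s n) < of_rat q"
        by (rule eventually_compose_filterlim[OF _ fs])
      moreover have "\<forall>\<^sub>F n in sequentially. of_rat q < a (s n)"
        using order_tendstoD(1)[OF l q(2)] by (simp add: o_def)
      ultimately have "\<forall>\<^sub>F n in sequentially. False" by eventually_elim simp
      then show False by simp
    qed
    then have "\<forall>\<^sub>F n in sequentially. \<not> a n < of_rat q" using cut by blast
    then show "\<forall>\<^sub>F n in sequentially. y < a n" by eventually_elim (use q in linarith)
  next
    fix y assume "l < y"
    then obtain q where q: "l < of_rat q" "of_rat q < y" using of_rat_dense by blast
    have "\<not> (\<forall>\<^sub>F n in sequentially. \<not> a n < of_rat q)"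
    proof
      assume "\<forall>\<^sub>F n in sequentially. \<not> a n < of_rat q"
      then have "\<forall>\<^sub>F n in sequentially. \<not> a (s n) < of_rat q"
        by (rule eventually_compose_filterlim[OF _ fs])
      moreover have "\<forall>\<^sub>F n in sequentially. a (s n) < of_rat q"
        using order_tendstoD(2)[OF l q(1)] by (simp add: o_def)
      ultimately have "\<forall>\<^sub>F n in sequentially. False" by eventually_elim simp
      then show False by simp
    qed
    then have "\<forall>\<^sub>F n in sequentially. a n < of_rat q" using cut by blast
    then show "\<forall>\<^sub>F n in sequentially. a n < y" by eventually_elim (use q in linarith)
  qed
  then show ?thesis by (auto simp: convergent_def)
qed

text \<open>The bits \<open>h j x < q\<close> code a point as a real number in such a way that convergence of the codes forces
  convergence of every \<open>h j\<close>; the laws of the codes are tight, so the theorems of Helly and Skorohod on the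
  real line apply.\<close>

lemma skorohod_discrete:
  fixes P :: "nat \<Rightarrow> 'x pmf" and h :: "'j::countable \<Rightarrow> 'x \<Rightarrow> real"
  assumes sep: "\<And>x y. x \<in> S \<Longrightarrow> y \<in> S \<Longrightarrow> (\<And>j. h j x = h j y) \<Longrightarrow> x = y"
    and bdd: "\<And>j. bounded (h j ` S)"
    and PS: "\<And>n. set_pmf (P n) \<subseteq> S"
  obtains r :: "nat \<Rightarrow> nat" and \<Omega> :: "real measure" and X :: "nat \<Rightarrow> real \<Rightarrow> 'x"
  where "strict_mono r" "prob_space \<Omega>"
    "\<And>n. X n \<in> \<Omega> \<rightarrow>\<^sub>M count_space UNIV"
    "\<And>n. distr \<Omega> (count_space UNIV) (X n) = measure_pmf (P (r n))"
    "\<And>n \<omega>. X n \<omega> \<in> S"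
    "\<And>j \<omega>. \<omega> \<in> space \<Omega> \<Longrightarrow> convergent (\<lambda>n. h j (X n \<omega>))"
proof -
  define bit where "bit m x = (case from_nat m of (j :: 'j, q :: rat) \<Rightarrow> h j x < of_rat q)" for m x
  define c where "c x = ternary_code (\<lambda>m. bit m x)" for x
  have bit: "bit (to_nat (j, q)) x \<longleftrightarrow> h j x < of_rat q" for j q x
    by (simp add: bit_def)
  have c_inj: "inj_on c S"
  proof (rule inj_onI)
    fix x y assume xy: "x \<in> S" "y \<in> S" "c x = c y"
    then have eq: "bit m x = bit m y" for m
      using ternary_code_close[of "\<lambda>m. bit m x" "\<lambda>m. bit m y" m] by (simp add: c_def)
    have "h j x = h j y" for j
    proof (rule ccontr)
      assume "h j x \<noteq> h j y"
      then consider "h j x < h j y" | "h j y < h j x" by linarith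
      then show False
      proof cases
        case 1
        then obtain q where "h j x < of_rat q" "of_rat q < h j y" using of_rat_dense by blast
        then show False using eq[of "to_nat (j, q)"] by (simp add: bit)
      next
        case 2
        then obtain q where "h j y < of_rat q" "of_rat q < h j x" using of_rat_dense by blast
        then show False using eq[of "to_nat (j, q)"] by (simp add: bit)
      qed
    qed
    then show "x = y" using sep xy by blast
  qed
  define \<mu> where "\<mu> n = distr (measure_pmf (P n)) borel c" for n
  have \<mu>: "real_distribution (\<mu> n)" for n
    unfolding \<mu>_def by (rule prob_space.real_distribution_distr) (simp_all add: prob_space_measure_pmf)
  have "tight \<mu>"
    unfolding tight_def
  proof (intro conjI allI impI)
    fix e :: real assume "e > 0"
    \<comment> \<open>The left end is \<open>-1\<close> because the interval is open there and
      \<open>0\<close> is a possible code.\<close>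
    have "-1 < c x \<and> c x \<le> 1" for x
      using ternary_code_bounds[of "\<lambda>m. bit m x"] unfolding c_def by linarith
    then have "c -` {-1<..1} = UNIV" by auto
    then have "measure (\<mu> n) {-1<..1} = 1" for n
      unfolding \<mu>_def by (subst measure_distr) auto
    then show "\<exists>a b. a < b \<and> (\<forall>n. 1 - e < measure (\<mu> n) {a<..b})"
      using \<open>e > 0\<close> by (intro exI[of _ "-1"] exI[of _ 1]) simp
  qed (rule \<mu>)
  then obtain r M where r: "strict_mono r" and M: "real_distribution M" "weak_conv_m (\<mu> \<circ> id \<circ> r) M"
    using tight_imp_convergent_subsubsequence[of \<mu> id] by (auto simp: strict_mono_id)
  obtain \<Omega> :: "real measure" and Y :: "nat \<Rightarrow> real \<Rightarrow> real" and Y' where \<Omega>: "prob_space \<Omega>"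
    and Ym [measurable]: "\<And>n. Y n \<in> borel_measurable \<Omega>"
    and Yd: "\<And>n. distr \<Omega> borel (Y n) = \<mu> (r n)"
    and Yc: "\<And>\<omega>. \<omega> \<in> space \<Omega> \<Longrightarrow> (\<lambda>n. Y n \<omega>) \<longlonglongrightarrow> Y' \<omega>"
    using Skorohod[OF _ M, simplified, OF \<mu>]
    by (elim exE conjE) (rule that, assumption, erule spec, erule spec, erule bspec, assumption)
  interpret prob_space \<Omega> by (rule \<Omega>)
  \<comment> \<open>The laws of the codes are carried by countable sets, so decoding is Borel and,
    almost surely, every \<open>Y n\<close> is a genuine code.\<close>
  define D where "D n = c ` set_pmf (P (r n))" for n
  have D_countable: "countable (D n)" for n by (simp add: D_def)
  have D_borel [measurable]: "D n \<in> sets borel" for n by (rule sets.countable[OF _ D_countable]) simp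
  define G where "G = {\<omega> \<in> space \<Omega>. \<forall>n. Y n \<omega> \<in> D n}"
  have G_meas [measurable]: "G \<in> sets \<Omega>" unfolding G_def by measurable
  have "AE \<omega> in \<Omega>. Y n \<omega> \<in> D n" for n
  proof -
    have "AE x in measure_pmf (P (r n)). c x \<in> D n"
      by (simp add: D_def AE_measure_pmf_iff)
    then have "AE y in \<mu> (r n). y \<in> D n"
      unfolding \<mu>_def by (subst AE_distr_iff) simp_all
    then show ?thesis unfolding Yd[symmetric] by (subst (asm) AE_distr_iff) auto
  qed
  then have AE_G: "AE \<omega> in \<Omega>. \<omega> \<in> G"
    unfolding G_def by (auto simp: AE_all_countable)
  obtain x0 where x0: "x0 \<in> S" using PS[of 0] set_pmf_not_empty[of "P 0"] by blast
  define dec where "dec n y = (if y \<in> D n then inv_into S c y else x0)" for n y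
  have dec_meas [measurable]: "dec n \<in> borel \<rightarrow>\<^sub>M count_space UNIV" for n
    by (rule measurable_discrete_difference[where f = "\<lambda>_. x0" and X = "D n"])
      (auto simp: dec_def D_countable)
  have D_S: "D n \<subseteq> c ` S" for n using PS[of "r n"] by (auto simp: D_def)
  have dec_S: "dec n y \<in> S" for n y
    using D_S[of n] x0 by (auto simp: dec_def intro: inv_into_into)
  have dec_c: "dec n (c x) = x" if "x \<in> set_pmf (P (r n))" for n x
    using that PS c_inj by (auto simp: dec_def D_def intro!: inv_into_f_f)
  have c_dec: "c (dec n y) = y" if "y \<in> D n" for n y
    using that D_S[of n] by (auto simp: dec_def f_inv_into_f)
  \<comment> \<open>On the null set outside \<open>G\<close> all \<open>X n\<close> are the constant
    \<open>x0\<close>, which makes membership in \<open>S\<close> and convergence hold everywhere,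
    not just almost everywhere.\<close>
  define X where "X n \<omega> = (if \<omega> \<in> G then dec n (Y n \<omega>) else x0)" for n \<omega>
  have X_meas [measurable]: "X n \<in> \<Omega> \<rightarrow>\<^sub>M count_space UNIV" for n
    unfolding X_def by measurable
  have X_distr: "distr \<Omega> (count_space UNIV) (X n) = measure_pmf (P (r n))" for n
  proof -
    have "distr \<Omega> (count_space UNIV) (X n) = distr \<Omega> (count_space UNIV) (dec n \<circ> Y n)"
      by (rule distr_cong_AE) (use AE_G in \<open>auto simp: X_def elim: eventually_mono\<close>)
    also have "\<dots> = distr (distr \<Omega> borel (Y n)) (count_space UNIV) (dec n)"
      by (rule distr_distr[symmetric]) measurable
    also have "\<dots> = distr (distr (measure_pmf (P (r n))) borel c) (count_space UNIV) (dec n)"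
      by (simp add: Yd \<mu>_def)
    also have "\<dots> = distr (measure_pmf (P (r n))) (count_space UNIV) (dec n \<circ> c)"
      by (rule distr_distr) auto
    also have "\<dots> = distr (measure_pmf (P (r n))) (count_space UNIV) (\<lambda>x. x)"
      by (rule distr_cong_AE) (auto simp: AE_measure_pmf_iff dec_c)
    also have "\<dots> = measure_pmf (P (r n))" by (rule distr_id2) simp
    finally show ?thesis .
  qed
  have conv: "convergent (\<lambda>n. h j (X n \<omega>))" if \<omega>: "\<omega> \<in> space \<Omega>" for j \<omega>
  proof (cases "\<omega> \<in> G")
    case True
    have cX: "c (X n \<omega>) = Y n \<omega>" for n
      using True by (simp add: X_def c_dec G_def)
    \<comment> \<open>The Cauchy property freezes each bit from some index on. The limit
      \<open>Y' \<omega>\<close> itself may fail to be the code of a point of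
      \<open>S\<close>.\<close>
    have "Cauchy (\<lambda>n. c (X n \<omega>))"
      unfolding cX using Yc[OF \<omega>] by (rule LIMSEQ_imp_Cauchy)
    have bits: "(\<forall>\<^sub>F n in sequentially. bit m (X n \<omega>)) \<or> (\<forall>\<^sub>F n in sequentially. \<not> bit m (X n \<omega>))" for m
    proof -
      have "(1::real) / 3 ^ Suc m > 0" by simp
      then obtain N where N: "\<And>n. n \<ge> N \<Longrightarrow> dist (c (X n \<omega>)) (c (X N \<omega>)) < 1 / 3 ^ Suc m"
        using \<open>Cauchy (\<lambda>n. c (X n \<omega>))\<close> unfolding Cauchy_def by (metis order_refl)
      then have "bit m (X n \<omega>) = bit m (X N \<omega>)" if "n \<ge> N" for n
        using that ternary_code_close[of "\<lambda>m. bit m (X n \<omega>)" "\<lambda>m. bit m (X N \<omega>)" m]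
        by (simp add: c_def dist_real_def)
      then show ?thesis by (cases "bit m (X N \<omega>)") (auto simp: eventually_sequentially)
    qed
    show ?thesis
    proof (rule convergent_by_rational_cuts)
      show "bounded (range (\<lambda>n. h j (X n \<omega>)))"
        by (rule bounded_subset[OF bdd[of j]]) (auto simp: X_def dec_S x0)
      show "(\<forall>\<^sub>F n in sequentially. h j (X n \<omega>) < of_rat q) \<or> (\<forall>\<^sub>F n in sequentially. \<not> h j (X n \<omega>) < of_rat q)" for q
        using bits[of "to_nat (j, q)"] by (simp add: bit)
    qed
  qed (simp add: X_def convergent_const)
  show thesis
    by (rule that[OF r \<Omega> X_meas X_distr _ conv]) (auto simp: X_def dec_S x0)
qed


section \<open>The algebraic tensor product\<close>

lemma sum_fun_apply: "(\<Sum>i\<in>A. f i) x = (\<Sum>i\<in>A. f i x)"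
  by (induction A rule: infinite_finite_induct) auto

lemma elem_tensor_add_left:
  assumes "f \<in> dual sX" "f' \<in> dual sX" "g \<in> dual sY"
  shows "elem_tensor sX sY (f + f') g = elem_tensor sX sY f g + elem_tensor sX sY f' g"
  using assms by (auto simp: elem_tensor_def bilinear_forms_def fun_eq_iff)

lemma elem_tensor_add_right:
  assumes "f \<in> dual sX" "g \<in> dual sY" "g' \<in> dual sY"
  shows "elem_tensor sX sY f (g + g') = elem_tensor sX sY f g + elem_tensor sX sY f g'"
  using assms by (auto simp: elem_tensor_def bilinear_forms_def fun_eq_iff)

lemma elem_tensor_scale_left:
  assumes "f \<in> dual sX" "g \<in> dual sY"
  shows "elem_tensor sX sY (dual_scale c f) g = (\<lambda>B. c * elem_tensor sX sY f g B)"
  using assms by (auto simp: elem_tensor_def bilinear_forms_def fun_eq_iff)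

lemma elem_tensor_diff_left:
  assumes "f \<in> dual sX" "f' \<in> dual sX" "g \<in> dual sY"
  shows "elem_tensor sX sY (f - f') g = elem_tensor sX sY f g - elem_tensor sX sY f' g"
  using elem_tensor_add_left[of "f - f'" sX f' g sY] assms by (simp add: dual_diff)

lemma elem_tensor_diff_right:
  assumes "f \<in> dual sX" "g \<in> dual sY" "g' \<in> dual sY"
  shows "elem_tensor sX sY f (g - g') = elem_tensor sX sY f g - elem_tensor sX sY f g'"
  using elem_tensor_add_right[of f sX "g - g'" sY g'] assms by (simp add: dual_diff)

lemma elem_tensor_scaleR_left:
  assumes "f \<in> dual sX" "g \<in> dual sY"
  shows "elem_tensor sX sY (r *\<^sub>R f) g = (\<lambda>B. r *\<^sub>R elem_tensor sX sY f g B)"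
  using elem_tensor_scale_left[OF assms] by (simp add: scaleR_eq_dual_scale scaleR_conv_of_real)

lemma alg_tensor_norm_le:
  assumes "tensor_rep sX sY n f g z"
  shows "vnorm (alg_tensor sX sY) z \<le> (\<Sum>i<n. norm (f i) * norm (g i))"
  unfolding alg_tensor_def
  by (simp, rule cInf_lower) (use assms in \<open>auto intro!: bdd_belowI[of _ 0] sum_nonneg\<close>)

text \<open>Arbitrary finite index sets are allowed so that later sums over disjoint unions and
  products of index sets require no renumbering.\<close>

lemma alg_tensor_sum:
  assumes A: "finite A" and d: "\<And>a. a \<in> A \<Longrightarrow> f a \<in> dual sX" "\<And>a. a \<in> A \<Longrightarrow> g a \<in> dual sY"
  shows "(\<Sum>a\<in>A. elem_tensor sX sY (f a) (g a)) \<in> vcarrier (alg_tensor sX sY)"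
    and "vnorm (alg_tensor sX sY) (\<Sum>a\<in>A. elem_tensor sX sY (f a) (g a)) \<le> (\<Sum>a\<in>A. norm (f a) * norm (g a))"
proof -
  obtain h where h: "bij_betw h {0..<card A} A" using ex_bij_betw_nat_finite[OF A] by blast
  then have h': "bij_betw h {..<card A} A" by (simp add: atLeast0LessThan)
  have rep: "tensor_rep sX sY (card A) (f \<circ> h) (g \<circ> h) (\<Sum>a\<in>A. elem_tensor sX sY (f a) (g a))"
    unfolding tensor_rep_def
  proof
    show "\<forall>i<card A. (f \<circ> h) i \<in> dual sX \<and> (g \<circ> h) i \<in> dual sY"
      using bij_betwE[OF h'] d by auto
    show "(\<Sum>a\<in>A. elem_tensor sX sY (f a) (g a)) = (\<lambda>B. \<Sum>i<card A. elem_tensor sX sY ((f \<circ> h) i) ((g \<circ> h) i) B)"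
      by (rule ext) (simp add: sum_fun_apply flip: sum.reindex_bij_betw[OF h'])
  qed
  then show "(\<Sum>a\<in>A. elem_tensor sX sY (f a) (g a)) \<in> vcarrier (alg_tensor sX sY)"
    by (auto simp: alg_tensor_def)
  show "vnorm (alg_tensor sX sY) (\<Sum>a\<in>A. elem_tensor sX sY (f a) (g a)) \<le> (\<Sum>a\<in>A. norm (f a) * norm (g a))"
    using alg_tensor_norm_le[OF rep] by (simp add: sum.reindex_bij_betw[OF h', of "\<lambda>a. norm (f a) * norm (g a)"])
qed

lemma alg_tensor_elem:
  assumes "f \<in> dual sX" "g \<in> dual sY"
  shows "elem_tensor sX sY f g \<in> vcarrier (alg_tensor sX sY)"
    and "vnorm (alg_tensor sX sY) (elem_tensor sX sY f g) \<le> norm f * norm g"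
  using alg_tensor_sum[of "{()}" "\<lambda>_. f" sX "\<lambda>_. g" sY] assms by simp_all

lemma alg_tensor_rep_ex:
  assumes z: "z \<in> vcarrier (alg_tensor sX sY)" and e: "e > 0"
  obtains n f g where "\<And>i::nat. f i \<in> dual sX" "\<And>i. g i \<in> dual sY"
    "z = (\<Sum>i<n. elem_tensor sX sY (f i) (g i))"
    "(\<Sum>i<n. norm (f i) * norm (g i)) < vnorm (alg_tensor sX sY) z + e"
proof -
  let ?R = "{(\<Sum>i<n. norm (f i) * norm (g i)) | n f g. tensor_rep sX sY n f g z}"
  have "Inf ?R < vnorm (alg_tensor sX sY) z + e"
    using e by (simp add: alg_tensor_def)
  moreover have "?R \<noteq> {}" using z by (auto simp: alg_tensor_def)
  moreover have "bdd_below ?R" by (auto intro!: bdd_belowI[of _ 0] sum_nonneg)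
  ultimately obtain n f g where rep: "tensor_rep sX sY n f g z"
    and lt: "(\<Sum>i<n. norm (f i) * norm (g i)) < vnorm (alg_tensor sX sY) z + e"
    by (subst (asm) cInf_less_iff) auto
  show thesis
  proof
    \<comment> \<open>Padding with \<open>0\<close> from index \<open>n\<close> on makes the
      memberships hold for every \<open>i\<close>.\<close>
    show "(if i < n then f i else 0) \<in> dual sX" "(if i < n then g i else 0) \<in> dual sY" for i
      using rep by (auto simp: tensor_rep_def dual_zero)
    show "z = (\<Sum>i<n. elem_tensor sX sY (if i < n then f i else 0) (if i < n then g i else 0))"
      using rep by (auto simp: tensor_rep_def sum_fun_apply fun_eq_iff)
    show "(\<Sum>i<n. norm (if i < n then f i else 0) * norm (if i < n then g i else 0))
        < vnorm (alg_tensor sX sY) z + e"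
      using lt by simp
  qed
qed

lemma seminormed_alg_tensor: "seminormed_structure (alg_tensor sX sY)"
proof -
  let ?E = "alg_tensor sX sY"
  have add: "u + v \<in> vcarrier ?E \<and> vnorm ?E (u + v) \<le> vnorm ?E u + vnorm ?E v"
    if uv: "u \<in> vcarrier ?E" "v \<in> vcarrier ?E" for u v
  proof -
    have *: "u + v \<in> vcarrier ?E \<and> vnorm ?E (u + v) \<le> vnorm ?E u + vnorm ?E v + e" if "e > 0" for e
    proof -
      have "e / 2 > 0" using that by simp
      obtain n f g where u: "\<And>i::nat. f i \<in> dual sX" "\<And>i. g i \<in> dual sY"
        "u = (\<Sum>i<n. elem_tensor sX sY (f i) (g i))"
        "(\<Sum>i<n. norm (f i) * norm (g i)) < vnorm ?E u + e / 2"
        by (rule alg_tensor_rep_ex[OF uv(1) \<open>e / 2 > 0\<close>]) blast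
      obtain n' f' g' where v: "\<And>i::nat. f' i \<in> dual sX" "\<And>i. g' i \<in> dual sY"
        "v = (\<Sum>i<n'. elem_tensor sX sY (f' i) (g' i))"
        "(\<Sum>i<n'. norm (f' i) * norm (g' i)) < vnorm ?E v + e / 2"
        by (rule alg_tensor_rep_ex[OF uv(2) \<open>e / 2 > 0\<close>]) blast
      \<comment> \<open>Concatenation of the two representations, indexed by the disjoint
        sum.\<close>
      have "u + v = (\<Sum>a\<in>{..<n} <+> {..<n'}. elem_tensor sX sY (case_sum f f' a) (case_sum g g' a))"
        by (simp add: u(3) v(3) sum.Plus)
      moreover have "(\<Sum>a\<in>{..<n} <+> {..<n'}. norm (case_sum f f' a) * norm (case_sum g g' a))
          \<le> vnorm ?E u + vnorm ?E v + e"
        using u(4) v(4) by (simp add: sum.Plus)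
      moreover have "case_sum f f' a \<in> dual sX" "case_sum g g' a \<in> dual sY" for a
        using u(1,2) v(1,2) by (auto split: sum.split)
      ultimately show ?thesis
        using alg_tensor_sum[of "{..<n} <+> {..<n'}" "case_sum f f'" sX "case_sum g g'" sY] by force
    qed
    show ?thesis using *[of 1] * by (auto intro: field_le_epsilon)
  qed
  have scale: "vscale ?E c u \<in> vcarrier ?E \<and> vnorm ?E (vscale ?E c u) \<le> norm c * vnorm ?E u"
    if u: "u \<in> vcarrier ?E" for c u
  proof -
    have *: "vscale ?E c u \<in> vcarrier ?E \<and> vnorm ?E (vscale ?E c u) \<le> norm c * (vnorm ?E u + e)"
      if e: "e > 0" for e
    proof -
      obtain n f g where u: "\<And>i::nat. f i \<in> dual sX" "\<And>i. g i \<in> dual sY"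
        "u = (\<Sum>i<n. elem_tensor sX sY (f i) (g i))"
        "(\<Sum>i<n. norm (f i) * norm (g i)) < vnorm ?E u + e"
        by (rule alg_tensor_rep_ex[OF u e]) blast
      have "vscale ?E c u = (\<Sum>i<n. elem_tensor sX sY (dual_scale c (f i)) (g i))"
        by (rule ext) (simp add: u alg_tensor_def elem_tensor_scale_left sum_fun_apply sum_distrib_left)
      moreover have "(\<Sum>i<n. norm (dual_scale c (f i)) * norm (g i)) \<le> norm c * (\<Sum>i<n. norm (f i) * norm (g i))"
        unfolding sum_distrib_left mult.assoc[symmetric]
        by (intro sum_mono mult_right_mono norm_dual_scale_le) simp
      moreover have "norm c * (\<Sum>i<n. norm (f i) * norm (g i)) \<le> norm c * (vnorm ?E u + e)"
        using u(4) by (intro mult_left_mono) auto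
      ultimately show ?thesis
        using alg_tensor_sum[of "{..<n}" "\<lambda>i. dual_scale c (f i)" sX g sY] u(1,2)
        by (force simp: dual_dual_scale)
    qed
    have "vnorm ?E (vscale ?E c u) \<le> norm c * vnorm ?E u + e" if "e > 0" for e
    proof -
      \<comment> \<open>The \<open>+ 1\<close> keeps the divisor positive when
        \<open>c = 0\<close>.\<close>
      have "norm c * (e / (norm c + 1)) \<le> e" using that by (simp add: divide_simps mult_mono add_nonneg_pos)
      then show ?thesis
        using *[of "e / (norm c + 1)"] that by (simp add: add_nonneg_pos distrib_left)
    qed
    then show ?thesis using *[of 1] by (auto intro: field_le_epsilon)
  qed
  have scale_scale: "vscale ?E a (vscale ?E b u) = vscale ?E (a * b) u" for a b u
    by (simp add: alg_tensor_def mult.assoc)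
  have zero: "0 \<in> vcarrier ?E" "vnorm ?E 0 \<le> 0"
    using alg_tensor_sum[of "{}" "\<lambda>_. 0" sX "\<lambda>_. 0" sY] by simp_all
  have nonneg: "vnorm ?E u \<ge> 0" if u: "u \<in> vcarrier ?E" for u
  proof (rule field_le_epsilon)
    fix e :: real assume "e > 0"
    obtain n f g where "\<And>i::nat. f i \<in> dual sX" "\<And>i. g i \<in> dual sY"
        "u = (\<Sum>i<n. elem_tensor sX sY (f i) (g i))"
        "(\<Sum>i<n. norm (f i) * norm (g i)) < vnorm ?E u + e"
      by (rule alg_tensor_rep_ex[OF u \<open>e > 0\<close>]) blast
    then show "0 \<le> vnorm ?E u + e" using sum_nonneg[of "{..<n}" "\<lambda>i. norm (f i) * norm (g i)"] by simp
  qed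
  show ?thesis
  proof
    show "vnorm ?E (vscale ?E c u) = norm c * vnorm ?E u" if u: "u \<in> vcarrier ?E" for c u
    proof (cases "c = 0")
      case True
      then have "vscale ?E c u = 0" by (simp add: alg_tensor_def fun_eq_iff)
      then show ?thesis using True zero nonneg[OF zero(1)] by simp
    next
      case False
      \<comment> \<open>So far scaling is known only with \<open>\<le>\<close>; scaling back by
        \<open>inverse c\<close> gives the reverse inequality.\<close>
      have "vnorm ?E u = vnorm ?E (vscale ?E (inverse c) (vscale ?E c u))"
        using False by (subst scale_scale) (simp add: alg_tensor_def)
      also have "\<dots> \<le> norm (inverse c) * vnorm ?E (vscale ?E c u)"
        using scale u by blast
      finally have "norm c * vnorm ?E u \<le> vnorm ?E (vscale ?E c u)"
        unfolding norm_inverse using False by (simp add: field_simps)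
      then show ?thesis using scale[OF u, of c] by simp
    qed
  qed (use add scale zero in \<open>auto simp: alg_tensor_def fun_eq_iff right_diff_distrib\<close>)
qed

interpretation alg_tensor: seminormed_structure "alg_tensor sX sY"
  for sX :: "'k::real_or_complex \<Rightarrow> 'a::banach \<Rightarrow> 'a" and sY :: "'k \<Rightarrow> 'b::banach \<Rightarrow> 'b"
  by (rule seminormed_alg_tensor)

text \<open>Tensors accept all bilinear forms; these, indexed by pairs of vectors, are the ones that
  see exactly what \<open>J\<close> retains.\<close>

definition eval_form :: "'a::banach \<Rightarrow> 'b::banach \<Rightarrow> ('a \<Rightarrow>\<^sub>L 'k::real_or_complex) \<Rightarrow> ('b \<Rightarrow>\<^sub>L 'k) \<Rightarrow> 'k" where
  "eval_form x y f g = blinfun_apply f x * blinfun_apply g y"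

lemma elem_tensor_eval_form: "elem_tensor sX sY f g (eval_form x y) = blinfun_apply f x * blinfun_apply g y"
proof -
  have "eval_form x y \<in> bilinear_forms sX sY"
    by (auto simp: bilinear_forms_def eval_form_def blinfun.add_left dual_scale_apply algebra_simps)
  then show ?thesis by (simp add: elem_tensor_def eval_form_def)
qed

text \<open>On one summand this is \<open>norm_blinfun\<close> twice; nearly optimal representations
  bring in the tensor norm. The bound makes evaluation continuous, hence extendable to the
  completion.\<close>

lemma alg_tensor_eval_form_le:
  assumes u: "u \<in> vcarrier (alg_tensor sX sY)"
  shows "norm (u (eval_form x y)) \<le> vnorm (alg_tensor sX sY) u * (norm x * norm y)"
proof (rule field_le_epsilon)
  fix e :: real assume e: "e > 0"
  define e' where "e' = e / (norm x * norm y + 1)"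
  have p: "norm x * norm y + 1 > 0" by (simp add: add_nonneg_pos)
  then have e': "e' > 0" using e by (simp add: e'_def)
  obtain n f g where fg: "\<And>i::nat. f i \<in> dual sX" "\<And>i. g i \<in> dual sY"
        "u = (\<Sum>i<n. elem_tensor sX sY (f i) (g i))"
        "(\<Sum>i<n. norm (f i) * norm (g i)) < vnorm (alg_tensor sX sY) u + e'"
    by (rule alg_tensor_rep_ex[OF u e']) blast
  have "norm (u (eval_form x y)) \<le> (\<Sum>i<n. norm (blinfun_apply (f i) x * blinfun_apply (g i) y))"
    unfolding fg(3) sum_fun_apply elem_tensor_eval_form by (rule norm_sum)
  also have "\<dots> \<le> (\<Sum>i<n. (norm (f i) * norm (g i)) * (norm x * norm y))"
  proof (rule sum_mono)
    fix i
    have "norm (blinfun_apply (f i) x) * norm (blinfun_apply (g i) y) \<le> (norm (f i) * norm x) * (norm (g i) * norm y)"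
      by (intro mult_mono norm_blinfun) auto
    then show "norm (blinfun_apply (f i) x * blinfun_apply (g i) y) \<le> (norm (f i) * norm (g i)) * (norm x * norm y)"
      by (simp add: norm_mult ac_simps)
  qed
  also have "\<dots> = (\<Sum>i<n. norm (f i) * norm (g i)) * (norm x * norm y)" by (simp add: sum_distrib_right)
  also have "\<dots> \<le> (vnorm (alg_tensor sX sY) u + e') * (norm x * norm y)"
    using fg(4) by (intro mult_right_mono) auto
  also have "\<dots> \<le> vnorm (alg_tensor sX sY) u * (norm x * norm y) + e"
  proof -
    have "e' * (norm x * norm y) \<le> e' * (norm x * norm y + 1)" using e' by simp
    also have "\<dots> = e" using p by (simp add: e'_def)
    finally show ?thesis by (simp add: distrib_right)
  qed
  finally show "norm (u (eval_form x y)) \<le> vnorm (alg_tensor sX sY) u * (norm x * norm y) + e" .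
qed

definition eval_lim :: "(nat \<Rightarrow> ('a::banach, 'b::banach, 'k::real_or_complex) tensor) \<Rightarrow> 'a \<Rightarrow> 'b \<Rightarrow> 'k" where
  "eval_lim u x y = lim (\<lambda>n. u n (eval_form x y))"

lemma eval_lim:
  assumes u: "u \<in> vcauchy (alg_tensor sX sY)"
  shows "(\<lambda>n. u n (eval_form x y)) \<longlonglongrightarrow> eval_lim u x y"
proof -
  have "Cauchy (\<lambda>n. u n (eval_form x y))"
    unfolding Cauchy_def
  proof (intro allI impI)
    fix e :: real assume e: "e > 0"
    have p: "norm x * norm y + 1 > 0" by (simp add: add_nonneg_pos)
    then have "e / (norm x * norm y + 1) > 0" using e by simp
    then obtain M where M: "\<forall>m\<ge>M. \<forall>n\<ge>M. vnorm (alg_tensor sX sY) (u m - u n) < e / (norm x * norm y + 1)"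
      using u unfolding alg_tensor.vcauchy_iff by blast
    have "dist (u m (eval_form x y)) (u n (eval_form x y)) < e" if "m \<ge> M" "n \<ge> M" for m n
    proof -
      have c: "u m - u n \<in> vcarrier (alg_tensor sX sY)"
        using u by (simp add: alg_tensor.carrier_diff alg_tensor.vcauchy_carrier)
      have "dist (u m (eval_form x y)) (u n (eval_form x y)) \<le> vnorm (alg_tensor sX sY) (u m - u n) * (norm x * norm y)"
        using alg_tensor_eval_form_le[OF c] by (simp add: dist_norm)
      also have "\<dots> \<le> vnorm (alg_tensor sX sY) (u m - u n) * (norm x * norm y + 1)"
        using alg_tensor.vnorm_nonneg[OF c] by (intro mult_left_mono) auto
      also have "\<dots> < e" using M that p by (simp add: pos_less_divide_eq)
      finally show ?thesis .
    qed
    then show "\<exists>M. \<forall>m\<ge>M. \<forall>n\<ge>M. dist (u m (eval_form x y)) (u n (eval_form x y)) < e" by blast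
  qed
  then show ?thesis
    unfolding eval_lim_def by (simp add: Cauchy_convergent convergent_LIMSEQ_iff[symmetric])
qed

lemma eval_lim_eqI:
  assumes "u \<in> vcauchy (alg_tensor sX sY)" "(\<lambda>n. u n (eval_form x y)) \<longlonglongrightarrow> a"
  shows "eval_lim u x y = a"
  by (rule LIMSEQ_unique[OF eval_lim[OF assms(1)] assms(2)])

text \<open>The bound for finite tensors passes to the limit. At distance \<open>0\<close> it shows
  that \<open>eval_lim\<close> depends only on the class of the Cauchy sequence.\<close>

lemma eval_lim_dist_le:
  assumes u: "u \<in> vcauchy (alg_tensor sX sY)" and v: "v \<in> vcauchy (alg_tensor sX sY)"
  shows "norm (eval_lim u x y - eval_lim v x y) \<le>
    vdist (proj_tensor sX sY) (alg_tensor.null_class sX sY u) (alg_tensor.null_class sX sY v) * (norm x * norm y)"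
proof (rule LIMSEQ_le)
  show "(\<lambda>n. norm (u n (eval_form x y) - v n (eval_form x y))) \<longlonglongrightarrow> norm (eval_lim u x y - eval_lim v x y)"
    by (intro tendsto_norm tendsto_diff eval_lim[OF u] eval_lim[OF v])
  show "(\<lambda>n. vnorm (alg_tensor sX sY) (u n - v n) * (norm x * norm y)) \<longlonglongrightarrow>
      vdist (proj_tensor sX sY) (alg_tensor.null_class sX sY u) (alg_tensor.null_class sX sY v) * (norm x * norm y)"
    by (intro tendsto_mult tendsto_const alg_tensor.completion_dist[OF u v])
  have "norm (u n (eval_form x y) - v n (eval_form x y)) \<le> vnorm (alg_tensor sX sY) (u n - v n) * (norm x * norm y)" for n
    using alg_tensor_eval_form_le[of "u n - v n" sX sY x y] u v
    by (simp add: alg_tensor.carrier_diff alg_tensor.vcauchy_carrier)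
  then show "\<exists>N. \<forall>n\<ge>N. norm (u n (eval_form x y) - v n (eval_form x y)) \<le> vnorm (alg_tensor sX sY) (u n - v n) * (norm x * norm y)"
    by blast
qed


section \<open>Series representations and the kernel of the canonical map\<close>

lemma vcauchy_telescope:
  assumes u: "u \<in> vcauchy (alg_tensor sX sY)"
  obtains r where "strict_mono r"
    "\<And>k. vnorm (alg_tensor sX sY) (u (r (Suc k)) - u (r k)) < (1 / 2) ^ k"
proof -
  have "\<exists>M. \<forall>m\<ge>M. \<forall>n\<ge>M. vnorm (alg_tensor sX sY) (u m - u n) < (1 / 2) ^ k" for k :: nat
    using u unfolding alg_tensor.vcauchy_iff by simp
  then obtain M where M: "\<And>k m n. m \<ge> M k \<Longrightarrow> n \<ge> M k \<Longrightarrow> vnorm (alg_tensor sX sY) (u m - u n) < (1 / 2) ^ k"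
    by metis
  define r where "r = rec_nat (M 0) (\<lambda>k a. max (Suc a) (M (Suc k)))"
  have r_Suc: "r (Suc k) = max (Suc (r k)) (M (Suc k))" for k by (simp add: r_def)
  have rM: "r k \<ge> M k" for k by (cases k) (simp_all add: r_def)
  have lt: "r k < r (Suc k)" for k by (simp add: r_Suc)
  show thesis
  proof
    show "strict_mono r" using lt by (simp add: strict_mono_Suc_iff)
    show "vnorm (alg_tensor sX sY) (u (r (Suc k)) - u (r k)) < (1 / 2) ^ k" for k
      using rM[of k] lt[of k] by (intro M) auto
  qed
qed

text \<open>Common terms cancel and only the symmetric difference is paid for. \<open>C\<close> may
  be larger so that a convenient index set can be used.\<close>

lemma alg_tensor_sum_diff_le:
  assumes "finite A" "finite B"
    and d: "\<And>i. f i \<in> dual sX" "\<And>i. g i \<in> dual sY"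
    and C: "finite C" "A \<union> B - A \<inter> B \<subseteq> C"
  shows "vnorm (alg_tensor sX sY) ((\<Sum>i\<in>A. elem_tensor sX sY (f i) (g i)) - (\<Sum>i\<in>B. elem_tensor sX sY (f i) (g i)))
    \<le> (\<Sum>i\<in>C. norm (f i) * norm (g i))"
proof -
  have eq: "(\<Sum>i\<in>A. elem_tensor sX sY (f i) (g i)) - (\<Sum>i\<in>B. elem_tensor sX sY (f i) (g i))
      = (\<Sum>i\<in>A - B. elem_tensor sX sY (f i) (g i)) - (\<Sum>i\<in>B - A. elem_tensor sX sY (f i) (g i))"
    using assms(1,2) sum.Int_Diff[of A "\<lambda>i. elem_tensor sX sY (f i) (g i)" B]
      sum.Int_Diff[of B "\<lambda>i. elem_tensor sX sY (f i) (g i)" A] by (simp add: Int_commute)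
  have "vnorm (alg_tensor sX sY) ((\<Sum>i\<in>A. elem_tensor sX sY (f i) (g i)) - (\<Sum>i\<in>B. elem_tensor sX sY (f i) (g i)))
      \<le> vnorm (alg_tensor sX sY) (\<Sum>i\<in>A - B. elem_tensor sX sY (f i) (g i))
        + vnorm (alg_tensor sX sY) (\<Sum>i\<in>B - A. elem_tensor sX sY (f i) (g i))"
    unfolding eq using assms by (intro alg_tensor.vnorm_diff_le alg_tensor_sum) auto
  also have "\<dots> \<le> (\<Sum>i\<in>A - B. norm (f i) * norm (g i)) + (\<Sum>i\<in>B - A. norm (f i) * norm (g i))"
    using assms by (intro add_mono alg_tensor_sum) auto
  also have "\<dots> = (\<Sum>i\<in>(A - B) \<union> (B - A). norm (f i) * norm (g i))"
    using assms(1,2) by (intro sum.union_disjoint[symmetric]) auto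
  also have "\<dots> \<le> (\<Sum>i\<in>C. norm (f i) * norm (g i))"
    using C by (intro sum_mono2) auto
  finally show ?thesis .
qed

text \<open>Increments along a fast subsequence are expanded in nearly optimal finite sums, and all
  blocks are merged into one sequence by pair encoding. Absolute convergence makes the merging order
  harmless.\<close>

lemma proj_tensor_series:
  fixes sX :: "'k::real_or_complex \<Rightarrow> 'a::banach \<Rightarrow> 'a" and sY :: "'k \<Rightarrow> 'b::banach \<Rightarrow> 'b"
  assumes u: "u \<in> vcauchy (alg_tensor sX sY)"
  obtains f g where "abs_summable_pair sX sY f g"
    "vsums (proj_tensor sX sY) (\<lambda>i. into_completion (alg_tensor sX sY) (elem_tensor sX sY (f i) (g i)))
       (alg_tensor.null_class sX sY u)"
proof -
  let ?E = "alg_tensor sX sY"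
  obtain r where r: "strict_mono r" and rlt: "\<And>k. vnorm ?E (u (r (Suc k)) - u (r k)) < (1 / 2) ^ k"
    using vcauchy_telescope[OF u] by blast
  define v where "v k = (case k of 0 \<Rightarrow> u (r 0) | Suc k \<Rightarrow> u (r (Suc k)) - u (r k))" for k
  have uc: "u n \<in> vcarrier ?E" for n by (rule alg_tensor.vcauchy_carrier[OF u])
  have vc: "v k \<in> vcarrier ?E" for k
    by (simp add: v_def uc alg_tensor.carrier_diff split: nat.split)
  have sum_v: "(\<Sum>k\<le>K. v k) = u (r K)" for K
    by (induction K) (simp_all add: v_def)
  define Q where "Q k n f g \<longleftrightarrow> (\<forall>i::nat. f i \<in> dual sX) \<and> (\<forall>i. g i \<in> dual sY) \<and>
      v k = (\<Sum>i<n. elem_tensor sX sY (f i) (g i)) \<and>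
      (\<Sum>i<n. norm (f i) * norm (g i)) < vnorm ?E (v k) + (1 / 2) ^ k" for k n f g
  have "\<exists>n f g. Q k n f g" for k
  proof -
    have "(1 / 2 :: real) ^ k > 0" by simp
    then show ?thesis unfolding Q_def by (rule alg_tensor_rep_ex[OF vc[of k]]) blast
  qed
  then obtain n F G where Q: "\<And>k. Q k (n k) (F k) (G k)" by metis
  then have F: "\<And>k i. F k i \<in> dual sX" and G: "\<And>k i. G k i \<in> dual sY"
    and v: "\<And>k. v k = (\<Sum>i<n k. elem_tensor sX sY (F k i) (G k i))"
    and lt: "\<And>k. (\<Sum>i<n k. norm (F k i) * norm (G k i)) < vnorm ?E (v k) + (1 / 2) ^ k"
    unfolding Q_def by blast+
  define f where "f m = (let (k, i) = prod_decode m in if i < n k then F k i else 0)" for m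
  define g where "g m = (let (k, i) = prod_decode m in if i < n k then G k i else 0)" for m
  have fd: "f m \<in> dual sX" and gd: "g m \<in> dual sY" for m
    by (auto simp: f_def g_def F G dual_zero split: prod.split)
  \<comment> \<open>Codes of the blocks \<open>0\<close> to \<open>K\<close>; summed over
    \<open>S K\<close>, the series telescopes exactly to \<open>u (r K)\<close>.\<close>
  define S where "S K = prod_encode ` (SIGMA k:{..K}. {..<n k})" for K
  have fin_S: "finite (S K)" for K by (simp add: S_def)
  have sum_S: "(\<Sum>m\<in>S K. \<phi> m (f m) (g m)) = (\<Sum>k\<le>K. \<Sum>i<n k. \<phi> (prod_encode (k, i)) (F k i) (G k i))"
    for K and \<phi> :: "nat \<Rightarrow> ('a \<Rightarrow>\<^sub>L 'k) \<Rightarrow> ('b \<Rightarrow>\<^sub>L 'k) \<Rightarrow> 'z::comm_monoid_add"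
    unfolding S_def
    by (subst sum.reindex) (auto intro: inj_prod_encode simp: sum.Sigma f_def g_def intro!: sum.cong)
  have S_el: "(\<Sum>m\<in>S K. elem_tensor sX sY (f m) (g m)) = u (r K)" for K
    using sum_S[of "\<lambda>_. elem_tensor sX sY" K] by (simp add: v[symmetric] sum_v)
  \<comment> \<open>A code dominates its first component, so an index \<open>m \<le> K\<close> lies
    in a block \<open>k \<le> K\<close>; outside \<open>S K\<close> it can only be padding.\<close>
  have zero_off: "f m = 0" if "m \<notin> S K" "m \<le> K" for m K
  proof -
    obtain k i where m: "m = prod_encode (k, i)" by (metis prod_decode_inverse surj_pair)
    then have "k \<le> K" using le_prod_encode_1[of k i] that(2) by simp
    then show ?thesis using that(1) by (auto simp: m S_def f_def)
  qed
  have geom: "(\<Sum>k<K. (1 / 2) ^ k :: real) \<le> 2" for K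
    using sum_le_suminf[of "\<lambda>k. (1 / 2) ^ k :: real" "{..<K}"] by (simp add: suminf_geometric)
  \<comment> \<open>The \<open>4\<close> is \<open>2 + 2\<close>: one geometric sum for the
    increments and one for the errors of their representations.\<close>
  have S_bound: "(\<Sum>m\<in>S K. norm (f m) * norm (g m)) \<le> vnorm ?E (u (r 0)) + 4" for K
  proof -
    have "(\<Sum>m\<in>S K. norm (f m) * norm (g m)) = (\<Sum>k\<le>K. \<Sum>i<n k. norm (F k i) * norm (G k i))"
      using sum_S[of "\<lambda>_ a b. norm a * norm b" K] by simp
    also have "\<dots> \<le> (\<Sum>k\<le>K. vnorm ?E (v k) + (1 / 2) ^ k)"
      by (intro sum_mono less_imp_le lt)
    also have "\<dots> = (\<Sum>k\<le>K. vnorm ?E (v k)) + (\<Sum>k<Suc K. (1 / 2) ^ k)"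
      unfolding lessThan_Suc_atMost by (rule sum.distrib)
    also have "(\<Sum>k\<le>K. vnorm ?E (v k)) \<le> vnorm ?E (u (r 0)) + (\<Sum>k<K. (1 / 2) ^ k)"
    proof (induction K)
      case 0
      show ?case by (simp add: v_def)
    next
      case (Suc K)
      have "vnorm ?E (v (Suc K)) \<le> (1 / 2) ^ K" using rlt[of K] by (simp add: v_def)
      then show ?case using Suc by simp
    qed
    finally show ?thesis using geom[of K] geom[of "Suc K"] by linarith
  qed
  have a_summable: "summable (\<lambda>m. norm (f m) * norm (g m))"
  proof (rule summableI_nonneg_bounded)
    fix N
    have "(\<Sum>m<N. norm (f m) * norm (g m)) = (\<Sum>m\<in>{..<N} \<inter> S N. norm (f m) * norm (g m))"
    proof (rule sum.mono_neutral_right)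
      show "\<forall>i\<in>{..<N} - {..<N} \<inter> S N. norm (f i) * norm (g i) = 0"
        using zero_off[of _ N] by auto
    qed auto
    also have "\<dots> \<le> (\<Sum>m\<in>S N. norm (f m) * norm (g m))"
      by (intro sum_mono2) (auto simp: fin_S)
    also have "\<dots> \<le> vnorm ?E (u (r 0)) + 4" by (rule S_bound)
    finally show "(\<Sum>m<N. norm (f m) * norm (g m)) \<le> vnorm ?E (u (r 0)) + 4" .
  qed simp
  show thesis
  proof
    show "abs_summable_pair sX sY f g"
      using fd gd a_summable by (simp add: abs_summable_pair_def)
    have ec: "elem_tensor sX sY (f i) (g i) \<in> vcarrier ?E" for i
      by (rule alg_tensor_elem[OF fd gd])
    let ?p = "\<lambda>N. \<Sum>i<N. elem_tensor sX sY (f i) (g i)"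
    have pc: "?p N \<in> vcarrier ?E" for N by (intro alg_tensor.carrier_sum ec)
    have "(\<lambda>N. vdist (proj_tensor sX sY) (alg_tensor.null_class sX sY (\<lambda>_. ?p N)) (alg_tensor.null_class sX sY u)) \<longlonglongrightarrow> 0"
    proof (rule LIMSEQ_I)
      fix e :: real assume e: "0 < e"
      then obtain N0 where N0: "\<And>m n. m \<ge> N0 \<Longrightarrow> norm (\<Sum>i=m..<n. norm (f i) * norm (g i)) < e / 2"
        using a_summable unfolding summable_Cauchy by (meson half_gt_zero)
      have "vdist (proj_tensor sX sY) (alg_tensor.null_class sX sY (\<lambda>_. ?p N)) (alg_tensor.null_class sX sY u) \<le> e / 2"
        if N: "N \<ge> N0" for N
      proof (rule LIMSEQ_le_const2)
        show "(\<lambda>K. vnorm ?E (?p N - u (r K))) \<longlonglongrightarrow>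
            vdist (proj_tensor sX sY) (alg_tensor.null_class sX sY (\<lambda>_. ?p N)) (alg_tensor.null_class sX sY u)"
          using LIMSEQ_subseq_LIMSEQ[OF alg_tensor.completion_dist[OF alg_tensor.vcauchy_const[OF pc[of N]] u] r]
          by (simp add: o_def)
        have "vnorm ?E (?p N - u (r K)) \<le> e / 2" if K: "K \<ge> N" for K
        proof -
          obtain M where M: "S K \<subseteq> {..<M}" using fin_S finite_nat_bounded by blast
          \<comment> \<open>Below \<open>N\<close> the two index sets differ only in padding, as
            \<open>N \<le> K\<close>; from \<open>N\<close> on the difference is bounded by the
            Cauchy tail.\<close>
          have "vnorm ?E (?p N - u (r K)) \<le> (\<Sum>i\<in>({..<N} - S K) \<union> {N..<M}. norm (f i) * norm (g i))"
            unfolding S_el[symmetric]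
            by (rule alg_tensor_sum_diff_le) (use fd gd M fin_S in auto)
          also have "\<dots> = (\<Sum>i\<in>{N..<M}. norm (f i) * norm (g i))"
          proof (rule sum.mono_neutral_right)
            show "\<forall>i\<in>({..<N} - S K) \<union> {N..<M} - {N..<M}. norm (f i) * norm (g i) = 0"
              using zero_off[of _ K] K by auto
          qed auto
          also have "\<dots> \<le> e / 2" using N0[OF N, of M] by simp
          finally show ?thesis .
        qed
        then show "\<exists>K0. \<forall>K\<ge>K0. vnorm ?E (?p N - u (r K)) \<le> e / 2" by blast
      qed
      moreover have "0 \<le> vdist (proj_tensor sX sY) (alg_tensor.null_class sX sY (\<lambda>_. ?p N)) (alg_tensor.null_class sX sY u)" for N
        by (rule alg_tensor.completion_dist_nonneg)
          (auto simp: alg_tensor.completion_carrier u alg_tensor.vcauchy_const[OF pc])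
      ultimately show "\<exists>N0. \<forall>N\<ge>N0. norm (vdist (proj_tensor sX sY)
          (alg_tensor.null_class sX sY (\<lambda>_. ?p N)) (alg_tensor.null_class sX sY u) - 0) < e"
        using e by (intro exI[of _ N0]) fastforce
    qed
    then show "vsums (proj_tensor sX sY) (\<lambda>i. into_completion ?E (elem_tensor sX sY (f i) (g i)))
       (alg_tensor.null_class sX sY u)"
      by (simp add: vsums_def alg_tensor.completion_partial_sum[OF ec])
  qed
qed

section \<open>Nuclear operators of series and the kernel of \<open>J\<close>\<close>

lemma nuclear_rep_ex:
  assumes fg: "abs_summable_pair sX sY f g"
  obtains T where "nuclear_rep sX sY f g T"
proof -
  define R where "R i = Blinfun (\<lambda>x. dual_scale (blinfun_apply (f i) x) (g i))" for i
  have le: "norm (dual_scale (blinfun_apply (f i) x) (g i)) \<le> norm x * (norm (f i) * norm (g i))" for i x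
  proof -
    have "norm (dual_scale (blinfun_apply (f i) x) (g i)) \<le> norm (blinfun_apply (f i) x) * norm (g i)"
      by (rule norm_dual_scale_le)
    also have "\<dots> \<le> (norm (f i) * norm x) * norm (g i)"
      by (intro mult_right_mono norm_blinfun) simp
    finally show ?thesis by (simp add: ac_simps)
  qed
  have bl: "bounded_linear (\<lambda>x. dual_scale (blinfun_apply (f i) x) (g i))" for i
    by (rule bounded_linear_intro[OF _ _ le])
      (auto intro!: blinfun_eqI simp: dual_scale_apply blinfun.bilinear_simps algebra_simps)
  have R: "blinfun_apply (R i) x = dual_scale (blinfun_apply (f i) x) (g i)" for i x
    unfolding R_def bounded_linear_Blinfun_apply[OF bl] ..
  have "norm (R i) \<le> norm (f i) * norm (g i)" for i
    by (rule norm_blinfun_bound) (use le in \<open>simp_all add: R mult.commute\<close>)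
  moreover have "summable (\<lambda>i. norm (f i) * norm (g i))" using fg by (simp add: abs_summable_pair_def)
  ultimately have "summable R" by (intro summable_comparison_test'[where N = 0 and f = R]) auto
  then have "(\<lambda>i. blinfun_apply (R i) x) sums blinfun_apply (suminf R) x" for x
    by (intro bounded_linear.sums[OF blinfun.bounded_linear_left]) (rule summable_sums)
  then have "nuclear_rep sX sY f g (suminf R)"
    using fg by (simp add: nuclear_rep_def R)
  then show thesis by (rule that)
qed

text \<open>Evaluation at \<open>(x, y)\<close> is continuous on the completion, so both sides sum
  the same scalar series. Hence \<open>T\<close> depends on the class of \<open>u\<close> alone,
  which legitimizes the \<open>THE\<close> in \<open>canonical_map\<close>.\<close>

lemma nuclear_rep_apply:
  assumes T: "nuclear_rep sX sY f g T"
    and s: "vsums (proj_tensor sX sY) (\<lambda>i. into_completion (alg_tensor sX sY) (elem_tensor sX sY (f i) (g i)))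
       (alg_tensor.null_class sX sY u)"
    and u: "u \<in> vcauchy (alg_tensor sX sY)"
  shows "blinfun_apply (blinfun_apply T x) y = eval_lim u x y"
proof -
  have ec: "elem_tensor sX sY (f i) (g i) \<in> vcarrier (alg_tensor sX sY)" for i
    using T by (intro alg_tensor_elem) (auto simp: nuclear_rep_def abs_summable_pair_def)
  let ?p = "\<lambda>N. \<Sum>i<N. elem_tensor sX sY (f i) (g i)"
  have pc: "(\<lambda>_. ?p N) \<in> vcauchy (alg_tensor sX sY)" for N
    by (intro alg_tensor.vcauchy_const alg_tensor.carrier_sum ec)
  have p: "eval_lim (\<lambda>_. ?p N) x y = (\<Sum>i<N. blinfun_apply (f i) x * blinfun_apply (g i) y)" for N
    by (rule eval_lim_eqI[OF pc]) (simp add: sum_fun_apply elem_tensor_eval_form)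
  have "(\<lambda>N. vdist (proj_tensor sX sY) (alg_tensor.null_class sX sY (\<lambda>_. ?p N)) (alg_tensor.null_class sX sY u)) \<longlonglongrightarrow> 0"
    using s by (simp add: vsums_def alg_tensor.completion_partial_sum[OF ec])
  from tendsto_mult_left_zero[OF this, of "norm x * norm y"]
  have "(\<lambda>N. (\<Sum>i<N. blinfun_apply (f i) x * blinfun_apply (g i) y) - eval_lim u x y) \<longlonglongrightarrow> 0"
    by (rule Lim_null_comparison[rotated]) (use eval_lim_dist_le[OF pc u] in \<open>simp add: p[symmetric]\<close>)
  then have "(\<lambda>i. blinfun_apply (f i) x * blinfun_apply (g i) y) sums eval_lim u x y"
    unfolding sums_def by (simp add: Lim_null[symmetric])
  moreover have "(\<lambda>i. dual_scale (blinfun_apply (f i) x) (g i)) sums blinfun_apply T x"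
    using T by (simp add: nuclear_rep_def)
  from bounded_linear.sums[OF blinfun.bounded_linear_left[of y] this]
  have "(\<lambda>i. blinfun_apply (f i) x * blinfun_apply (g i) y) sums blinfun_apply (blinfun_apply T x) y"
    by (simp add: dual_scale_apply)
  ultimately show ?thesis by (rule sums_unique2[symmetric])
qed

lemma canonical_map_apply:
  assumes u: "u \<in> vcauchy (alg_tensor sX sY)"
  shows "blinfun_apply (blinfun_apply (canonical_map sX sY (alg_tensor.null_class sX sY u)) x) y = eval_lim u x y"
proof -
  obtain f g where fg: "abs_summable_pair sX sY f g"
    and s: "vsums (proj_tensor sX sY) (\<lambda>i. into_completion (alg_tensor sX sY) (elem_tensor sX sY (f i) (g i)))
       (alg_tensor.null_class sX sY u)"
    by (rule proj_tensor_series[OF u])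
  obtain T where T: "nuclear_rep sX sY f g T" by (rule nuclear_rep_ex[OF fg])
  have "canonical_map sX sY (alg_tensor.null_class sX sY u) = T"
    unfolding canonical_map_def
  proof (rule the_equality)
    fix T' assume "\<exists>f g. nuclear_rep sX sY f g T' \<and>
      vsums (proj_tensor sX sY) (\<lambda>i. into_completion (alg_tensor sX sY) (elem_tensor sX sY (f i) (g i)))
       (alg_tensor.null_class sX sY u)"
    then show "T' = T"
      using nuclear_rep_apply[OF _ _ u] nuclear_rep_apply[OF T s u] by (auto intro!: blinfun_eqI)
  qed (use T s in blast)
  then show ?thesis using nuclear_rep_apply[OF T s u] by simp
qed

text \<open>From here on \<open>J\<close> disappears: membership in its kernel becomes a condition
  on scalar limits of finite tensors.\<close>

lemma kernel_canonical_map: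
  "vkernel (proj_tensor sX sY) (nuclear_operators sX sY) (canonical_map sX sY) =
     alg_tensor.null_class sX sY ` {u \<in> vcauchy (alg_tensor sX sY). \<forall>x y. eval_lim u x y = 0}"
proof -
  have "canonical_map sX sY (alg_tensor.null_class sX sY u) = 0 \<longleftrightarrow> (\<forall>x y. eval_lim u x y = 0)"
    if u: "u \<in> vcauchy (alg_tensor sX sY)" for u
    unfolding canonical_map_apply[OF u, symmetric] by (auto intro!: blinfun_eqI)
  then show ?thesis
    by (auto simp: vkernel_def nuclear_operators_def alg_tensor.completion_carrier)
qed


section \<open>Tensors as expectations\<close>

lemma integral_measure_pmf_map_finite:
  fixes h :: "'x \<Rightarrow> 'y::{banach, second_countable_topology}"
  assumes "finite A" "set_pmf Q \<subseteq> A"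
  shows "(\<integral>p. h p \<partial>measure_pmf (map_pmf \<kappa> Q)) = (\<Sum>i\<in>A. pmf Q i *\<^sub>R h (\<kappa> i))"
  using assms unfolding integral_map_pmf by (intro integral_measure_pmf) auto

text \<open>The missing mass is put at the extra index \<open>n\<close>, which will carry the zero
  pair and so leave expectations unchanged.\<close>

lemma pmf_of_subprobability:
  fixes p :: "nat \<Rightarrow> real"
  assumes p: "\<And>i. i < n \<Longrightarrow> p i \<ge> 0" and le: "(\<Sum>i<n. p i) \<le> 1"
  obtains Q where "set_pmf Q \<subseteq> {..n}" "\<And>i. i < n \<Longrightarrow> pmf Q i = p i"
proof -
  define q where "q i = (if i < n then p i else if i = n then 1 - (\<Sum>i<n. p i) else 0)" for i
  have q0: "q i \<ge> 0" for i using p le by (simp add: q_def)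
  have "(\<integral>\<^sup>+ i. ennreal (q i) \<partial>count_space UNIV) = (\<Sum>i\<in>{..n}. ennreal (q i))"
    by (rule nn_integral_count_space') (auto simp: q_def)
  also have "\<dots> = ennreal (\<Sum>i\<in>{..n}. q i)" by (rule sum_ennreal) (rule q0)
  also have "(\<Sum>i\<in>{..n}. q i) = 1"
    by (simp add: q_def flip: lessThan_Suc_atMost)
  finally have q1: "(\<integral>\<^sup>+ i. ennreal (q i) \<partial>count_space UNIV) = 1" by simp
  have pmf: "pmf (embed_pmf q) i = q i" for i by (rule pmf_embed_pmf[OF q0 q1])
  show thesis
  proof
    show "set_pmf (embed_pmf q) \<subseteq> {..n}"
      by (auto simp: set_pmf_iff pmf q_def split: if_splits)
    show "i < n \<Longrightarrow> pmf (embed_pmf q) i = p i" for i by (simp add: pmf q_def)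
  qed
qed

lemma blinfun_apply_eq_sgn: "blinfun_apply f x = norm f *\<^sub>R blinfun_apply (sgn f) x"
  by (cases "f = 0") (simp_all add: sgn_div_norm blinfun.scaleR_left)

lemma dual_sgn: "f \<in> dual sX \<Longrightarrow> sgn f \<in> dual sX"
  by (simp add: sgn_div_norm dual_scaleR)

definition dual_ball :: "('k::real_or_complex \<Rightarrow> 'a::banach \<Rightarrow> 'a) \<Rightarrow> ('a \<Rightarrow>\<^sub>L 'k) set" where
  "dual_ball sX = {f \<in> dual sX. norm f \<le> 1}"

text \<open>Each summand is \<open>norm (f i) * norm (g i)\<close> times a tensor of normalized
  functionals; dividing by \<open>t\<close> turns these coefficients into a subprobability. The
  strict bound on the norm yields both a representation cheaper than \<open>t\<close> and
  \<open>t > 0\<close>.\<close>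

lemma alg_tensor_as_expectation:
  fixes sX :: "'k::real_or_complex \<Rightarrow> 'a::banach \<Rightarrow> 'a" and sY :: "'k \<Rightarrow> 'b::banach \<Rightarrow> 'b"
  assumes u: "u \<in> vcarrier (alg_tensor sX sY)" and t: "vnorm (alg_tensor sX sY) u < t"
  obtains P where "set_pmf P \<subseteq> dual_ball sX \<times> dual_ball sY"
    "\<And>x y. cemb (u (eval_form x y)) =
       t *\<^sub>R (\<integral>p. cemb (blinfun_apply (fst p) x * blinfun_apply (snd p) y) \<partial>measure_pmf P)"
proof -
  have t0: "t > 0" using alg_tensor.vnorm_nonneg[OF u] t by linarith
  have "t - vnorm (alg_tensor sX sY) u > 0" using t by simp
  then obtain n f g where fg: "\<And>i::nat. f i \<in> dual sX" "\<And>i. g i \<in> dual sY"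
    and ueq: "u = (\<Sum>i<n. elem_tensor sX sY (f i) (g i))"
    and lt: "(\<Sum>i<n. norm (f i) * norm (g i)) < t"
    by (rule alg_tensor_rep_ex[OF u]) auto
  have "(\<Sum>i<n. norm (f i) * norm (g i) / t) \<le> 1"
    using lt t0 by (simp flip: sum_divide_distrib)
  then obtain Q where Q: "set_pmf Q \<subseteq> {..n}" "\<And>i. i < n \<Longrightarrow> pmf Q i = norm (f i) * norm (g i) / t"
    using pmf_of_subprobability[of n "\<lambda>i. norm (f i) * norm (g i) / t"] t0 by auto
  define \<kappa> where "\<kappa> i = (if i < n then (sgn (f i), sgn (g i)) else (0, 0))" for i
  show thesis
  proof
    show "set_pmf (map_pmf \<kappa> Q) \<subseteq> dual_ball sX \<times> dual_ball sY"
      using fg by (auto simp: \<kappa>_def dual_ball_def dual_sgn dual_zero norm_sgn)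
    fix x y
    have *: "(norm a * norm b) *\<^sub>R (blinfun_apply (sgn a) x * blinfun_apply (sgn b) y) = blinfun_apply a x * blinfun_apply b y"
      for a :: "'a \<Rightarrow>\<^sub>L 'k" and b :: "'b \<Rightarrow>\<^sub>L 'k"
      by (simp add: blinfun_apply_eq_sgn[of a] blinfun_apply_eq_sgn[of b])
    have "t *\<^sub>R (\<integral>p. cemb (blinfun_apply (fst p) x * blinfun_apply (snd p) y) \<partial>measure_pmf (map_pmf \<kappa> Q))
        = t *\<^sub>R (\<Sum>i\<le>n. pmf Q i *\<^sub>R cemb (blinfun_apply (fst (\<kappa> i)) x * blinfun_apply (snd (\<kappa> i)) y))"
      by (subst integral_measure_pmf_map_finite[OF _ Q(1)]) auto
    also have "\<dots> = (\<Sum>i<n. cemb ((norm (f i) * norm (g i)) *\<^sub>R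
        (blinfun_apply (sgn (f i)) x * blinfun_apply (sgn (g i)) y)))"
      using t0 by (simp add: \<kappa>_def Q(2) cemb_scaleR scaleR_sum_right flip: lessThan_Suc_atMost)
    also have "\<dots> = cemb (u (eval_form x y))"
      unfolding * by (simp add: ueq sum_fun_apply elem_tensor_eval_form cemb_sum)
    finally show "cemb (u (eval_form x y)) =
        t *\<^sub>R (\<integral>p. cemb (blinfun_apply (fst p) x * blinfun_apply (snd p) y) \<partial>measure_pmf (map_pmf \<kappa> Q))" ..
  qed
qed

lemma dual_ball_norm_apply: "f \<in> dual_ball sX \<Longrightarrow> norm (blinfun_apply f x) \<le> norm x"
  using norm_blinfun[of f x] mult_right_mono[of "norm f" 1 "norm x"] by (simp add: dual_ball_def)

text \<open>Real and imaginary parts of the values at \<open>a j\<close> and \<open>b j\<close>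
  separate pairs and are bounded on the balls, so the laws can be coupled along them. Convergence at
  these vectors becomes weak* convergence by \<open>dual_ball_convergent\<close>, and the coupling
  lets the product of the two factors converge pointwise.\<close>

lemma dual_ball_pairs_weak_limit:
  fixes sX :: "'k::real_or_complex \<Rightarrow> 'a::banach \<Rightarrow> 'a" and sY :: "'k \<Rightarrow> 'b::banach \<Rightarrow> 'b"
    and P :: "nat \<Rightarrow> (('a \<Rightarrow>\<^sub>L 'k) \<times> ('b \<Rightarrow>\<^sub>L 'k)) pmf" and a :: "nat \<Rightarrow> 'a" and b :: "nat \<Rightarrow> 'b"
  assumes sepX: "\<And>f. f \<in> dual sX \<Longrightarrow> (\<And>j. blinfun_apply f (a j) = 0) \<Longrightarrow> f = 0"
    and sepY: "\<And>g. g \<in> dual sY \<Longrightarrow> (\<And>j. blinfun_apply g (b j) = 0) \<Longrightarrow> g = 0"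
    and P: "\<And>n. set_pmf (P n) \<subseteq> dual_ball sX \<times> dual_ball sY"
  obtains r and \<Omega> :: "real measure" and \<phi> \<psi> where "strict_mono r" "prob_space \<Omega>"
    "\<And>\<omega>. \<omega> \<in> space \<Omega> \<Longrightarrow> \<phi> \<omega> \<in> dual_ball sX" "\<And>\<omega>. \<omega> \<in> space \<Omega> \<Longrightarrow> \<psi> \<omega> \<in> dual_ball sY"
    "\<And>x. (\<lambda>\<omega>. cemb (blinfun_apply (\<phi> \<omega>) x)) \<in> borel_measurable \<Omega>"
    "\<And>y. (\<lambda>\<omega>. cemb (blinfun_apply (\<psi> \<omega>) y)) \<in> borel_measurable \<Omega>"
    "\<And>x y. (\<lambda>n. \<integral>p. cemb (blinfun_apply (fst p) x * blinfun_apply (snd p) y) \<partial>measure_pmf (P (r n)))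
       \<longlonglongrightarrow> (\<integral>\<omega>. cemb (blinfun_apply (\<phi> \<omega>) x * blinfun_apply (\<psi> \<omega>) y) \<partial>\<Omega>)"
proof -
  define S where "S = dual_ball sX \<times> dual_ball sY"
  define val where "val i j p = cemb (if i then blinfun_apply (fst p) (a j) else blinfun_apply (snd p) (b j))"
    for i j and p :: "('a \<Rightarrow>\<^sub>L 'k) \<times> ('b \<Rightarrow>\<^sub>L 'k)"
  \<comment> \<open>\<open>i\<close> selects the factor and \<open>c\<close> the real or imaginary
    part.\<close>
  define h where "h = (\<lambda>(i, c, j) p. if c then Re (val i j p) else Im (val i j p))"
  have h: "h (i, True, j) p = Re (val i j p)" "h (i, False, j) p = Im (val i j p)" for i j p
    by (simp_all add: h_def)
  have "p = q" if p: "p \<in> S" and q: "q \<in> S" and eq: "\<And>j. h j p = h j q" for p q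
  proof -
    have val: "val i j p = val i j q" for i j
      using eq[of "(i, True, j)"] eq[of "(i, False, j)"] by (simp add: h complex_eq_iff)
    have "fst p - fst q = 0"
      by (rule sepX) (use p q val[of True] in \<open>auto simp: S_def dual_ball_def dual_diff val_def blinfun.diff_left\<close>)
    moreover have "snd p - snd q = 0"
      by (rule sepY) (use p q val[of False] in \<open>auto simp: S_def dual_ball_def dual_diff val_def blinfun.diff_left\<close>)
    ultimately show ?thesis by (simp add: prod_eq_iff)
  qed
  moreover have "bounded (h j ` S)" for j
  proof -
    obtain i c k where j: "j = (i, c, k)" by (cases j)
    have "norm (h j p) \<le> max (norm (a k)) (norm (b k))" if "p \<in> S" for p
    proof -
      have "norm (h j p) \<le> norm (val i k p)"
        using abs_Re_le_cmod abs_Im_le_cmod by (simp add: j h_def)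
      also have "\<dots> \<le> max (norm (a k)) (norm (b k))"
        using that by (auto simp: val_def S_def dual_ball_norm_apply le_max_iff_disj)
      finally show ?thesis .
    qed
    then show ?thesis by (intro boundedI[of _ "max (norm (a k)) (norm (b k))"]) auto
  qed
  ultimately obtain r and \<Omega> :: "real measure" and X where r: "strict_mono r" and \<Omega>: "prob_space \<Omega>"
    and X: "\<And>n. X n \<in> \<Omega> \<rightarrow>\<^sub>M count_space UNIV"
    and Xd: "\<And>n. distr \<Omega> (count_space UNIV) (X n) = measure_pmf (P (r n))"
    and XS: "\<And>n \<omega>. X n \<omega> \<in> S"
    and Xc: "\<And>j \<omega>. \<omega> \<in> space \<Omega> \<Longrightarrow> convergent (\<lambda>n. h j (X n \<omega>))"
    by (rule skorohod_discrete[of S h P]) (use P S_def in auto)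
  interpret prob_space \<Omega> by (rule \<Omega>)
  have XS': "fst (X n \<omega>) \<in> dual_ball sX" "snd (X n \<omega>) \<in> dual_ball sY" for n \<omega>
    using XS[of n \<omega>] by (auto simp: S_def mem_Times_iff)
  \<comment> \<open>The branches with constant \<open>0\<close> let both projections be read off
    from convergence of \<open>val i j\<close>.\<close>
  have val_conv: "convergent (\<lambda>n. if i then blinfun_apply (fst (X n \<omega>)) (a j) else 0)"
    "convergent (\<lambda>n. if i then 0 else blinfun_apply (snd (X n \<omega>)) (b j))" if \<omega>: "\<omega> \<in> space \<Omega>" for i j \<omega>
  proof -
    have "convergent (\<lambda>n. val i j (X n \<omega>))"
    proof -
      obtain l m where "(\<lambda>n. Re (val i j (X n \<omega>))) \<longlonglongrightarrow> l" "(\<lambda>n. Im (val i j (X n \<omega>))) \<longlonglongrightarrow> m"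
        using Xc[OF \<omega>, of "(i, True, j)"] Xc[OF \<omega>, of "(i, False, j)"] by (auto simp: h convergent_def)
      then have "(\<lambda>n. Complex (Re (val i j (X n \<omega>))) (Im (val i j (X n \<omega>)))) \<longlonglongrightarrow> Complex l m"
        by (rule tendsto_Complex)
      then show ?thesis by (auto simp: convergent_def)
    qed
    then show "convergent (\<lambda>n. if i then blinfun_apply (fst (X n \<omega>)) (a j) else 0)"
      "convergent (\<lambda>n. if i then 0 else blinfun_apply (snd (X n \<omega>)) (b j))"
      unfolding val_def convergent_cemb_iff by (cases i; simp add: convergent_const)+
  qed
  have "\<exists>l. l \<in> dual_ball sX \<and> (\<forall>x. (\<lambda>n. blinfun_apply (fst (X n \<omega>)) x) \<longlonglongrightarrow> blinfun_apply l x)"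
    if \<omega>: "\<omega> \<in> space \<Omega>" for \<omega>
    by (rule dual_ball_convergent[of "\<lambda>n. fst (X n \<omega>)" sX a])
      (use XS' val_conv(1)[OF \<omega>, of True] in \<open>auto simp: dual_ball_def intro: sepX\<close>)
  then obtain \<phi> where \<phi>: "\<And>\<omega>. \<omega> \<in> space \<Omega> \<Longrightarrow> \<phi> \<omega> \<in> dual_ball sX"
    and \<phi>_lim: "\<And>\<omega> x. \<omega> \<in> space \<Omega> \<Longrightarrow> (\<lambda>n. blinfun_apply (fst (X n \<omega>)) x) \<longlonglongrightarrow> blinfun_apply (\<phi> \<omega>) x"
    by metis
  have "\<exists>l. l \<in> dual_ball sY \<and> (\<forall>y. (\<lambda>n. blinfun_apply (snd (X n \<omega>)) y) \<longlonglongrightarrow> blinfun_apply l y)"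
    if \<omega>: "\<omega> \<in> space \<Omega>" for \<omega>
    by (rule dual_ball_convergent[of "\<lambda>n. snd (X n \<omega>)" sY b])
      (use XS' val_conv(2)[OF \<omega>, of False] in \<open>auto simp: dual_ball_def intro: sepY\<close>)
  then obtain \<psi> where \<psi>: "\<And>\<omega>. \<omega> \<in> space \<Omega> \<Longrightarrow> \<psi> \<omega> \<in> dual_ball sY"
    and \<psi>_lim: "\<And>\<omega> y. \<omega> \<in> space \<Omega> \<Longrightarrow> (\<lambda>n. blinfun_apply (snd (X n \<omega>)) y) \<longlonglongrightarrow> blinfun_apply (\<psi> \<omega>) y"
    by metis
  \<comment> \<open>Any function of \<open>X n\<close> is measurable, its target being discrete; the
    limits \<open>\<phi>\<close> and \<open>\<psi>\<close> inherit measurability only after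
    evaluation at a vector.\<close>
  have X_borel: "(\<lambda>\<omega>. q (X n \<omega>)) \<in> borel_measurable \<Omega>" for n and q :: "_ \<Rightarrow> complex"
    by (rule measurable_compose[OF X]) simp
  show thesis
  proof (rule that[OF r \<Omega> \<phi> \<psi>])
    show "(\<lambda>\<omega>. cemb (blinfun_apply (\<phi> \<omega>) x)) \<in> borel_measurable \<Omega>" for x
      by (rule borel_measurable_LIMSEQ_metric[OF X_borel[of "\<lambda>p. cemb (blinfun_apply (fst p) x)"]])
        (rule tendsto_cemb[OF \<phi>_lim])
    show "(\<lambda>\<omega>. cemb (blinfun_apply (\<psi> \<omega>) y)) \<in> borel_measurable \<Omega>" for y
      by (rule borel_measurable_LIMSEQ_metric[OF X_borel[of "\<lambda>p. cemb (blinfun_apply (snd p) y)"]])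
        (rule tendsto_cemb[OF \<psi>_lim])
    fix x :: 'a and y :: 'b
    let ?q = "\<lambda>p :: ('a \<Rightarrow>\<^sub>L 'k) \<times> ('b \<Rightarrow>\<^sub>L 'k). cemb (blinfun_apply (fst p) x * blinfun_apply (snd p) y)"
    have eq: "(\<integral>p. ?q p \<partial>measure_pmf (P (r n))) = (\<integral>\<omega>. ?q (X n \<omega>) \<partial>\<Omega>)" for n
      unfolding Xd[symmetric] by (rule integral_distr[OF X]) simp
    have lim: "(\<lambda>n. ?q (X n \<omega>)) \<longlonglongrightarrow> cemb (blinfun_apply (\<phi> \<omega>) x * blinfun_apply (\<psi> \<omega>) y)"
      if "\<omega> \<in> space \<Omega>" for \<omega>
      by (intro tendsto_cemb tendsto_mult \<phi>_lim \<psi>_lim that)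
    show "(\<lambda>n. \<integral>p. ?q p \<partial>measure_pmf (P (r n))) \<longlonglongrightarrow>
        (\<integral>\<omega>. cemb (blinfun_apply (\<phi> \<omega>) x * blinfun_apply (\<psi> \<omega>) y) \<partial>\<Omega>)"
      unfolding eq
    proof (rule integral_dominated_convergence[where w = "\<lambda>_. norm x * norm y"])
      show "(\<lambda>\<omega>. cemb (blinfun_apply (\<phi> \<omega>) x * blinfun_apply (\<psi> \<omega>) y)) \<in> borel_measurable \<Omega>"
        by (rule borel_measurable_LIMSEQ_metric[OF X_borel[of ?q] lim])
      show "AE \<omega> in \<Omega>. (\<lambda>n. ?q (X n \<omega>)) \<longlonglongrightarrow> cemb (blinfun_apply (\<phi> \<omega>) x * blinfun_apply (\<psi> \<omega>) y)"
        using lim by (rule AE_I2)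
      show "AE \<omega> in \<Omega>. norm (?q (X n \<omega>)) \<le> norm x * norm y" for n
        using XS' by (auto intro!: AE_I2 mult_mono dual_ball_norm_apply simp: norm_mult)
    qed (auto intro: X_borel)
  qed
qed


section \<open>Bochner integrals of tensors\<close>

lemma (in prob_space) expectation_finite_index:
  fixes h :: "'i \<Rightarrow> 'c::{banach, second_countable_topology}"
  assumes I: "I \<in> M \<rightarrow>\<^sub>M count_space UNIV" and A: "finite A" "\<And>\<omega>. \<omega> \<in> space M \<Longrightarrow> I \<omega> \<in> A"
  shows "integrable M (\<lambda>\<omega>. h (I \<omega>))"
    and "expectation (\<lambda>\<omega>. h (I \<omega>)) = (\<Sum>i\<in>A. prob (I -` {i} \<inter> space M) *\<^sub>R h i)"
proof -
  have ev: "I -` {i} \<inter> space M \<in> events" for i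
    by (rule measurable_sets[OF I]) simp
  have eq: "h (I \<omega>) = (\<Sum>i\<in>A. indicator (I -` {i} \<inter> space M) \<omega> *\<^sub>R h i)" if "\<omega> \<in> space M" for \<omega>
    using A that by (simp add: indicator_def of_bool_def if_distrib[of "\<lambda>c. c *\<^sub>R _"] cong: if_cong)
  have int: "integrable M (\<lambda>\<omega>. indicator (I -` {i} \<inter> space M) \<omega> *\<^sub>R h i)" for i
    using ev by (intro integrable_scaleR_left integrable_indicator) (auto simp: less_top[symmetric])
  show "integrable M (\<lambda>\<omega>. h (I \<omega>))"
    using int by (subst Bochner_Integration.integrable_cong[OF refl eq]) auto
  show "expectation (\<lambda>\<omega>. h (I \<omega>)) = (\<Sum>i\<in>A. prob (I -` {i} \<inter> space M) *\<^sub>R h i)"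
  proof -
    have "expectation (\<lambda>\<omega>. indicator (I -` {i} \<inter> space M) \<omega> *\<^sub>R h i) = prob (I -` {i} \<inter> space M) *\<^sub>R h i" for i
      using ev by (subst integral_scaleR_left) (simp_all add: Int_assoc less_top[symmetric])
    then show ?thesis
      using int by (subst Bochner_Integration.integral_cong[OF refl eq]) simp_all
  qed
qed

text \<open>The index is a running minimizer, updated only on strict improvement; measurability
  follows along the recursion since only countably many indices occur.\<close>

lemma measurable_nearest_index:
  fixes e :: "nat \<Rightarrow> 'w \<Rightarrow> real"
  assumes e [measurable]: "\<And>i. e i \<in> borel_measurable M"
  obtains I where "\<And>k. I k \<in> M \<rightarrow>\<^sub>M count_space UNIV" "\<And>k \<omega>. I k \<omega> \<le> k"
    "\<And>k i \<omega>. i \<le> k \<Longrightarrow> e (I k \<omega>) \<omega> \<le> e i \<omega>"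
proof -
  define I where "I = rec_nat (\<lambda>_. 0) (\<lambda>k J \<omega>. if e (Suc k) \<omega> < e (J \<omega>) \<omega> then Suc k else J \<omega>)"
  have I0: "I 0 = (\<lambda>_. 0)" by (simp add: I_def)
  have IS: "I (Suc k) = (\<lambda>\<omega>. if e (Suc k) \<omega> < e (I k \<omega>) \<omega> then Suc k else I k \<omega>)" for k
    unfolding I_def by simp
  show thesis
  proof
    show "I k \<in> M \<rightarrow>\<^sub>M count_space UNIV" for k
    proof (induction k)
      case (Suc k)
      note Suc [measurable]
      have [measurable]: "(\<lambda>\<omega>. e (I k \<omega>) \<omega>) \<in> borel_measurable M"
        by (rule measurable_compose_countable[OF e Suc])
      show ?case unfolding IS by measurable
    qed (simp add: I0)
    show "I k \<omega> \<le> k" for k \<omega>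
      by (induction k) (auto simp: I0 IS)
    show "e (I k \<omega>) \<omega> \<le> e i \<omega>" if "i \<le> k" for k i \<omega>
      using that by (induction k) (auto simp: I0 IS le_Suc_eq)
  qed
qed

text \<open>A countable norming sequence turns the norm into a countable supremum of scalar
  functions, each measurable by hypothesis; this is the core of Pettis' measurability
  argument.\<close>

lemma borel_measurable_dual_dist:
  fixes sX :: "'k::real_or_complex \<Rightarrow> 'a::banach \<Rightarrow> 'a" and a :: "nat \<Rightarrow> 'a"
  assumes norming: "\<And>j. norm (a j) \<le> 1" "\<And>f. f \<in> dual sX \<Longrightarrow> norm f = (SUP j. norm (blinfun_apply f (a j)))"
    and \<phi>: "\<And>\<omega>. \<omega> \<in> space M \<Longrightarrow> \<phi> \<omega> \<in> dual sX" "\<And>x. (\<lambda>\<omega>. cemb (blinfun_apply (\<phi> \<omega>) x)) \<in> borel_measurable M"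
    and d: "d \<in> dual sX"
  shows "(\<lambda>\<omega>. norm (\<phi> \<omega> - d)) \<in> borel_measurable M"
proof -
  have "(\<lambda>\<omega>. SUP j. norm (cemb (blinfun_apply (\<phi> \<omega>) (a j)) - cemb (blinfun_apply d (a j)))) \<in> borel_measurable M"
  proof (rule borel_measurable_cSUP)
    show "(\<lambda>\<omega>. norm (cemb (blinfun_apply (\<phi> \<omega>) (a j)) - cemb (blinfun_apply d (a j)))) \<in> borel_measurable M" for j
      using \<phi>(2) by simp
    show "bdd_above (range (\<lambda>j. norm (cemb (blinfun_apply (\<phi> \<omega>) (a j)) - cemb (blinfun_apply d (a j)))))" for \<omega>
    proof (rule bdd_aboveI2)
      fix j
      have "norm (cemb (blinfun_apply (\<phi> \<omega>) (a j)) - cemb (blinfun_apply d (a j))) = norm (blinfun_apply (\<phi> \<omega> - d) (a j))"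
        by (simp add: blinfun.diff_left flip: cemb_diff)
      also have "\<dots> \<le> norm (\<phi> \<omega> - d) * 1"
        using norm_blinfun[of "\<phi> \<omega> - d" "a j"] norming(1)[of j]
          mult_left_mono[of "norm (a j)" 1 "norm (\<phi> \<omega> - d)"] by simp
      finally show "norm (cemb (blinfun_apply (\<phi> \<omega>) (a j)) - cemb (blinfun_apply d (a j))) \<le> norm (\<phi> \<omega> - d) * 1" .
    qed
  qed simp
  moreover have "norm (\<phi> \<omega> - d) = (SUP j. norm (cemb (blinfun_apply (\<phi> \<omega>) (a j)) - cemb (blinfun_apply d (a j))))"
    if "\<omega> \<in> space M" for \<omega>
    using norming(2)[OF dual_diff[OF \<phi>(1)[OF that] d]]
    by (simp add: blinfun.diff_left flip: cemb_diff)
  ultimately show ?thesis by (subst measurable_cong)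
qed

text \<open>Choosing a nearest point among the first \<open>k + 1\<close> members of a countable
  dense family gives finitely valued approximations in norm.\<close>

lemma dual_ball_simple_approximation:
  fixes sX :: "'k::real_or_complex \<Rightarrow> 'a::banach \<Rightarrow> 'a"
  assumes sep: "separable_space (top_of_set (dual sX))"
    and \<phi>: "\<And>\<omega>. \<omega> \<in> space M \<Longrightarrow> \<phi> \<omega> \<in> dual_ball sX"
    and meas: "\<And>x. (\<lambda>\<omega>. cemb (blinfun_apply (\<phi> \<omega>) x)) \<in> borel_measurable M"
  obtains d :: "nat \<Rightarrow> 'a \<Rightarrow>\<^sub>L 'k" and I :: "nat \<Rightarrow> 'w \<Rightarrow> nat"
  where "\<And>i. d i \<in> dual sX" "\<And>k. I k \<in> M \<rightarrow>\<^sub>M count_space UNIV" "\<And>k \<omega>. I k \<omega> \<le> k"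
    "\<And>k. (\<lambda>\<omega>. norm (\<phi> \<omega> - d (I k \<omega>))) \<in> borel_measurable M"
    "\<And>k \<omega>. \<omega> \<in> space M \<Longrightarrow> norm (\<phi> \<omega> - d (I k \<omega>)) \<le> 1"
    "\<And>\<omega>. \<omega> \<in> space M \<Longrightarrow> (\<lambda>k. norm (\<phi> \<omega> - d (I k \<omega>))) \<longlonglongrightarrow> 0"
proof (rule separable_dual_sequences[OF sep])
  fix d0 :: "nat \<Rightarrow> 'a \<Rightarrow>\<^sub>L 'k" and a :: "nat \<Rightarrow> 'a"
  assume d0: "\<And>i. d0 i \<in> dual sX"
    and dense: "\<And>f e. f \<in> dual sX \<Longrightarrow> e > 0 \<Longrightarrow> \<exists>i. norm (f - d0 i) < e"
    and a: "\<And>j. norm (a j) \<le> 1" "\<And>f. f \<in> dual sX \<Longrightarrow> norm f = (SUP j. norm (blinfun_apply f (a j)))"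
  \<comment> \<open>Prepending \<open>0\<close> keeps the error below
    \<open>norm (\<phi> \<omega>) \<le> 1\<close> from the first stage on, which later supplies the
    dominating constant; it shifts the indices of \<open>d0\<close> by one.\<close>
  define d where "d = case_nat 0 d0"
  have d: "d i \<in> dual sX" for i using d0 by (simp add: d_def dual_zero split: nat.split)
  have \<phi>': "\<omega> \<in> space M \<Longrightarrow> \<phi> \<omega> \<in> dual sX" "\<omega> \<in> space M \<Longrightarrow> norm (\<phi> \<omega>) \<le> 1" for \<omega>
    using \<phi> by (auto simp: dual_ball_def)
  have em: "(\<lambda>\<omega>. norm (\<phi> \<omega> - d i)) \<in> borel_measurable M" for i
    by (rule borel_measurable_dual_dist[OF a \<phi>'(1) meas d])
  obtain I where I: "\<And>k. I k \<in> M \<rightarrow>\<^sub>M count_space UNIV" "\<And>k \<omega>. I k \<omega> \<le> k"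
    "\<And>k i \<omega>. i \<le> k \<Longrightarrow> norm (\<phi> \<omega> - d (I k \<omega>)) \<le> norm (\<phi> \<omega> - d i)"
    by (rule measurable_nearest_index[of "\<lambda>i \<omega>. norm (\<phi> \<omega> - d i)" M, OF em]) blast
  show thesis
  proof (rule that[OF d I(1,2)])
    show "(\<lambda>\<omega>. norm (\<phi> \<omega> - d (I k \<omega>))) \<in> borel_measurable M" for k
      by (rule measurable_compose_countable[OF em I(1)])
    show "norm (\<phi> \<omega> - d (I k \<omega>)) \<le> 1" if "\<omega> \<in> space M" for k \<omega>
      using I(3)[of 0 k \<omega>] \<phi>'(2)[OF that] by (simp add: d_def)
    show "(\<lambda>k. norm (\<phi> \<omega> - d (I k \<omega>))) \<longlonglongrightarrow> 0" if \<omega>: "\<omega> \<in> space M" for \<omega>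
    proof (rule LIMSEQ_I)
      fix e :: real assume "e > 0"
      then obtain i where i: "norm (\<phi> \<omega> - d0 i) < e" using dense[OF \<phi>'(1)[OF \<omega>]] by blast
      have "norm (\<phi> \<omega> - d (I k \<omega>)) < e" if "k \<ge> Suc i" for k
        using I(3)[OF that, of \<omega>] i by (simp add: d_def)
      then show "\<exists>N. \<forall>k\<ge>N. norm (norm (\<phi> \<omega> - d (I k \<omega>)) - 0) < e" by auto
    qed
  qed
qed

text \<open>The Bochner integral of \<open>\<phi> \<otimes> \<psi>\<close> exists in the completion although \<open>\<phi>\<close> and \<open>\<psi>\<close> are only weak*
  measurable: since the duals are separable, both are pointwise norm limits of simple functions.\<close>

lemma bochner_tensor:
  fixes sX :: "'k::real_or_complex \<Rightarrow> 'a::banach \<Rightarrow> 'a" and sY :: "'k \<Rightarrow> 'b::banach \<Rightarrow> 'b"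
  assumes sep: "separable_space (top_of_set (dual sX))" "separable_space (top_of_set (dual sY))"
    and prob: "prob_space M"
    and \<phi>: "\<And>\<omega>. \<omega> \<in> space M \<Longrightarrow> \<phi> \<omega> \<in> dual_ball sX"
      "\<And>x. (\<lambda>\<omega>. cemb (blinfun_apply (\<phi> \<omega>) x)) \<in> borel_measurable M"
    and \<psi>: "\<And>\<omega>. \<omega> \<in> space M \<Longrightarrow> \<psi> \<omega> \<in> dual_ball sY"
      "\<And>y. (\<lambda>\<omega>. cemb (blinfun_apply (\<psi> \<omega>) y)) \<in> borel_measurable M"
  obtains v where "v \<in> vcauchy (alg_tensor sX sY)"
    "vnorm (proj_tensor sX sY) (alg_tensor.null_class sX sY v) \<le> 1"
    "\<And>x y. cemb (eval_lim v x y) = (\<integral>\<omega>. cemb (blinfun_apply (\<phi> \<omega>) x * blinfun_apply (\<psi> \<omega>) y) \<partial>M)"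
proof -
  interpret prob_space M by (rule prob)
  let ?E = "alg_tensor sX sY"
  obtain d :: "nat \<Rightarrow> 'a \<Rightarrow>\<^sub>L 'k" and I where d: "\<And>i. d i \<in> dual sX"
    and I [measurable]: "\<And>k. I k \<in> M \<rightarrow>\<^sub>M count_space UNIV" and Ik: "\<And>k \<omega>. I k \<omega> \<le> k"
    and dm [measurable]: "\<And>k. (\<lambda>\<omega>. norm (\<phi> \<omega> - d (I k \<omega>))) \<in> borel_measurable M"
    and d1: "\<And>k \<omega>. \<omega> \<in> space M \<Longrightarrow> norm (\<phi> \<omega> - d (I k \<omega>)) \<le> 1"
    and dlim: "\<And>\<omega>. \<omega> \<in> space M \<Longrightarrow> (\<lambda>k. norm (\<phi> \<omega> - d (I k \<omega>))) \<longlonglongrightarrow> 0"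
    by (rule dual_ball_simple_approximation[OF sep(1) \<phi>]) (assumption | rule that)+
  obtain e :: "nat \<Rightarrow> 'b \<Rightarrow>\<^sub>L 'k" and J where e: "\<And>i. e i \<in> dual sY"
    and J [measurable]: "\<And>k. J k \<in> M \<rightarrow>\<^sub>M count_space UNIV" and Jk: "\<And>k \<omega>. J k \<omega> \<le> k"
    and em [measurable]: "\<And>k. (\<lambda>\<omega>. norm (\<psi> \<omega> - e (J k \<omega>))) \<in> borel_measurable M"
    and e1: "\<And>k \<omega>. \<omega> \<in> space M \<Longrightarrow> norm (\<psi> \<omega> - e (J k \<omega>)) \<le> 1"
    and elim: "\<And>\<omega>. \<omega> \<in> space M \<Longrightarrow> (\<lambda>k. norm (\<psi> \<omega> - e (J k \<omega>))) \<longlonglongrightarrow> 0"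
    by (rule dual_ball_simple_approximation[OF sep(2) \<psi>]) (assumption | rule that)+
  define K where "K k \<omega> = (I k \<omega>, J k \<omega>)" for k \<omega>
  define A where "A k = {..k} \<times> {..k}" for k :: nat
  \<comment> \<open>The integral of the simple function \<open>d (I k) \<otimes> e (J k)\<close>, as
    a finite sum over its possible index pairs; the probability is absorbed in the left
    factor.\<close>
  define v where "v k = (\<Sum>p\<in>A k. elem_tensor sX sY (prob (K k -` {p} \<inter> space M) *\<^sub>R d (fst p)) (e (snd p)))" for k
  define \<delta> where "\<delta> k \<omega> = norm (\<phi> \<omega> - d (I k \<omega>)) + norm (\<psi> \<omega> - e (J k \<omega>))" for k \<omega>
  define err where "err k = expectation (\<delta> k)" for k
  have [measurable]: "K k \<in> M \<rightarrow>\<^sub>M count_space UNIV" for k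
  proof -
    have "K k \<in> M \<rightarrow>\<^sub>M (count_space UNIV \<Otimes>\<^sub>M count_space UNIV)" unfolding K_def by measurable
    then show ?thesis by (simp add: pair_measure_countable)
  qed
  have KA: "K k \<omega> \<in> A k" for k \<omega> by (simp add: K_def A_def Ik Jk)
  have finA: "finite (A k)" for k by (simp add: A_def)
  have [measurable]: "\<delta> k \<in> borel_measurable M" for k unfolding \<delta>_def by measurable
  have \<delta>0: "0 \<le> \<delta> k \<omega>" for k \<omega> by (simp add: \<delta>_def)
  have \<delta>2: "\<delta> k \<omega> \<le> 2" if "\<omega> \<in> space M" for k \<omega>
    using d1[OF that, of k] e1[OF that, of k] by (simp add: \<delta>_def)
  have \<delta>_int [simp]: "integrable M (\<delta> k)" for k
    by (rule integrable_const_bound[of _ 2]) (use \<delta>0 \<delta>2 in auto)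
  have err: "err \<longlonglongrightarrow> 0"
  proof -
    have "err \<longlonglongrightarrow> expectation (\<lambda>_. 0)"
      unfolding err_def
    proof (rule integral_dominated_convergence[where w = "\<lambda>_. 2"])
      show "AE \<omega> in M. (\<lambda>k. \<delta> k \<omega>) \<longlonglongrightarrow> 0"
        unfolding \<delta>_def by (intro AE_I2 tendsto_add_zero dlim elim)
      show "AE \<omega> in M. norm (\<delta> k \<omega>) \<le> 2" for k
        using \<delta>0 \<delta>2 by (auto intro!: AE_I2)
    qed simp_all
    then show ?thesis by simp
  qed
  have \<phi>1: "norm (\<phi> \<omega>) \<le> 1" "norm (\<psi> \<omega>) \<le> 1" if "\<omega> \<in> space M" for \<omega>
    using \<phi>(1)[OF that] \<psi>(1)[OF that] by (auto simp: dual_ball_def)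
  \<comment> \<open>Values lie within distance \<open>1\<close> of the unit ball. This crude bound
    serves for domination; \<open>v_norm\<close> uses the sharp one.\<close>
  have d2: "norm (d (I k \<omega>)) \<le> 2" "norm (e (J k \<omega>)) \<le> 2" if "\<omega> \<in> space M" for k \<omega>
    using d1[OF that, of k] e1[OF that, of k] \<phi>1[OF that]
      norm_triangle_ineq3[of "\<phi> \<omega>" "d (I k \<omega>)"] norm_triangle_ineq3[of "\<psi> \<omega>" "e (J k \<omega>)"] by linarith+
  \<comment> \<open>As \<open>K k\<close> takes finitely many values, this holds for every
    \<open>B\<close>, so equalities of tensors can be verified form by form under the
    integral.\<close>
  have v_eval: "cemb (v k B) = expectation (\<lambda>\<omega>. cemb (elem_tensor sX sY (d (I k \<omega>)) (e (J k \<omega>)) B))" for k B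
  proof -
    have "cemb (v k B) = (\<Sum>p\<in>A k. prob (K k -` {p} \<inter> space M) *\<^sub>R cemb (elem_tensor sX sY (d (fst p)) (e (snd p)) B))"
      by (simp add: v_def sum_fun_apply elem_tensor_scaleR_left d e cemb_sum cemb_scaleR)
    also have "\<dots> = expectation (\<lambda>\<omega>. cemb (elem_tensor sX sY (d (fst (K k \<omega>))) (e (snd (K k \<omega>))) B))"
      by (rule expectation_finite_index(2)[symmetric]) (simp_all add: finA KA)
    finally show ?thesis by (simp add: K_def)
  qed
  have v_carrier: "v k \<in> vcarrier ?E" for k
    unfolding v_def by (intro alg_tensor_sum finA dual_scaleR d e)
  have v_norm: "vnorm ?E (v k) \<le> 1 + 2 * err k" for k
  proof -
    have "vnorm ?E (v k) \<le> (\<Sum>p\<in>A k. norm (prob (K k -` {p} \<inter> space M) *\<^sub>R d (fst p)) * norm (e (snd p)))"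
      unfolding v_def by (intro alg_tensor_sum finA dual_scaleR d e)
    also have "\<dots> = expectation (\<lambda>\<omega>. norm (d (fst (K k \<omega>))) * norm (e (snd (K k \<omega>))))"
      by (subst expectation_finite_index(2)[where A = "A k"]) (simp_all add: finA KA mult.assoc)
    also have "\<dots> \<le> expectation (\<lambda>\<omega>. 1 + 2 * \<delta> k \<omega>)"
    proof (rule integral_mono)
      show "integrable M (\<lambda>\<omega>. norm (d (fst (K k \<omega>))) * norm (e (snd (K k \<omega>))))"
        by (rule expectation_finite_index(1)[where A = "A k"]) (simp_all add: finA KA)
      fix \<omega> assume \<omega>: "\<omega> \<in> space M"
      have "norm (d (I k \<omega>)) \<le> 1 + norm (\<phi> \<omega> - d (I k \<omega>))"
        using norm_triangle_ineq3[of "\<phi> \<omega>" "d (I k \<omega>)"] \<phi>1[OF \<omega>] by linarith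
      moreover have "norm (e (J k \<omega>)) \<le> 1 + norm (\<psi> \<omega> - e (J k \<omega>))"
        using norm_triangle_ineq3[of "\<psi> \<omega>" "e (J k \<omega>)"] \<phi>1[OF \<omega>] by linarith
      ultimately have "norm (d (I k \<omega>)) * norm (e (J k \<omega>))
          \<le> (1 + norm (\<phi> \<omega> - d (I k \<omega>))) * (1 + norm (\<psi> \<omega> - e (J k \<omega>)))"
        by (intro mult_mono) auto
      \<comment> \<open>The second error is at most \<open>1\<close>, so the product of the errors
        is absorbed by doubling the first.\<close>
      also have "\<dots> \<le> 1 + 2 * \<delta> k \<omega>"
      proof -
        have "norm (\<phi> \<omega> - d (I k \<omega>)) * norm (\<psi> \<omega> - e (J k \<omega>)) \<le> norm (\<phi> \<omega> - d (I k \<omega>))"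
          using mult_left_mono[OF e1[OF \<omega>, of k], of "norm (\<phi> \<omega> - d (I k \<omega>))"] by simp
        moreover have "0 \<le> norm (\<psi> \<omega> - e (J k \<omega>))" by simp
        ultimately show ?thesis unfolding \<delta>_def distrib_left distrib_right by linarith
      qed
      finally show "norm (d (fst (K k \<omega>))) * norm (e (snd (K k \<omega>))) \<le> 1 + 2 * \<delta> k \<omega>"
        by (simp add: K_def)
    qed simp
    also have "\<dots> = 1 + 2 * err k" by (simp add: err_def prob_space)
    finally show ?thesis .
  qed
  have v_diff: "vnorm ?E (v k - v l) \<le> 2 * err k + 2 * err l" for k l
  proof -
    \<comment> \<open>The joint law of stages \<open>k\<close> and \<open>l\<close> puts both
      tensors over common atoms, where \<open>d \<otimes> e - d' \<otimes> e' = (d - d') \<otimes> e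
      + d' \<otimes> (e - e')\<close> has small norm.\<close>
    define L where "L \<omega> = (K k \<omega>, K l \<omega>)" for \<omega>
    define w where "w q = prob (L -` {q} \<inter> space M)" for q
    define AA where "AA = A k \<times> A l"
    have [measurable]: "L \<in> M \<rightarrow>\<^sub>M count_space UNIV"
    proof -
      have "L \<in> M \<rightarrow>\<^sub>M (count_space UNIV \<Otimes>\<^sub>M count_space UNIV)" unfolding L_def by measurable
      then show ?thesis by (simp add: pair_measure_countable)
    qed
    have LA: "finite AA" "L \<omega> \<in> AA" for \<omega> by (simp_all add: AA_def L_def KA finA)
    have w0: "w q \<ge> 0" for q by (simp add: w_def)
    let ?f1 = "\<lambda>q. w q *\<^sub>R (d (fst (fst q)) - d (fst (snd q)))" and ?g1 = "\<lambda>q. e (snd (fst q))"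
    let ?f2 = "\<lambda>q. w q *\<^sub>R d (fst (snd q))" and ?g2 = "\<lambda>q. e (snd (fst q)) - e (snd (snd q))"
    let ?S1 = "\<Sum>q\<in>AA. elem_tensor sX sY (?f1 q) (?g1 q)" and ?S2 = "\<Sum>q\<in>AA. elem_tensor sX sY (?f2 q) (?g2 q)"
    have "cemb ((v k - v l) B) = cemb ((?S1 + ?S2) B)" for B
    proof -
      let ?h = "\<lambda>q. cemb (elem_tensor sX sY (d (fst (fst q))) (e (snd (fst q))) B)
          - cemb (elem_tensor sX sY (d (fst (snd q))) (e (snd (snd q))) B)"
      have int: "integrable M (\<lambda>\<omega>. cemb (elem_tensor sX sY (d (I k \<omega>)) (e (J k \<omega>)) B))" for k
        using expectation_finite_index(1)[of "K k" "A k" "\<lambda>p. cemb (elem_tensor sX sY (d (fst p)) (e (snd p)) B)"]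
        by (simp add: finA KA) (simp add: K_def)
      have "cemb ((v k - v l) B) = expectation (\<lambda>\<omega>. ?h (L \<omega>))"
        using int by (simp add: cemb_diff v_eval L_def K_def)
      also have "\<dots> = (\<Sum>q\<in>AA. w q *\<^sub>R ?h q)"
        unfolding w_def by (rule expectation_finite_index(2)) (simp_all add: LA)
      also have "\<dots> = (\<Sum>q\<in>AA. cemb (elem_tensor sX sY (?f1 q) (?g1 q) B + elem_tensor sX sY (?f2 q) (?g2 q) B))"
        by (intro sum.cong refl, simp only: elem_tensor_scaleR_left[OF dual_diff[OF d d] e]
            elem_tensor_scaleR_left[OF d dual_diff[OF e e]] elem_tensor_diff_left[OF d d e]
            elem_tensor_diff_right[OF d e e])
          (simp add: cemb_scaleR cemb_diff cemb_add algebra_simps)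
      also have "\<dots> = cemb ((?S1 + ?S2) B)"
        by (simp add: sum_fun_apply sum.distrib flip: cemb_sum)
      finally show ?thesis .
    qed
    then have eq: "v k - v l = ?S1 + ?S2" unfolding cemb_eq_iff by (rule ext)
    have duals: "?f1 q \<in> dual sX" "?g1 q \<in> dual sY" "?f2 q \<in> dual sX" "?g2 q \<in> dual sY" for q
      by (intro dual_scaleR dual_diff d e)+
    have "vnorm ?E (v k - v l) \<le> vnorm ?E ?S1 + vnorm ?E ?S2"
      unfolding eq by (intro alg_tensor.vnorm_triangle alg_tensor_sum LA duals)
    also have "\<dots> \<le> (\<Sum>q\<in>AA. norm (?f1 q) * norm (?g1 q)) + (\<Sum>q\<in>AA. norm (?f2 q) * norm (?g2 q))"
      by (intro add_mono alg_tensor_sum LA duals)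
    also have "\<dots> = (\<Sum>q\<in>AA. w q *\<^sub>R (norm (d (fst (fst q)) - d (fst (snd q))) * norm (e (snd (fst q)))
        + norm (d (fst (snd q))) * norm (e (snd (fst q)) - e (snd (snd q)))))"
      by (simp add: sum.distrib[symmetric] w0 distrib_left ac_simps)
    also have "\<dots> = expectation (\<lambda>\<omega>. norm (d (fst (fst (L \<omega>))) - d (fst (snd (L \<omega>)))) * norm (e (snd (fst (L \<omega>))))
        + norm (d (fst (snd (L \<omega>)))) * norm (e (snd (fst (L \<omega>))) - e (snd (snd (L \<omega>)))))"
      unfolding w_def by (rule expectation_finite_index(2)[symmetric]) (simp_all add: LA)
    also have "\<dots> \<le> expectation (\<lambda>\<omega>. 2 * \<delta> k \<omega> + 2 * \<delta> l \<omega>)"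
    proof (rule integral_mono)
      show "integrable M (\<lambda>\<omega>. norm (d (fst (fst (L \<omega>))) - d (fst (snd (L \<omega>)))) * norm (e (snd (fst (L \<omega>))))
        + norm (d (fst (snd (L \<omega>)))) * norm (e (snd (fst (L \<omega>))) - e (snd (snd (L \<omega>)))))"
        by (rule expectation_finite_index(1)[where A = AA]) (simp_all add: LA)
      fix \<omega> assume \<omega>: "\<omega> \<in> space M"
      have 1: "norm (d (I k \<omega>) - d (I l \<omega>)) \<le> norm (\<phi> \<omega> - d (I k \<omega>)) + norm (\<phi> \<omega> - d (I l \<omega>))"
        using norm_triangle_ineq4[of "\<phi> \<omega> - d (I k \<omega>)" "\<phi> \<omega> - d (I l \<omega>)"] by (simp add: norm_minus_commute)
      have 2: "norm (e (J k \<omega>) - e (J l \<omega>)) \<le> norm (\<psi> \<omega> - e (J k \<omega>)) + norm (\<psi> \<omega> - e (J l \<omega>))"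
        using norm_triangle_ineq4[of "\<psi> \<omega> - e (J k \<omega>)" "\<psi> \<omega> - e (J l \<omega>)"] by (simp add: norm_minus_commute)
      have "norm (d (I k \<omega>) - d (I l \<omega>)) * norm (e (J k \<omega>)) \<le> (norm (\<phi> \<omega> - d (I k \<omega>)) + norm (\<phi> \<omega> - d (I l \<omega>))) * 2"
        using 1 d2(2)[OF \<omega>, of k] by (intro mult_mono) auto
      moreover have "norm (d (I l \<omega>)) * norm (e (J k \<omega>) - e (J l \<omega>)) \<le> 2 * (norm (\<psi> \<omega> - e (J k \<omega>)) + norm (\<psi> \<omega> - e (J l \<omega>)))"
        using 2 d2(1)[OF \<omega>, of l] by (intro mult_mono) auto
      ultimately show "norm (d (fst (fst (L \<omega>))) - d (fst (snd (L \<omega>)))) * norm (e (snd (fst (L \<omega>))))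
        + norm (d (fst (snd (L \<omega>)))) * norm (e (snd (fst (L \<omega>))) - e (snd (snd (L \<omega>))))
        \<le> 2 * \<delta> k \<omega> + 2 * \<delta> l \<omega>"
        by (simp add: L_def K_def \<delta>_def)
    qed simp
    also have "\<dots> = 2 * err k + 2 * err l" by (simp add: err_def)
    finally show ?thesis .
  qed
  have v: "v \<in> vcauchy ?E"
    by (rule alg_tensor.vcauchyI[OF v_carrier v_diff]) (use tendsto_mult_right_zero[OF err] in simp)
  show thesis
  proof (rule that[OF v])
    show "vnorm (proj_tensor sX sY) (alg_tensor.null_class sX sY v) \<le> 1"
    proof (rule LIMSEQ_le[OF alg_tensor.completion_norm[OF v]])
      \<comment> \<open>The excess \<open>2 * err k\<close> disappears in the limit, so no constant
        above \<open>1\<close> survives.\<close>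
      show "(\<lambda>k. 1 + 2 * err k) \<longlonglongrightarrow> 1"
        using tendsto_add[OF tendsto_const tendsto_mult_right_zero[OF err]] by simp
    qed (use v_norm in blast)
    fix x y
    let ?q = "\<lambda>\<omega>. cemb (blinfun_apply (\<phi> \<omega>) x * blinfun_apply (\<psi> \<omega>) y)"
    have qlim: "(\<lambda>k. cemb (blinfun_apply (d (I k \<omega>)) x * blinfun_apply (e (J k \<omega>)) y)) \<longlonglongrightarrow> ?q \<omega>"
      if "\<omega> \<in> space M" for \<omega>
    proof -
      have "(\<lambda>k. \<phi> \<omega> - d (I k \<omega>)) \<longlonglongrightarrow> 0" "(\<lambda>k. \<psi> \<omega> - e (J k \<omega>)) \<longlonglongrightarrow> 0"
        by (rule tendsto_norm_zero_cancel, rule dlim[OF that])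
          (rule tendsto_norm_zero_cancel, rule elim[OF that])
      from this[THEN tendsto_diff[OF tendsto_const]]
      have "(\<lambda>k. \<phi> \<omega> - (\<phi> \<omega> - d (I k \<omega>))) \<longlonglongrightarrow> \<phi> \<omega> - 0" "(\<lambda>k. \<psi> \<omega> - (\<psi> \<omega> - e (J k \<omega>))) \<longlonglongrightarrow> \<psi> \<omega> - 0" .
      then have "(\<lambda>k. d (I k \<omega>)) \<longlonglongrightarrow> \<phi> \<omega>" "(\<lambda>k. e (J k \<omega>)) \<longlonglongrightarrow> \<psi> \<omega>" by simp_all
      then show ?thesis by (intro tendsto_cemb tendsto_mult blinfun.tendsto tendsto_const)
    qed
    have "(\<lambda>k. cemb (v k (eval_form x y))) \<longlonglongrightarrow> expectation ?q"
      unfolding v_eval elem_tensor_eval_form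
    proof (rule integral_dominated_convergence[where w = "\<lambda>_. (2 * norm x) * (2 * norm y)"])
      show "?q \<in> borel_measurable M"
        unfolding cemb_mult by (intro borel_measurable_times \<phi>(2) \<psi>(2))
      show "(\<lambda>\<omega>. cemb (blinfun_apply (d (I k \<omega>)) x * blinfun_apply (e (J k \<omega>)) y)) \<in> borel_measurable M" for k
      proof -
        have "(\<lambda>\<omega>. (\<lambda>p. cemb (blinfun_apply (d (fst p)) x * blinfun_apply (e (snd p)) y)) (K k \<omega>)) \<in> borel_measurable M"
          by (rule measurable_compose[OF \<open>K k \<in> M \<rightarrow>\<^sub>M count_space UNIV\<close>]) simp
        then show ?thesis by (simp add: K_def)
      qed
      show "AE \<omega> in M. (\<lambda>k. cemb (blinfun_apply (d (I k \<omega>)) x * blinfun_apply (e (J k \<omega>)) y)) \<longlonglongrightarrow> ?q \<omega>"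
        using qlim by (rule AE_I2)
      show "AE \<omega> in M. norm (cemb (blinfun_apply (d (I k \<omega>)) x * blinfun_apply (e (J k \<omega>)) y)) \<le> (2 * norm x) * (2 * norm y)" for k
      proof (rule AE_I2)
        fix \<omega> assume \<omega>: "\<omega> \<in> space M"
        have "norm (blinfun_apply (d (I k \<omega>)) x) \<le> 2 * norm x" "norm (blinfun_apply (e (J k \<omega>)) y) \<le> 2 * norm y"
          using norm_blinfun[of "d (I k \<omega>)" x] norm_blinfun[of "e (J k \<omega>)" y]
            mult_right_mono[OF d2(1)[OF \<omega>, of k], of "norm x"] mult_right_mono[OF d2(2)[OF \<omega>, of k], of "norm y"]
          by simp_all
        then show "norm (cemb (blinfun_apply (d (I k \<omega>)) x * blinfun_apply (e (J k \<omega>)) y)) \<le> (2 * norm x) * (2 * norm y)"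
          unfolding norm_cemb norm_mult by (intro mult_mono) auto
      qed
    qed simp
    moreover have "(\<lambda>k. cemb (v k (eval_form x y))) \<longlonglongrightarrow> cemb (eval_lim v x y)"
      by (intro tendsto_cemb eval_lim[OF v])
    ultimately show "cemb (eval_lim v x y) = expectation ?q" by (rule LIMSEQ_unique[rotated])
  qed
qed


section \<open>Proximinality of the kernel\<close>

text \<open>The image of the closed ball of radius \<open>c\<close> of the projective tensor product under \<open>J\<close> is closed for
  pointwise convergence of the forms \<open>(x, y) \<mapsto> J z x y\<close>.\<close>

lemma alg_tensor_pointwise_limit:
  fixes sX :: "'k::real_or_complex \<Rightarrow> 'a::banach \<Rightarrow> 'a" and sY :: "'k \<Rightarrow> 'b::banach \<Rightarrow> 'b"
  assumes sep: "separable_space (top_of_set (dual sX))" "separable_space (top_of_set (dual sY))"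
    and u: "\<And>n. u n \<in> vcarrier (alg_tensor sX sY)" "\<And>n. vnorm (alg_tensor sX sY) (u n) < t n"
    and t: "t \<longlonglongrightarrow> c"
    and lim: "\<And>x y. (\<lambda>n. u n (eval_form x y)) \<longlonglongrightarrow> T x y"
  obtains v where "v \<in> vcauchy (alg_tensor sX sY)"
    "vnorm (proj_tensor sX sY) (alg_tensor.null_class sX sY v) \<le> c"
    "\<And>x y. eval_lim v x y = T x y"
proof -
  let ?E = "alg_tensor sX sY"
  have t0: "t n \<ge> 0" for n using alg_tensor.vnorm_nonneg[OF u(1)[of n]] u(2)[of n] by linarith
  then have c0: "c \<ge> 0" using t by (intro LIMSEQ_le_const) auto
  obtain a :: "nat \<Rightarrow> 'a" where a: "\<And>f. f \<in> dual sX \<Longrightarrow> norm f = (SUP j. norm (blinfun_apply f (a j)))"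
    by (rule separable_dual_sequences[OF sep(1)]) blast
  obtain b :: "nat \<Rightarrow> 'b" where b: "\<And>g. g \<in> dual sY \<Longrightarrow> norm g = (SUP j. norm (blinfun_apply g (b j)))"
    by (rule separable_dual_sequences[OF sep(2)]) blast
  define Q where "Q n P \<longleftrightarrow> set_pmf P \<subseteq> dual_ball sX \<times> dual_ball sY \<and> (\<forall>x y. cemb (u n (eval_form x y)) =
       t n *\<^sub>R (\<integral>p. cemb (blinfun_apply (fst p) x * blinfun_apply (snd p) y) \<partial>measure_pmf P))" for n P
  have "\<exists>P. Q n P" for n
    unfolding Q_def by (rule alg_tensor_as_expectation[OF u]) blast
  then obtain P where "\<And>n. Q n (P n)" by metis
  then have P: "\<And>n. set_pmf (P n) \<subseteq> dual_ball sX \<times> dual_ball sY"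
    and uP: "\<And>n x y. cemb (u n (eval_form x y)) =
       t n *\<^sub>R (\<integral>p. cemb (blinfun_apply (fst p) x * blinfun_apply (snd p) y) \<partial>measure_pmf (P n))"
    unfolding Q_def by blast+
  \<comment> \<open>A norming sequence separates functionals: a supremum of zeros is a zero
    norm.\<close>
  have sepX: "f = 0" if "f \<in> dual sX" "\<And>j. blinfun_apply f (a j) = 0" for f
    using a[OF that(1)] that(2) by simp
  have sepY: "g = 0" if "g \<in> dual sY" "\<And>j. blinfun_apply g (b j) = 0" for g
    using b[OF that(1)] that(2) by simp
  obtain r and \<Omega> :: "real measure" and \<phi> \<psi> where r: "strict_mono r" and \<Omega>: "prob_space \<Omega>"
    and \<phi>: "\<And>\<omega>. \<omega> \<in> space \<Omega> \<Longrightarrow> \<phi> \<omega> \<in> dual_ball sX" and \<psi>: "\<And>\<omega>. \<omega> \<in> space \<Omega> \<Longrightarrow> \<psi> \<omega> \<in> dual_ball sY"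
    and \<phi>m: "\<And>x. (\<lambda>\<omega>. cemb (blinfun_apply (\<phi> \<omega>) x)) \<in> borel_measurable \<Omega>"
    and \<psi>m: "\<And>y. (\<lambda>\<omega>. cemb (blinfun_apply (\<psi> \<omega>) y)) \<in> borel_measurable \<Omega>"
    and Plim: "\<And>x y. (\<lambda>n. \<integral>p. cemb (blinfun_apply (fst p) x * blinfun_apply (snd p) y) \<partial>measure_pmf (P (r n)))
       \<longlonglongrightarrow> (\<integral>\<omega>. cemb (blinfun_apply (\<phi> \<omega>) x * blinfun_apply (\<psi> \<omega>) y) \<partial>\<Omega>)"
    by (rule dual_ball_pairs_weak_limit[of sX a sY b P, OF sepX sepY P]) (assumption | rule that)+
  obtain v where v: "v \<in> vcauchy ?E" and v1: "vnorm (proj_tensor sX sY) (alg_tensor.null_class sX sY v) \<le> 1"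
    and vint: "\<And>x y. cemb (eval_lim v x y) = (\<integral>\<omega>. cemb (blinfun_apply (\<phi> \<omega>) x * blinfun_apply (\<psi> \<omega>) y) \<partial>\<Omega>)"
    by (rule bochner_tensor[OF sep \<Omega> \<phi> \<phi>m \<psi> \<psi>m]) (assumption | rule that)+
  \<comment> \<open>The integral has norm at most \<open>1\<close>; the limit \<open>c\<close> of
    the normalizing factors \<open>t n\<close> is restored here.\<close>
  define v' where "v' n = vscale ?E (of_real c) (v n)" for n
  have v': "v' \<in> vcauchy ?E" unfolding v'_def by (rule alg_tensor.vcauchy_scale[OF v])
  have v'_eval: "v' n B = of_real c * v n B" for n B by (simp add: v'_def alg_tensor_def)
  show thesis
  proof (rule that[OF v'])
    have "(\<lambda>n. vnorm ?E (v' n)) \<longlonglongrightarrow> c * vnorm (proj_tensor sX sY) (alg_tensor.null_class sX sY v)"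
      using tendsto_mult_left[OF alg_tensor.completion_norm[OF v], of c] v c0
      by (simp add: v'_def alg_tensor.vnorm_scale alg_tensor.vcauchy_carrier)
    then have "vnorm (proj_tensor sX sY) (alg_tensor.null_class sX sY v')
        = c * vnorm (proj_tensor sX sY) (alg_tensor.null_class sX sY v)"
      by (rule LIMSEQ_unique[OF alg_tensor.completion_norm[OF v']])
    then show "vnorm (proj_tensor sX sY) (alg_tensor.null_class sX sY v') \<le> c"
      using mult_left_mono[OF v1 c0] by simp
    fix x y
    have "(\<lambda>n. cemb (u (r n) (eval_form x y))) \<longlonglongrightarrow> c *\<^sub>R cemb (eval_lim v x y)"
      unfolding uP vint by (intro tendsto_scaleR Plim LIMSEQ_subseq_LIMSEQ[OF t r, unfolded o_def])
    moreover have "(\<lambda>n. cemb (u (r n) (eval_form x y))) \<longlonglongrightarrow> cemb (T x y)"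
      by (intro tendsto_cemb LIMSEQ_subseq_LIMSEQ[OF lim r, unfolded o_def])
    ultimately have "cemb (T x y) = cemb (c *\<^sub>R eval_lim v x y)"
      unfolding cemb_scaleR by (rule LIMSEQ_unique[rotated])
    then have "T x y = of_real c * eval_lim v x y" by (simp add: scaleR_conv_of_real)
    moreover have "eval_lim v' x y = of_real c * eval_lim v x y"
      by (rule eval_lim_eqI[OF v']) (simp only: v'_eval, intro tendsto_mult_left eval_lim[OF v])
    ultimately show "eval_lim v' x y = T x y" by simp
  qed
qed

text \<open>A late term of \<open>u\<close> serves: its norm falls below \<open>s\<close> by
  strictness, and its evaluations are within the Cauchy error of the limit, uniformly on bounded
  vectors.\<close>

lemma alg_tensor_approximation:
  assumes u: "u \<in> vcauchy (alg_tensor sX sY)" and e: "e > 0"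
    and less: "vnorm (proj_tensor sX sY) (alg_tensor.null_class sX sY u) < s"
  obtains w where "w \<in> vcarrier (alg_tensor sX sY)" "vnorm (alg_tensor sX sY) w < s"
    "\<And>x y. norm (w (eval_form x y) - eval_lim u x y) \<le> e * (norm x * norm y)"
proof -
  let ?E = "alg_tensor sX sY"
  obtain M where M: "\<forall>m\<ge>M. \<forall>n\<ge>M. vnorm ?E (u m - u n) < e"
    using u e unfolding alg_tensor.vcauchy_iff by blast
  have "\<forall>\<^sub>F n in sequentially. vnorm ?E (u n) < s"
    by (rule order_tendstoD(2)[OF alg_tensor.completion_norm[OF u] less])
  then obtain N where N: "\<And>n. n \<ge> N \<Longrightarrow> vnorm ?E (u n) < s"
    unfolding eventually_sequentially by blast
  define m where "m = max M N"
  have uc: "u n \<in> vcarrier ?E" for n by (rule alg_tensor.vcauchy_carrier[OF u])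
  show thesis
  proof
    show "u m \<in> vcarrier ?E" by (rule uc)
    show "vnorm ?E (u m) < s" by (rule N) (simp add: m_def)
    fix x y
    show "norm (u m (eval_form x y) - eval_lim u x y) \<le> e * (norm x * norm y)"
    proof (rule LIMSEQ_le_const2)
      show "(\<lambda>n. norm (u m (eval_form x y) - u n (eval_form x y))) \<longlonglongrightarrow> norm (u m (eval_form x y) - eval_lim u x y)"
        by (intro tendsto_norm tendsto_diff tendsto_const eval_lim[OF u])
      have "norm (u m (eval_form x y) - u n (eval_form x y)) \<le> e * (norm x * norm y)" if "n \<ge> M" for n
      proof -
        have "norm ((u m - u n) (eval_form x y)) \<le> vnorm ?E (u m - u n) * (norm x * norm y)"
          by (intro alg_tensor_eval_form_le alg_tensor.carrier_diff uc)
        also have "vnorm ?E (u m - u n) \<le> e"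
          using M that by (simp add: m_def less_imp_le)
        then have "vnorm ?E (u m - u n) * (norm x * norm y) \<le> e * (norm x * norm y)"
          by (rule mult_right_mono) simp
        finally show ?thesis by simp
      qed
      then show "\<exists>N. \<forall>n\<ge>N. norm (u m (eval_form x y) - u n (eval_form x y)) \<le> e * (norm x * norm y)" by blast
    qed
  qed
qed

lemma eval_lim_add:
  assumes u: "u \<in> vcauchy (alg_tensor sX sY)" and v: "v \<in> vcauchy (alg_tensor sX sY)"
  shows "eval_lim (\<lambda>n. u n + v n) x y = eval_lim u x y + eval_lim v x y"
  by (rule eval_lim_eqI[OF alg_tensor.vcauchy_add[OF u v]])
    (simp add: tendsto_add eval_lim[OF u] eval_lim[OF v])

lemma eval_lim_scale:
  assumes u: "u \<in> vcauchy (alg_tensor sX sY)"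
  shows "eval_lim (\<lambda>n. vscale (alg_tensor sX sY) c (u n)) x y = c * eval_lim u x y"
  by (rule eval_lim_eqI[OF alg_tensor.vcauchy_scale[OF u]])
    (simp add: alg_tensor_def tendsto_mult_left eval_lim[OF u])

lemma eval_lim_diff:
  assumes u: "u \<in> vcauchy (alg_tensor sX sY)" and v: "v \<in> vcauchy (alg_tensor sX sY)"
  shows "eval_lim (\<lambda>n. u n - v n) x y = eval_lim u x y - eval_lim v x y"
  by (rule eval_lim_eqI[OF alg_tensor.vcauchy_diff[OF u v]])
    (simp add: tendsto_diff eval_lim[OF u] eval_lim[OF v])

lemma vsubspace_kernel:
  fixes sX :: "'k::real_or_complex \<Rightarrow> 'a::banach \<Rightarrow> 'a" and sY :: "'k \<Rightarrow> 'b::banach \<Rightarrow> 'b"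
  shows "vsubspace (proj_tensor sX sY) (vkernel (proj_tensor sX sY) (nuclear_operators sX sY) (canonical_map sX sY))"
  unfolding vsubspace_def kernel_canonical_map
proof (intro conjI ballI allI)
  let ?E = "alg_tensor sX sY"
  let ?W = "alg_tensor.null_class sX sY ` {u \<in> vcauchy ?E. \<forall>x y. eval_lim u x y = 0}"
  have z: "(\<lambda>_. 0) \<in> vcauchy ?E" by (rule alg_tensor.vcauchy_const[OF alg_tensor.carrier_zero])
  have "eval_lim (\<lambda>_. 0) x y = (0 :: 'k)" for x :: 'a and y :: 'b by (rule eval_lim_eqI[OF z]) simp
  then show "vzero (proj_tensor sX sY) \<in> ?W"
    using z by (auto simp: alg_tensor.completion_zero)
  show "?W \<subseteq> vcarrier (proj_tensor sX sY)" by (auto simp: alg_tensor.completion_carrier)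
  show "vadd (proj_tensor sX sY) u v \<in> ?W" if "u \<in> ?W" "v \<in> ?W" for u v
    using that by (auto simp: alg_tensor.completion_add alg_tensor.vcauchy_add eval_lim_add intro!: imageI)
  show "vscale (proj_tensor sX sY) c u \<in> ?W" if "u \<in> ?W" for c u
    using that by (auto simp: alg_tensor.completion_scale alg_tensor.vcauchy_scale eval_lim_scale intro!: imageI)
qed

theorem theorem4p4:
  fixes sX :: "'k::real_or_complex \<Rightarrow> 'a::banach \<Rightarrow> 'a"
    and sY :: "'k \<Rightarrow> 'b::banach \<Rightarrow> 'b"
  assumes "banach_space_over sX" and "banach_space_over sY"
    and "separable_space (top_of_set (dual sX))"
    and "separable_space (top_of_set (dual sY))"
  shows "proximinal_subspace (proj_tensor sX sY)
           (vkernel (proj_tensor sX sY) (nuclear_operators sX sY) (canonical_map sX sY))"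
  unfolding proximinal_subspace_def
proof (intro conjI ballI vsubspace_kernel)
  let ?E = "alg_tensor sX sY" and ?Z = "proj_tensor sX sY" and ?cl = "alg_tensor.null_class sX sY"
  let ?W = "vkernel ?Z (nuclear_operators sX sY) (canonical_map sX sY)"
  have W: "w \<in> ?W \<longleftrightarrow> (\<exists>u. w = ?cl u \<and> u \<in> vcauchy ?E \<and> (\<forall>x y. eval_lim u x y = 0))" for w
    unfolding kernel_canonical_map by blast
  fix z assume "z \<in> vcarrier ?Z"
  then obtain u where u: "u \<in> vcauchy ?E" and z: "z = ?cl u"
    by (auto simp: alg_tensor.completion_carrier)
  define c where "c = (INF w\<in>?W. vdist ?Z z w)"
  have "0 \<le> vdist ?Z z w" if "w \<in> ?W" for w
    using that \<open>z \<in> vcarrier ?Z\<close> by (intro alg_tensor.completion_dist_nonneg) (simp_all add: vkernel_def)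
  then have bdd: "bdd_below (vdist ?Z z ` ?W)" by (rule bdd_belowI2)
  have ne: "?W \<noteq> {}"
    using vsubspace_kernel[of sX sY] unfolding vsubspace_def by blast
  \<comment> \<open>The margin \<open>1 / Suc n\<close> over the infimum yields a kernel element
    \<open>w\<close>; then \<open>u - w'\<close> still has the evaluations of \<open>u\<close>, and
    its norm is the distance from \<open>z\<close> to \<open>w\<close>.\<close>
  have "\<exists>s. s \<in> vcarrier ?E \<and> vnorm ?E s < c + 1 / Suc n \<and>
      (\<forall>x y. norm (s (eval_form x y) - eval_lim u x y) \<le> 1 / Suc n * (norm x * norm y))" for n
  proof -
    have "c < c + 1 / Suc n" by simp
    then obtain w where "w \<in> ?W" and wlt: "vdist ?Z z w < c + 1 / Suc n"
      unfolding c_def by (subst (asm) cINF_less_iff[OF ne bdd]) blast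
    then obtain w' where w': "w = ?cl w'" "w' \<in> vcauchy ?E" "\<And>x y. eval_lim w' x y = 0"
      unfolding W by blast
    have "vnorm ?Z (?cl (\<lambda>n. u n - w' n)) < c + 1 / Suc n"
      using wlt by (simp add: z w' alg_tensor.completion_dist_eq_norm u)
    then show ?thesis
      by (rule alg_tensor_approximation[OF alg_tensor.vcauchy_diff[OF u w'(2)], of "1 / Suc n", rotated])
        (auto simp: eval_lim_diff[OF u w'(2)] w'(3))
  qed
  then obtain s where s: "\<And>n. s n \<in> vcarrier ?E" "\<And>n. vnorm ?E (s n) < c + 1 / Suc n"
    and s_eval: "\<And>n x y. norm (s n (eval_form x y) - eval_lim u x y) \<le> 1 / Suc n * (norm x * norm y)"
    by metis
  have inv0: "(\<lambda>n. 1 / real (Suc n)) \<longlonglongrightarrow> 0"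
    using LIMSEQ_inverse_real_of_nat by (simp add: inverse_eq_divide)
  have t: "(\<lambda>n. c + 1 / Suc n) \<longlonglongrightarrow> c"
    using tendsto_add[OF tendsto_const[of c] inv0] by simp
  have lim: "(\<lambda>n. s n (eval_form x y)) \<longlonglongrightarrow> eval_lim u x y" for x y
    using Lim_null_comparison[OF always_eventually[OF allI[OF s_eval]] tendsto_mult_left_zero[OF inv0]]
    by (simp add: Lim_null[symmetric])
  obtain v where v: "v \<in> vcauchy ?E" and v_norm: "vnorm ?Z (?cl v) \<le> c"
    and v_eval: "\<And>x y. eval_lim v x y = eval_lim u x y"
    by (rule alg_tensor_pointwise_limit[OF assms(3,4) s t lim]) blast
  have uv: "(\<lambda>n. u n - v n) \<in> vcauchy ?E" by (rule alg_tensor.vcauchy_diff[OF u v])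
  have mem: "?cl (\<lambda>n. u n - v n) \<in> ?W"
    unfolding W using uv by (auto simp: eval_lim_diff[OF u v] v_eval)
  \<comment> \<open>Termwise \<open>u n - (u n - v n) = v n\<close>, so this distance is the norm of
    the class of \<open>v\<close>.\<close>
  have "vdist ?Z z (?cl (\<lambda>n. u n - v n)) \<le> c"
    using v_norm by (simp add: z alg_tensor.completion_dist_eq_norm[OF u uv])
  moreover have "c \<le> vdist ?Z z (?cl (\<lambda>n. u n - v n))"
    unfolding c_def by (rule cINF_lower[OF bdd mem])
  ultimately show "\<exists>w\<in>?W. vdist ?Z z w = (INF w'\<in>?W. vdist ?Z z w')"
    using mem unfolding c_def by (intro bexI[OF _ mem]) simp
qed

end
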